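(* Let $p \ge q \ge 2$ be integers. The partitioning orbitope $\mathrm{O}^{=}_{p,q}(\mathfrak{S}_q)$ with respect to the symmetric group $\mathfrak{S}_q$ equals the set of all $x \in \mathbb{R}^{\mathcal{I}_{p,q}}$ that satisfy the following linear constraints: (a) the row-sum equations $x(\mathrm{row}_i) = 1$ for all $i \in [p]$; (b) the nonnegativity constraints $x_{ij} \ge 0$ for all $(i,j) \in \mathcal{I}_{p,q} \setminus \{(j,j) : j < q\}$; (c) the shifted column inequalities $x(B) - x(S) \le 0$ for all bars $B = \{(i,j),(i,j+1),\dots,(i,\min\{i,q\})\}$ with $(i,j) = \langle \eta,j\rangle \in \mathcal{I}_{p,q}$, $j \ge 2$, and all shifted columns $S = \{\langle 1,c_1\rangle, \langle 2,c_2\rangle,\dots,\langle \eta,c_\eta\rangle\}$ with $2 \le c_1 = c_2 \le \dots \le c_\eta \le j-1$, where in case of $\eta = 1$ the last condition reduces to $2 \le c_1$ and we additionally require $j = c_1+1$. This system of constraints is non-redundant. The corresponding separation problem can be solved in time $O(pq)$.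
   Context: Notation: $[n] = \{1,\dots,n\}$. The symmetric group $\mathfrak{S}_q$ acts on the set $\{0,1\}^{[p]\times[q]}$ of $0/1$-matrices by permuting columns. Let $\prec$ be the lexicographic order on $\{0,1\}^{[p]\times[q]}$ with respect to the row-wise ordering $(1,1)<(1,2)<\dots<(1,q)<(2,1)<\dots<(p,q)$ of positions, i.e. $A\prec B$ iff $a_{k\ell}<b_{k\ell}$ at the first position $(k,\ell)$ where $A,B$ differ. The partitioning orbitope $\mathrm{O}^{=}_{p,q}(\mathfrak{S}_q)$ is the convex hull of all $0/1$-matrices of size $p\times q$ that have exactly one $1$-entry in each row and are $\prec$-maximal within their $\mathfrak{S}_q$-orbit. All these matrices satisfy $x_{ij}=0$ for $i<j$; these coordinates are dropped, and the orbitope is regarded as a subset of $\mathbb{R}^{\mathcal{I}_{p,q}}$, where $\mathcal{I}_{p,q}=\{(i,j)\in[p]\times[q] : i\ge j\}$. For $T\subseteq\mathcal{I}_{p,q}$ write $x(T)=\sum_{(i,j)\in T}x_{ij}$. Let $\mathrm{row}_i=\{(i,1),\dots,(i,\min\{i,q\})\}$. Diagonal coordinates: $\langle\eta,j\rangle := (j+\eta-1,j)$ for $j\in[q]$, $1\le\eta\le p-j+1$. A system of constraints is non-redundant if dropping any single constraint (equation or inequality) enlarges its solution set. The separation problem: given $x^\star\in\mathbb{Q}^{\mathcal{I}_{p,q}}$, decide whether $x^\star$ satisfies all constraints of the system and, if not, output a violated one. Running times are counted in the unit-cost (arithmetic operation) model. *)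

theory Defs
  imports "HOL-Analysis.Analysis" "HOL-Analysis.Finite_Function_Topology"
    "HOL-Combinatorics.Permutations"
begin

section \<open>Partitioning orbitopes\<close>

type_synonym pos = "nat \<times> nat"

definition index_set :: "nat \<Rightarrow> nat \<Rightarrow> pos set" where
  "index_set p q = {(i, j). i \<in> {1..p} \<and> j \<in> {1..q} \<and> j \<le> i}"

text \<open>The space of vectors with coordinates in \<^term>\<open>index_set p q\<close> is represented by the finitely
  supported functions that vanish outside \<^term>\<open>index_set p q\<close>. It is used over the reals
  (polyhedra) and over the rationals (inputs of the separation problem).\<close>

definition coord_space :: "nat \<Rightarrow> nat \<Rightarrow> (pos \<Rightarrow>\<^sub>0 'a::zero) set" where
  "coord_space p q = {x. Poly_Mapping.keys x \<subseteq> index_set p q}"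

definition zero_one_matrices :: "nat \<Rightarrow> nat \<Rightarrow> (nat \<Rightarrow> nat \<Rightarrow> nat) set" where
  "zero_one_matrices p q =
     {A. (\<forall>i\<in>{1..p}. \<forall>j\<in>{1..q}. A i j \<in> {0, 1}) \<and>
         (\<forall>i j. (i, j) \<notin> {1..p} \<times> {1..q} \<longrightarrow> A i j = 0)}"

definition column_orbit :: "nat \<Rightarrow> (nat \<Rightarrow> nat \<Rightarrow> nat) \<Rightarrow> (nat \<Rightarrow> nat \<Rightarrow> nat) set" where
  "column_orbit q A = {(\<lambda>i j. A i (\<pi> j)) | \<pi>. \<pi> permutes {1..q}}"

definition pos_before :: "pos \<Rightarrow> pos \<Rightarrow> bool" where
  "pos_before k l \<longleftrightarrow> fst k < fst l \<or> fst k = fst l \<and> snd k < snd l"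

definition lex_less ::
    "nat \<Rightarrow> nat \<Rightarrow> (nat \<Rightarrow> nat \<Rightarrow> nat) \<Rightarrow> (nat \<Rightarrow> nat \<Rightarrow> nat) \<Rightarrow> bool" where
  "lex_less p q A B \<longleftrightarrow>
     (\<exists>k\<in>{1..p}. \<exists>l\<in>{1..q}. A k l < B k l \<and>
        (\<forall>i\<in>{1..p}. \<forall>j\<in>{1..q}. pos_before (i, j) (k, l) \<longrightarrow> A i j = B i j))"

definition orbit_representatives :: "nat \<Rightarrow> nat \<Rightarrow> (nat \<Rightarrow> nat \<Rightarrow> nat) set" where
  "orbit_representatives p q =
     {A \<in> zero_one_matrices p q.
        (\<forall>i\<in>{1..p}. \<exists>!j. j \<in> {1..q} \<and> A i j = 1) \<and>
        (\<forall>B\<in>column_orbit q A. \<not> lex_less p q A B)}"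

text \<open>The coordinates above the diagonal, which vanish on all representatives, are dropped.\<close>

definition partitioning_orbitope :: "nat \<Rightarrow> nat \<Rightarrow> (pos \<Rightarrow>\<^sub>0 real) set" where
  "partitioning_orbitope p q =
     convex hull {x \<in> coord_space p q.
       \<exists>A\<in>orbit_representatives p q.
         \<forall>(i, j)\<in>index_set p q. Poly_Mapping.lookup x (i, j) = real (A i j)}"


section \<open>The system of linear constraints\<close>

datatype lin_constraint =
    Sum_Eq_One "pos set"
  | Nonneg pos
  | Diff_Nonpos "pos set" "pos set"

definition coord_sum :: "(pos \<Rightarrow>\<^sub>0 'a::comm_monoid_add) \<Rightarrow> pos set \<Rightarrow> 'a" where
  "coord_sum x T = (\<Sum>k\<in>T. Poly_Mapping.lookup x k)"

fun satisfies :: "(pos \<Rightarrow>\<^sub>0 'a::linordered_field) \<Rightarrow> lin_constraint \<Rightarrow> bool" where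
  "satisfies x (Sum_Eq_One T) \<longleftrightarrow> coord_sum x T = 1"
| "satisfies x (Nonneg k) \<longleftrightarrow> Poly_Mapping.lookup x k \<ge> 0"
| "satisfies x (Diff_Nonpos B S) \<longleftrightarrow> coord_sum x B - coord_sum x S \<le> 0"

definition solution_set :: "nat \<Rightarrow> nat \<Rightarrow> lin_constraint set \<Rightarrow> (pos \<Rightarrow>\<^sub>0 real) set" where
  "solution_set p q C = {x \<in> coord_space p q. \<forall>c\<in>C. satisfies x c}"

definition nonredundant :: "nat \<Rightarrow> nat \<Rightarrow> lin_constraint set \<Rightarrow> bool" where
  "nonredundant p q C \<longleftrightarrow> (\<forall>c\<in>C. solution_set p q C \<subset> solution_set p q (C - {c}))"

definition row_set :: "nat \<Rightarrow> nat \<Rightarrow> pos set" where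
  "row_set q i = {(i, j) | j. j \<in> {1..min i q}}"

definition diag_coord :: "nat \<Rightarrow> nat \<Rightarrow> pos" where
  "diag_coord \<eta> j = (j + \<eta> - 1, j)"

definition bar :: "nat \<Rightarrow> pos \<Rightarrow> pos set" where
  "bar q k = {(fst k, l) | l. l \<in> {snd k..min (fst k) q}}"

definition shifted_column :: "nat \<Rightarrow> (nat \<Rightarrow> nat) \<Rightarrow> pos set" where
  "shifted_column \<eta> c = {diag_coord k (c k) | k. k \<in> {1..\<eta>}}"

definition admissible_columns :: "nat \<Rightarrow> nat \<Rightarrow> (nat \<Rightarrow> nat) \<Rightarrow> bool" where
  "admissible_columns \<eta> j c \<longleftrightarrow>
     (if \<eta> = 1 then 2 \<le> c 1 \<and> j = c 1 + 1
      else 2 \<le> c 1 \<and> c 1 = c 2 \<and> (\<forall>k\<in>{2..<\<eta>}. c k \<le> c (k + 1)) \<and> c \<eta> \<le> j - 1)"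

definition orbitope_system :: "nat \<Rightarrow> nat \<Rightarrow> lin_constraint set" where
  "orbitope_system p q =
     {Sum_Eq_One (row_set q i) | i. i \<in> {1..p}} \<union>
     {Nonneg k | k. k \<in> index_set p q - {(j, j) | j. j < q}} \<union>
     {Diff_Nonpos (bar q (diag_coord \<eta> j)) (shifted_column \<eta> c) | \<eta> j c.
        1 \<le> \<eta> \<and> 2 \<le> j \<and> diag_coord \<eta> j \<in> index_set p q \<and> admissible_columns \<eta> j c}"


section \<open>Unit-cost random access programs\<close>

text \<open>
  Programs operate on cells holding natural numbers (used for indices and for the output) and
  cells holding exact rational numbers. A cell is addressed by an array name together with a list
  of index values; scalar variables are arrays with the empty index list. As the number of index
  expressions at each access is fixed by the program text, each arithmetic operation, comparison,
  cell access and control step is charged one unit. Subtraction of natural numbers is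
  truncated, and division by the rational 0 yields 0. There is no conversion from rationals
  to natural numbers.
\<close>

datatype nexp =
    NConst nat
  | NCell string "nexp list"
  | NAdd nexp nexp
  | NSub nexp nexp
  | NMul nexp nexp

datatype qexp =
    QConst rat
  | QCell string "nexp list"
  | QAdd qexp qexp
  | QSub qexp qexp
  | QMul qexp qexp
  | QDiv qexp qexp

datatype bexp =
    NLess nexp nexp
  | NEq nexp nexp
  | QLess qexp qexp
  | QEq qexp qexp
  | BNot bexp
  | BAnd bexp bexp

datatype com =
    Skip
  | NAssign string "nexp list" nexp
  | QAssign string "nexp list" qexp
  | Seq com com
  | Cond bexp com com
  | While bexp com

type_synonym store = "(string \<Rightarrow> nat list \<Rightarrow> nat) \<times> (string \<Rightarrow> nat list \<Rightarrow> rat)"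

primrec nval :: "store \<Rightarrow> nexp \<Rightarrow> nat" where
  "nval s (NConst n) = n"
| "nval s (NCell a es) = fst s a (map (nval s) es)"
| "nval s (NAdd e f) = nval s e + nval s f"
| "nval s (NSub e f) = nval s e - nval s f"
| "nval s (NMul e f) = nval s e * nval s f"

primrec ncost :: "nexp \<Rightarrow> nat" where
  "ncost (NConst n) = 1"
| "ncost (NCell a es) = 1 + sum_list (map ncost es)"
| "ncost (NAdd e f) = 1 + ncost e + ncost f"
| "ncost (NSub e f) = 1 + ncost e + ncost f"
| "ncost (NMul e f) = 1 + ncost e + ncost f"

primrec qval :: "store \<Rightarrow> qexp \<Rightarrow> rat" where
  "qval s (QConst r) = r"
| "qval s (QCell a es) = snd s a (map (nval s) es)"
| "qval s (QAdd e f) = qval s e + qval s f"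
| "qval s (QSub e f) = qval s e - qval s f"
| "qval s (QMul e f) = qval s e * qval s f"
| "qval s (QDiv e f) = qval s e / qval s f"

primrec qcost :: "qexp \<Rightarrow> nat" where
  "qcost (QConst r) = 1"
| "qcost (QCell a es) = 1 + sum_list (map ncost es)"
| "qcost (QAdd e f) = 1 + qcost e + qcost f"
| "qcost (QSub e f) = 1 + qcost e + qcost f"
| "qcost (QMul e f) = 1 + qcost e + qcost f"
| "qcost (QDiv e f) = 1 + qcost e + qcost f"

primrec bval :: "store \<Rightarrow> bexp \<Rightarrow> bool" where
  "bval s (NLess e f) \<longleftrightarrow> nval s e < nval s f"
| "bval s (NEq e f) \<longleftrightarrow> nval s e = nval s f"
| "bval s (QLess e f) \<longleftrightarrow> qval s e < qval s f"
| "bval s (QEq e f) \<longleftrightarrow> qval s e = qval s f"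
| "bval s (BNot b) \<longleftrightarrow> \<not> bval s b"
| "bval s (BAnd a b) \<longleftrightarrow> bval s a \<and> bval s b"

primrec bcost :: "bexp \<Rightarrow> nat" where
  "bcost (NLess e f) = 1 + ncost e + ncost f"
| "bcost (NEq e f) = 1 + ncost e + ncost f"
| "bcost (QLess e f) = 1 + qcost e + qcost f"
| "bcost (QEq e f) = 1 + qcost e + qcost f"
| "bcost (BNot b) = 1 + bcost b"
| "bcost (BAnd a b) = 1 + bcost a + bcost b"

definition update_cell ::
    "(string \<Rightarrow> nat list \<Rightarrow> 'v) \<Rightarrow> string \<Rightarrow> nat list \<Rightarrow> 'v \<Rightarrow> (string \<Rightarrow> nat list \<Rightarrow> 'v)" where
  "update_cell m a is v = m(a := (m a)(is := v))"

text \<open>\<open>runs c s t s'\<close>: started in store \<open>s\<close>, program \<open>c\<close> terminates in store \<open>s'\<close> after exactly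
  \<open>t\<close> time units.\<close>

inductive runs :: "com \<Rightarrow> store \<Rightarrow> nat \<Rightarrow> store \<Rightarrow> bool" where
  Skip: "runs Skip s 1 s"
| NAssign: "runs (NAssign a es e) s (1 + sum_list (map ncost es) + ncost e)
     (update_cell (fst s) a (map (nval s) es) (nval s e), snd s)"
| QAssign: "runs (QAssign a es e) s (1 + sum_list (map ncost es) + qcost e)
     (fst s, update_cell (snd s) a (map (nval s) es) (qval s e))"
| Seq: "runs c s t s' \<Longrightarrow> runs d s' u s'' \<Longrightarrow> runs (Seq c d) s (t + u) s''"
| IfTrue: "bval s b \<Longrightarrow> runs c s t s' \<Longrightarrow> runs (Cond b c d) s (1 + bcost b + t) s'"
| IfFalse: "\<not> bval s b \<Longrightarrow> runs d s t s' \<Longrightarrow> runs (Cond b c d) s (1 + bcost b + t) s'"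
| WhileFalse: "\<not> bval s b \<Longrightarrow> runs (While b c) s (1 + bcost b) s"
| WhileTrue: "bval s b \<Longrightarrow> runs c s t s' \<Longrightarrow> runs (While b c) s' u s'' \<Longrightarrow>
     runs (While b c) s (1 + bcost b + t + u) s''"


section \<open>The separation problem\<close>

text \<open>Input: the scalars \<open>p\<close>, \<open>q\<close> and the rational array \<open>x\<close>; all other cells are 0.\<close>

definition input_store :: "nat \<Rightarrow> nat \<Rightarrow> (pos \<Rightarrow>\<^sub>0 rat) \<Rightarrow> store" where
  "input_store p q x =
     ((\<lambda>a is. if a = ''p'' \<and> is = [] then p else if a = ''q'' \<and> is = [] then q else 0),
      (\<lambda>a is. if a = ''x'' then (case is of [i, j] \<Rightarrow> Poly_Mapping.lookup x (i, j) | _ \<Rightarrow> 0) else 0))"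

text \<open>Output: scalar \<open>answer\<close> is 0 if all constraints are claimed to hold, and otherwise the type of
  the returned constraint, which is then described by further cells: the row \<open>i\<close>, the
  position \<open>(i, j)\<close>, or the diagonal coordinates \<open>\<langle>eta, j\<rangle>\<close> of the first element of the bar and
  the columns \<open>c[1], \<dots>, c[eta]\<close> of the shifted column.\<close>

definition output_constraint :: "nat \<Rightarrow> store \<Rightarrow> lin_constraint option" where
  "output_constraint q s =
     (let var = (\<lambda>a. fst s a []) in
      if var ''answer'' = 0 then None
      else if var ''answer'' = 1 then Some (Sum_Eq_One (row_set q (var ''i'')))
      else if var ''answer'' = 2 then Some (Nonneg (var ''i'', var ''j''))
      else Some (Diff_Nonpos (bar q (diag_coord (var ''eta'') (var ''j'')))
                             (shifted_column (var ''eta'') (\<lambda>k. fst s ''c'' [k]))))"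

definition separates :: "lin_constraint set \<Rightarrow> (pos \<Rightarrow>\<^sub>0 rat) \<Rightarrow> lin_constraint option \<Rightarrow> bool" where
  "separates C x r \<longleftrightarrow>
     (case r of None \<Rightarrow> \<forall>c\<in>C. satisfies x c | Some c \<Rightarrow> c \<in> C \<and> \<not> satisfies x c)"

definition solves_separation_within :: "com \<Rightarrow> nat \<Rightarrow> nat \<Rightarrow> (pos \<Rightarrow>\<^sub>0 rat) \<Rightarrow> nat \<Rightarrow> bool" where
  "solves_separation_within prog p q x T \<longleftrightarrow>
     (\<exists>t s. runs prog (input_store p q x) t s \<and> t \<le> T \<and>
        separates (orbitope_system p q) x (output_constraint q s))"

end

theory Submission
  imports Defs
begin

text \<open>
  The lexicographically maximal matrices correspond to restricted growth functions \<open>r\<close>: the one in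
  row \<open>i\<close> is at column \<open>r i \<le> 1 + max {r 1, \<dots>, r (i - 1)}\<close>. A point \<open>x\<close> lies in their convex hull iff there
  is a random growth function with \<open>P (r i = j) = x\<^sub>i\<^sub>j\<close>. To build one as a Markov chain in the running
  maximum, let the maximum grow as fast as \<open>x\<close> permits. The resulting tail probabilities satisfy
  \<open>F i j = min (F (i - 1) j + x\<^sub>i\<^sub>j) (F (i - 1) (j - 1))\<close>, which is also the recursion for the minimum of
  \<open>x(S)\<close> over all shifted columns \<open>S\<close>. The rest of row \<open>i\<close> can be distributed over the states of
  the chain iff \<open>x(B) \<le> F i j\<close> for all bars \<open>B\<close> starting at \<open>(i, j)\<close>, and this follows from the shifted column
  inequalities. The same recursion, evaluated in one pass over the matrix, solves the separation
  problem. For non-redundancy, a point violating only the given constraint is constructed.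
\<close>

section \<open>Cheapest shifted columns\<close>

text \<open>Greedy growth of the maximum fixes which mass raises it in row i: from state j - 1 the
  amount F i j - F (i - 1) j goes to column j. What remains in state m may use any column up to m.
  These sets of columns are nested, so the Hall condition of the remaining transport problem reduces
  to prefix sums, and the prefix sums are exactly the bar conditions. The obstacle in the
  non-redundancy proof is a long shifted column S: it must become the unique cheapest one while all
  other inequalities survive, including those whose bars lie in the rows that S crosses. The weights
  are therefore potential differences P (k - 1) c - P k c along the diagonals. A column sum then
  telescopes into prices for moving between columns, with the moves of S for free, and a large
  constant per cell makes longer columns dearer. A bar is a descending path in this picture. Because
  c_1 = c_2, shifted columns never move at step 1, so the price of that step can be chosen to keep
  the bars light.\<close>

text \<open>For \<open>2 \<le> j \<le> i\<close>, \<open>cheapest f i j\<close> is the minimum weight of a shifted column of length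
  \<open>i - j + 1\<close> that ends in a column up to \<open>j\<close> (in column \<open>j\<close> itself if the length is 1). The
  values for \<open>j \<le> 1\<close> are meaningless.\<close>

primrec cheapest :: "(pos \<Rightarrow> 'a::linordered_field) \<Rightarrow> nat \<Rightarrow> nat \<Rightarrow> 'a" where
  "cheapest f 0 j = 0"
| "cheapest f (Suc i) j =
     (if 2 < j \<and> j \<le> i \<and> cheapest f i (j - 1) < cheapest f i j + f (Suc i, j)
      then cheapest f i (j - 1) else cheapest f i j + f (Suc i, j))"

text \<open>The column in which the minimizer behind \<open>cheapest\<close> ends: a diagonal move
  inherits it, a vertical move ends in j. The guard \<open>j \<le> i\<close> withholds the diagonal
  move at length 1, which is what forces c_1 = c_2; \<open>2 < j\<close> keeps column 1 out. The
  value in row 0 is arbitrary.\<close>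

primrec last_col :: "(pos \<Rightarrow> 'a::linordered_field) \<Rightarrow> nat \<Rightarrow> nat \<Rightarrow> nat" where
  "last_col f 0 j = j"
| "last_col f (Suc i) j =
     (if 2 < j \<and> j \<le> i \<and> cheapest f i (j - 1) < cheapest f i j + f (Suc i, j)
      then last_col f i (j - 1) else j)"

text \<open>Reads off a minimizer from its end. Columns of length \<eta> + 1 counted up to column d
  belong to the cell (d + \<eta>, d); once the last entry is placed in column v, the rest has length
  \<eta> and belongs to (v + \<eta> - 1, v).\<close>

primrec backtrack :: "(pos \<Rightarrow> 'a::linordered_field) \<Rightarrow> nat \<Rightarrow> nat \<Rightarrow> nat \<Rightarrow> nat" where
  "backtrack f 0 d = (\<lambda>_. 0)"
| "backtrack f (Suc \<eta>) d = (backtrack f \<eta> (last_col f (d + \<eta>) d))(Suc \<eta> := last_col f (d + \<eta>) d)"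

text \<open>Zeros above the diagonal make the vertical recursion in column j effectively start at
  (j, j), as a shifted column does.\<close>

definition lower_triangular :: "(pos \<Rightarrow> 'a::zero) \<Rightarrow> bool" where
  "lower_triangular f \<longleftrightarrow> (\<forall>i j. i < j \<longrightarrow> f (i, j) = 0)"

lemma cheapest_above_diag:
  assumes "lower_triangular f" "i < j"
  shows "cheapest f i j = 0"
  using assms(2) by (induction i) (use assms(1) in \<open>auto simp: lower_triangular_def\<close>)

lemma cheapest_diag:
  assumes "lower_triangular f"
  shows "cheapest f (Suc i) (Suc i) = f (Suc i, Suc i)"
  by (simp add: cheapest_above_diag[OF assms])

lemma cheapest_le_extend: "cheapest f (Suc i) j \<le> cheapest f i j + f (Suc i, j)"
  by auto

text \<open>Along a diagonal the length of the columns is constant while the range for the last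
  column grows. The hypothesis \<open>j < i\<close> means length at least 2: a column of length 1 is
  tied to its exact column.\<close>

lemma cheapest_antitone_diag:
  assumes "2 \<le> j" "j < i"
  shows "cheapest f (i + n) (j + n) \<le> cheapest f i j"
proof (induction n)
  case (Suc n)
  have "cheapest f (i + Suc n) (j + Suc n) \<le> cheapest f (i + n) (j + n)"
    using assms by auto
  with Suc show ?case by simp
qed simp

definition column_sum :: "(pos \<Rightarrow> 'a::comm_monoid_add) \<Rightarrow> nat \<Rightarrow> (nat \<Rightarrow> nat) \<Rightarrow> 'a" where
  "column_sum f \<eta> c = (\<Sum>k\<in>{1..\<eta>}. f (diag_coord k (c k)))"

lemma column_sum_Suc: "column_sum f (Suc \<eta>) c = column_sum f \<eta> c + f (c (Suc \<eta>) + \<eta>, c (Suc \<eta>))"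
  by (simp add: column_sum_def diag_coord_def)

text \<open>The part of admissibility that does not mention the bar. It is inherited by prefixes of
  a column, which the inductions on the length require.\<close>

definition admissible_path :: "nat \<Rightarrow> (nat \<Rightarrow> nat) \<Rightarrow> bool" where
  "admissible_path \<eta> c \<longleftrightarrow> 2 \<le> c 1 \<and> (2 \<le> \<eta> \<longrightarrow> c 2 = c 1) \<and> (\<forall>k\<in>{2..<\<eta>}. c k \<le> c (k + 1))"

lemma admissible_columns_iff:
  assumes "1 \<le> \<eta>" "2 \<le> j"
  shows "admissible_columns \<eta> j c \<longleftrightarrow> admissible_path \<eta> c \<and>
    (if \<eta> = 1 then c \<eta> = j - 1 else c \<eta> \<le> j - 1)"
  using assms unfolding admissible_columns_def admissible_path_def by auto

lemma admissible_path_Suc: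
  assumes "1 \<le> \<eta>"
  shows "admissible_path (Suc \<eta>) c \<longleftrightarrow> admissible_path \<eta> c \<and>
    (if \<eta> = 1 then c 2 = c 1 else c \<eta> \<le> c (Suc \<eta>))"
proof -
  have "\<eta> = 1 \<or> 2 \<le> \<eta>" using assms by auto
  then show ?thesis
    unfolding admissible_path_def using assms by (auto simp: atLeastLessThanSuc)
qed

lemma admissible_path_step:
  assumes "admissible_path \<eta> c" "1 \<le> k" "k < \<eta>"
  shows "c k \<le> c (Suc k)"
proof (cases "k = 1")
  case True
  then show ?thesis using assms by (simp add: admissible_path_def numeral_2_eq_2)
next
  case False
  then show ?thesis using assms by (auto simp: admissible_path_def)
qed

lemma admissible_path_mono:
  assumes "admissible_path \<eta> c" "1 \<le> k" "k \<le> l" "l \<le> \<eta>"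
  shows "c k \<le> c l"
  using assms(3,4)
proof (induction l rule: dec_induct)
  case (step n)
  then show ?case using admissible_path_step[OF assms(1), of n] assms(2) by simp
qed simp

lemma admissible_path_ge2:
  assumes "admissible_path \<eta> c" "1 \<le> k" "k \<le> \<eta>"
  shows "2 \<le> c k"
  using admissible_path_mono[OF assms(1), of 1 k] assms by (auto simp: admissible_path_def)

text \<open>Cutting off the last entry leaves a shorter column ending in \<open>c \<eta>\<close>.
  Sliding its cell along the diagonal to column \<open>c (Suc \<eta>)\<close> does not increase
  \<open>cheapest\<close>, and one vertical move adds the last entry.\<close>

lemma cheapest_le_column_sum:
  assumes van: "lower_triangular f"
  assumes "1 \<le> \<eta>" "admissible_path \<eta> c"
  shows "cheapest f (c \<eta> + \<eta> - 1) (c \<eta>) \<le> column_sum f \<eta> c"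
  using assms(2,3)
proof (induction \<eta> rule: dec_induct)
  case base
  then have "2 \<le> c 1" by (simp add: admissible_path_def)
  then show ?case using cheapest_diag[of f "c 1 - 1", OF van]
    by (simp add: column_sum_def diag_coord_def)
next
  case (step \<eta>)
  let ?c = "c \<eta>" and ?c' = "c (Suc \<eta>)"
  have ap: "admissible_path \<eta> c" and ge: "2 \<le> ?c"
    using step.prems step.hyps admissible_path_Suc admissible_path_ge2 by auto
  have le: "?c \<le> ?c'" using admissible_path_step[OF step.prems, of \<eta>] step.hyps by simp
  \<comment> \<open>Columns of length 1 cannot be slid; there c_1 = c_2 makes the two cells
    equal.\<close>
  have "cheapest f (?c' + \<eta> - 1) ?c' \<le> cheapest f (?c + \<eta> - 1) ?c"
  proof (cases "\<eta> = 1")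
    case True
    then show ?thesis using step.prems by (simp add: admissible_path_def numeral_2_eq_2)
  next
    case False
    then have "?c < ?c + \<eta> - 1" "?c + \<eta> - 1 + (?c' - ?c) = ?c' + \<eta> - 1"
      using step.hyps le by linarith+
    then show ?thesis
      using cheapest_antitone_diag[of ?c "?c + \<eta> - 1" f "?c' - ?c"] ge le by simp
  qed
  then have "cheapest f (?c' + \<eta> - 1) ?c' + f (?c' + \<eta>, ?c') \<le> column_sum f (Suc \<eta>) c"
    using step.IH[OF ap] by (simp add: column_sum_Suc)
  moreover have "cheapest f (Suc (?c' + \<eta> - 1)) ?c' \<le> cheapest f (?c' + \<eta> - 1) ?c' + f (Suc (?c' + \<eta> - 1), ?c')"
    by (rule cheapest_le_extend)
  ultimately show ?case using ge le by simp
qed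

text \<open>The cell (j + \<eta> - 2, j - 1) is the diagonal predecessor of the first element of the
  bar and therefore stands for the same length \<eta>.\<close>

lemma cheapest_le_admissible:
  assumes van: "lower_triangular f"
  assumes "1 \<le> \<eta>" "2 \<le> j" "admissible_columns \<eta> j c"
  shows "cheapest f (j + \<eta> - 2) (j - 1) \<le> column_sum f \<eta> c"
proof -
  have ap: "admissible_path \<eta> c" and le: "c \<eta> \<le> j - 1" and one: "\<eta> = 1 \<Longrightarrow> c \<eta> = j - 1"
    using assms admissible_columns_iff[of \<eta> j c] by (auto split: if_splits)
  have ge: "2 \<le> c \<eta>" using admissible_path_ge2[OF ap, of \<eta>] assms by simp
  have "cheapest f (j + \<eta> - 2) (j - 1) \<le> cheapest f (c \<eta> + \<eta> - 1) (c \<eta>)"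
  proof (cases "\<eta> = 1")
    case True
    then show ?thesis using one assms by (simp add: numeral_2_eq_2)
  next
    case False
    have "c \<eta> + \<eta> - 1 + (j - 1 - c \<eta>) = j + \<eta> - 2" using le ge by simp
    then show ?thesis
      using cheapest_antitone_diag[of "c \<eta>" "c \<eta> + \<eta> - 1" f "j - 1 - c \<eta>"] ge le False assms(2)
      by simp
  qed
  then show ?thesis using cheapest_le_column_sum[of f \<eta> c, OF van assms(2) ap] by simp
qed

text \<open>Induction along the diagonal with \<eta> fixed: undoing diagonal moves leads to the
  column v of a vertical move, and there the value splits into the last entry and the optimum for
  the column shortened by one.\<close>

lemma last_col_props:
  assumes "2 \<le> d"
  shows "2 \<le> last_col f (d + \<eta>) d \<and> last_col f (d + \<eta>) d \<le> d \<and> (\<eta> = 0 \<longrightarrow> last_col f (d + \<eta>) d = d) \<and>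
    cheapest f (d + \<eta>) d =
      cheapest f (last_col f (d + \<eta>) d + \<eta> - 1) (last_col f (d + \<eta>) d)
      + f (last_col f (d + \<eta>) d + \<eta>, last_col f (d + \<eta>) d)"
  using assms
proof (induction d rule: dec_induct)
  case base
  show ?case by (simp add: numeral_2_eq_2)
next
  case (step d)
  then show ?case by auto
qed

lemma backtrack_last: "1 \<le> \<eta> \<Longrightarrow> backtrack f \<eta> d \<eta> = last_col f (d + \<eta> - 1) d"
  by (cases \<eta>) auto

lemma admissible_path_cong:
  assumes "\<And>k. 1 \<le> k \<Longrightarrow> k \<le> \<eta> \<Longrightarrow> c k = c' k" "1 \<le> \<eta>"
  shows "admissible_path \<eta> c \<longleftrightarrow> admissible_path \<eta> c'"
  using assms unfolding admissible_path_def by auto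

text \<open>The lower bound is attained. The end column d is generalized because the shortened
  column ends in a possibly smaller column v.\<close>

lemma backtrack_optimal:
  assumes van: "lower_triangular f"
  assumes "1 \<le> \<eta>" "2 \<le> d"
  shows "admissible_path \<eta> (backtrack f \<eta> d) \<and> column_sum f \<eta> (backtrack f \<eta> d) = cheapest f (d + \<eta> - 1) d"
  using assms(2,3)
proof (induction \<eta> arbitrary: d rule: dec_induct)
  case base
  obtain i where "d = Suc i" using base by (cases d) auto
  then show ?case using base last_col_props[of d f 0] cheapest_diag[of f i, OF van]
    by (simp add: admissible_path_def column_sum_def diag_coord_def)
next
  case (step \<eta>)
  define v where "v = last_col f (d + \<eta>) d"
  have v: "2 \<le> v" "v \<le> d" "cheapest f (d + \<eta>) d = cheapest f (v + \<eta> - 1) v + f (v + \<eta>, v)"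
    using last_col_props[OF step.prems, of f \<eta>] by (auto simp: v_def)
  have tr: "backtrack f (Suc \<eta>) d = (backtrack f \<eta> v)(Suc \<eta> := v)" by (simp add: v_def)
  note IH = step.IH[OF v(1)]
  have "column_sum f \<eta> (backtrack f (Suc \<eta>) d) = column_sum f \<eta> (backtrack f \<eta> v)"
    unfolding column_sum_def tr by (intro sum.cong) auto
  then have "column_sum f (Suc \<eta>) (backtrack f (Suc \<eta>) d) = cheapest f (d + \<eta>) d"
    using IH v(3) by (simp add: column_sum_Suc tr del: backtrack.simps)
  moreover have "admissible_path \<eta> (backtrack f (Suc \<eta>) d)"
    using IH step.hyps by (subst admissible_path_cong[of \<eta> _ "backtrack f \<eta> v"]) (auto simp: tr simp del: backtrack.simps)
  moreover have "backtrack f \<eta> v \<eta> \<le> v" "\<eta> = 1 \<Longrightarrow> backtrack f \<eta> v \<eta> = v"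
    using last_col_props[OF v(1), of f "\<eta> - 1"] backtrack_last[of \<eta> f v] step.hyps
    by auto
  then have "if \<eta> = 1 then backtrack f (Suc \<eta>) d (Suc \<eta>) = backtrack f (Suc \<eta>) d \<eta>
      else backtrack f (Suc \<eta>) d \<eta> \<le> backtrack f (Suc \<eta>) d (Suc \<eta>)"
    unfolding tr by simp
  then have "if \<eta> = 1 then backtrack f (Suc \<eta>) d 2 = backtrack f (Suc \<eta>) d 1
      else backtrack f (Suc \<eta>) d \<eta> \<le> backtrack f (Suc \<eta>) d (Suc \<eta>)"
    by (cases "\<eta> = 1") (simp_all add: numeral_2_eq_2 del: backtrack.simps)
  ultimately show ?case using step.hyps by (simp add: admissible_path_Suc del: backtrack.simps)
qed

lemma backtrack_admissible:
  assumes van: "lower_triangular f"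
  assumes "1 \<le> \<eta>" "3 \<le> j"
  shows "admissible_columns \<eta> j (backtrack f \<eta> (j - 1))"
    "column_sum f \<eta> (backtrack f \<eta> (j - 1)) = cheapest f (j + \<eta> - 2) (j - 1)"
  using backtrack_optimal[of f \<eta> "j - 1", OF van] assms last_col_props[of "j - 1" f "\<eta> - 1"]
    backtrack_last[of \<eta> f "j - 1"] admissible_columns_iff[of \<eta> j "backtrack f \<eta> (j - 1)"]
  by (auto simp: numeral_2_eq_2 numeral_3_eq_3)

lemma coord_sum_bar: "coord_sum x (bar q (i, j)) = (\<Sum>l\<in>{j..min i q}. Poly_Mapping.lookup x (i, l))"
proof -
  have "bar q (i, j) = Pair i ` {j..min i q}" by (auto simp: bar_def)
  then show ?thesis by (simp add: coord_sum_def sum.reindex inj_on_def)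
qed

lemma coord_sum_row: "coord_sum x (row_set q i) = (\<Sum>l\<in>{1..min i q}. Poly_Mapping.lookup x (i, l))"
proof -
  have "row_set q i = Pair i ` {1..min i q}" by (auto simp: row_set_def)
  then show ?thesis by (simp add: coord_sum_def sum.reindex inj_on_def)
qed

lemma row_lt_in_path:
  assumes "admissible_path \<eta> c" "1 \<le> k" "k < l" "l \<le> \<eta>"
  shows "c k + k < c l + l"
  using admissible_path_mono[OF assms(1), of k l] assms by simp

lemma coord_sum_shifted_column:
  assumes "admissible_path \<eta> c"
  shows "coord_sum x (shifted_column \<eta> c) = column_sum (Poly_Mapping.lookup x) \<eta> c"
proof -
  have "shifted_column \<eta> c = (\<lambda>k. diag_coord k (c k)) ` {1..\<eta>}"
    by (auto simp: shifted_column_def)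
  moreover have "inj_on (\<lambda>k. diag_coord k (c k)) {1..\<eta>}"
  proof (rule inj_onI)
    fix k l assume kl: "k \<in> {1..\<eta>}" "l \<in> {1..\<eta>}" "diag_coord k (c k) = diag_coord l (c l)"
    then have "c k = c l" "c k + k - 1 = c l + l - 1" by (auto simp: diag_coord_def)
    then show "k = l" using kl by auto
  qed
  ultimately show ?thesis by (simp add: coord_sum_def column_sum_def sum.reindex)
qed

lemma diag_coord_mem_iff:
  "1 \<le> \<eta> \<Longrightarrow> diag_coord \<eta> j \<in> index_set p q \<longleftrightarrow> 1 \<le> j \<and> j \<le> q \<and> j + \<eta> - 1 \<le> p"
  by (auto simp: diag_coord_def index_set_def)

text \<open>For a given bar only the cheapest shifted column matters, so exponentially many
  inequalities collapse to one per bar. Bars starting in column 2 do not appear because 2 \<le>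
  \<open>c \<eta>\<close> \<le> j - 1. Completeness and separation both rest on this form.\<close>

lemma shifted_column_constraints_iff:
  fixes x :: "pos \<Rightarrow>\<^sub>0 'a::linordered_field"
  assumes van: "lower_triangular (Poly_Mapping.lookup x)"
  shows "(\<forall>\<eta> j c. 1 \<le> \<eta> \<and> 2 \<le> j \<and> diag_coord \<eta> j \<in> index_set p q \<and> admissible_columns \<eta> j c \<longrightarrow>
      satisfies x (Diff_Nonpos (bar q (diag_coord \<eta> j)) (shifted_column \<eta> c))) \<longleftrightarrow>
    (\<forall>i j. 3 \<le> j \<and> j \<le> q \<and> j \<le> i \<and> i \<le> p \<longrightarrow>
      coord_sum x (bar q (i, j)) \<le> cheapest (Poly_Mapping.lookup x) (i - 1) (j - 1))"
    (is "?L \<longleftrightarrow> ?R")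
proof
  assume L: ?L
  show ?R
  proof (intro allI impI)
    fix i j :: nat assume ij: "3 \<le> j \<and> j \<le> q \<and> j \<le> i \<and> i \<le> p"
    define \<eta> where "\<eta> = i - j + 1"
    have eta: "1 \<le> \<eta>" and d: "diag_coord \<eta> j = (i, j)" and r: "j + \<eta> - 2 = i - 1"
      using ij by (auto simp: \<eta>_def diag_coord_def)
    note T = backtrack_admissible[of "Poly_Mapping.lookup x" \<eta> j, OF van eta]
    have adm: "admissible_columns \<eta> j (backtrack (Poly_Mapping.lookup x) \<eta> (j - 1))" using T ij by blast
    then have ap: "admissible_path \<eta> (backtrack (Poly_Mapping.lookup x) \<eta> (j - 1))"
      using admissible_columns_iff eta ij by auto
    have "satisfies x (Diff_Nonpos (bar q (diag_coord \<eta> j))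
        (shifted_column \<eta> (backtrack (Poly_Mapping.lookup x) \<eta> (j - 1))))"
      using L[rule_format, of \<eta> j] adm eta ij d by (auto simp: index_set_def)
    then show "coord_sum x (bar q (i, j)) \<le> cheapest (Poly_Mapping.lookup x) (i - 1) (j - 1)"
      using T(2)[unfolded r] ij unfolding satisfies.simps coord_sum_shifted_column[OF ap] d by simp
  qed
next
  assume R: ?R
  show ?L
  proof (intro allI impI)
    fix \<eta> j c
    assume a: "1 \<le> \<eta> \<and> 2 \<le> j \<and> diag_coord \<eta> j \<in> index_set p q \<and> admissible_columns \<eta> j c"
    then have ap: "admissible_path \<eta> c" and le: "c \<eta> \<le> j - 1"
      using admissible_columns_iff by (auto split: if_splits)
    have "3 \<le> j" using le a admissible_path_ge2[OF ap, of \<eta>] by simp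
    moreover have "j \<le> q \<and> j \<le> j + \<eta> - 1 \<and> j + \<eta> - 1 \<le> p" using a diag_coord_mem_iff by auto
    ultimately have "coord_sum x (bar q (j + \<eta> - 1, j))
        \<le> cheapest (Poly_Mapping.lookup x) (j + \<eta> - 1 - 1) (j - 1)"
      using R by blast
    also have "\<dots> \<le> column_sum (Poly_Mapping.lookup x) \<eta> c"
      using cheapest_le_admissible[of "Poly_Mapping.lookup x" \<eta> j c, OF van] a
      by (simp add: numeral_2_eq_2)
    finally show "satisfies x (Diff_Nonpos (bar q (diag_coord \<eta> j)) (shifted_column \<eta> c))"
      by (simp add: coord_sum_shifted_column[OF ap] diag_coord_def)
  qed
qed

lemma lookup_outside:
  assumes "x \<in> coord_space p q" "(i, j) \<notin> index_set p q"
  shows "Poly_Mapping.lookup x (i, j) = 0"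
  using assms by (auto simp: coord_space_def in_keys_iff)

section \<open>Representatives as growth functions\<close>

primrec running_max :: "(nat \<Rightarrow> nat) \<Rightarrow> nat \<Rightarrow> nat" where
  "running_max r 0 = 0"
| "running_max r (Suc n) = max (running_max r n) (r (Suc n))"

text \<open>Each element encodes a partition of the rows into at most q blocks, numbered in order of
  first appearance. The value 0 outside the rows makes the set finite and lets a function be
  extended by one row in a unique way.\<close>

definition growth_functions :: "nat \<Rightarrow> nat \<Rightarrow> (nat \<Rightarrow> nat) set" where
  "growth_functions q n = {r. (\<forall>i. i \<notin> {1..n} \<longrightarrow> r i = 0) \<and>
     (\<forall>i\<in>{1..n}. 1 \<le> r i \<and> r i \<le> q \<and> r i \<le> running_max r (i - 1) + 1)}"

definition vertex :: "nat \<Rightarrow> (nat \<Rightarrow> nat) \<Rightarrow> pos \<Rightarrow>\<^sub>0 real" where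
  "vertex n r = (\<Sum>i\<in>{1..n}. Poly_Mapping.single (i, r i) 1)"

lemma lookup_vertex:
  "Poly_Mapping.lookup (vertex n r) (i, j) = (if i \<in> {1..n} \<and> r i = j then 1 else 0)"
proof -
  have "Poly_Mapping.lookup (vertex n r) (i, j) = (\<Sum>k\<in>{1..n}. if k = i \<and> r i = j then 1 else 0)"
    unfolding vertex_def lookup_sum
    by (intro sum.cong) (auto simp: lookup_single when_def)
  also have "\<dots> = (if i \<in> {1..n} \<and> r i = j then 1 else 0)"
    by (cases "r i = j") auto
  finally show ?thesis .
qed

lemma le_running_max: "1 \<le> i \<Longrightarrow> i \<le> n \<Longrightarrow> r i \<le> running_max r n"
  by (induction n) (auto simp: le_Suc_eq)

lemma running_max_le_add:
  assumes "r \<in> growth_functions q p" "n + m \<le> p"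
  shows "running_max r (n + m) \<le> running_max r n + m"
  using assms(2)
proof (induction m)
  case (Suc m)
  then have "r (Suc (n + m)) \<le> running_max r (n + m) + 1"
    using assms(1) by (force simp: growth_functions_def)
  then show ?case using Suc by simp
qed simp

lemma running_max_le: "r \<in> growth_functions q p \<Longrightarrow> n \<le> p \<Longrightarrow> running_max r n \<le> n"
  using running_max_le_add[of r q p 0 n] by simp

lemma growth_functions_le_index: "r \<in> growth_functions q p \<Longrightarrow> i \<in> {1..p} \<Longrightarrow> r i \<le> i"
  using running_max_le[of r q p i] le_running_max[of i i r] by auto

lemma running_max_attained:
  assumes "r \<in> growth_functions q p" "n \<le> p" "1 \<le> j" "j \<le> running_max r n"
  shows "\<exists>i\<in>{1..n}. r i = j"
  using assms(2-)
proof (induction n)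
  case (Suc n)
  show ?case
  proof (cases "j \<le> running_max r n")
    case True
    then show ?thesis using Suc by force
  next
    case False
    have "r (Suc n) \<le> running_max r n + 1"
      using assms(1) Suc.prems by (force simp: growth_functions_def)
    then have "r (Suc n) = j" using False Suc.prems by auto
    then show ?thesis by auto
  qed
qed simp

lemma vertex_in_coord_space:
  assumes "r \<in> growth_functions q p"
  shows "vertex p r \<in> coord_space p q"
proof -
  have "(i, j) \<in> index_set p q" if "(i, j) \<in> Poly_Mapping.keys (vertex p r)" for i j
    using that growth_functions_le_index[OF assms] assms
    by (auto simp: in_keys_iff lookup_vertex index_set_def growth_functions_def split: if_splits)
  then show ?thesis by (auto simp: coord_space_def)
qed

lemma representative_rows:
  assumes "A \<in> orbit_representatives p q"
  obtains r where "r \<in> growth_functions q p"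
    "\<And>i j. A i j = (if i \<in> {1..p} \<and> r i = j then 1 else 0)"
proof -
  have zo: "A \<in> zero_one_matrices p q"
    and ex1: "\<And>i. i \<in> {1..p} \<Longrightarrow> \<exists>!j. j \<in> {1..q} \<and> A i j = 1"
    and mx: "\<And>B. B \<in> column_orbit q A \<Longrightarrow> \<not> lex_less p q A B"
    using assms by (auto simp: orbit_representatives_def)
  define r where "r i = (if i \<in> {1..p} then THE j. j \<in> {1..q} \<and> A i j = 1 else 0)" for i
  have r: "r i \<in> {1..q}" "A i (r i) = 1" if "i \<in> {1..p}" for i
    using theI'[OF ex1[OF that]] that by (auto simp: r_def)
  have A: "A i j = (if i \<in> {1..p} \<and> r i = j then 1 else 0)" for i j
  proof (cases "i \<in> {1..p} \<and> j \<in> {1..q}")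
    case True
    then have "A i j = 0 \<or> A i j = 1" using zo by (auto simp: zero_one_matrices_def)
    then show ?thesis using True ex1[of i] r[of i] by auto
  next
    case False
    then have "A i j = 0" using zo unfolding zero_one_matrices_def by blast
    then show ?thesis using False r[of i] by auto
  qed
  have "r i \<le> running_max r (i - 1) + 1" if i: "i \<in> {1..p}" for i
  proof (rule ccontr)
    define a where "a = running_max r (i - 1) + 1"
    assume "\<not> ?thesis"
    then have ab: "a < r i" by (simp add: a_def)
    define \<pi> where "\<pi> = Transposition.transpose a (r i)"
    have aq: "a \<in> {1..q}" using ab r(1)[OF i] by (auto simp: a_def)
    have "\<pi> permutes {1..q}"
      unfolding \<pi>_def using aq r(1)[OF i] by (rule permutes_swap_id)
    then have mem: "(\<lambda>i j. A i (\<pi> j)) \<in> column_orbit q A" by (auto simp: column_orbit_def)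
    have "A k j = A k (\<pi> j)" if "k \<in> {1..p}" "j \<in> {1..q}" "pos_before (k, j) (i, a)" for k j
    proof (cases "k < i")
      case True
      then have "k \<le> i - 1" by simp
      then have "r k < a" using le_running_max[of k "i - 1" r] that by (simp add: a_def)
      then show ?thesis using ab by (auto simp: A \<pi>_def Transposition.transpose_def)
    next
      case False
      then show ?thesis using that ab by (auto simp: A \<pi>_def Transposition.transpose_def pos_before_def)
    qed
    moreover have "A i a < A i (\<pi> a)" using ab i by (simp add: A \<pi>_def)
    ultimately have "lex_less p q A (\<lambda>i j. A i (\<pi> j))"
      using i aq unfolding lex_less_def by blast
    then show False using mx[OF mem] by blast
  qed
  then have "r \<in> growth_functions q p"
    using r by (auto simp: growth_functions_def r_def)
  then show thesis using A that by blast
qed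

lemma growth_function_matrix_representative:
  assumes r: "r \<in> growth_functions q p"
  shows "(\<lambda>i j. if i \<in> {1..p} \<and> r i = j then 1 else 0) \<in> orbit_representatives p q"
    (is "?A \<in> _")
proof -
  have rng: "r i \<in> {1..q}" if "i \<in> {1..p}" for i
    using r that by (auto simp: growth_functions_def)
  have "\<not> lex_less p q ?A (\<lambda>i j. ?A i (\<pi> j))" if pi: "\<pi> permutes {1..q}" for \<pi>
  proof
    assume "lex_less p q ?A (\<lambda>i j. ?A i (\<pi> j))"
    then obtain k l where kl: "k \<in> {1..p}" "l \<in> {1..q}" "?A k l < ?A k (\<pi> l)"
      and before: "\<And>i j. i \<in> {1..p} \<Longrightarrow> j \<in> {1..q} \<Longrightarrow> pos_before (i, j) (k, l) \<Longrightarrow> ?A i j = ?A i (\<pi> j)"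
      unfolding lex_less_def by blast
    have l: "r k \<noteq> l" "\<pi> l = r k" using kl by (auto split: if_splits)
    have fix_used: "\<pi> j = j" if j: "1 \<le> j" "j \<le> running_max r (k - 1)" for j
    proof -
      obtain i where i: "i \<in> {1..k - 1}" "r i = j"
        using running_max_attained[OF r _ j] kl by (meson atLeastAtMost_iff diff_le_self le_trans)
      then have ik: "i < k" "i \<in> {1..p}" using kl by auto
      then have "j \<in> {1..q}" "pos_before (i, j) (k, l)"
        using rng[of i] i(2) by (simp_all add: pos_before_def)
      then have "?A i j = ?A i (\<pi> j)" by (rule before[OF ik(2)])
      then have "r i = \<pi> j" unfolding i(2) using ik(2) by (cases "j = \<pi> j") simp_all
      then show ?thesis using i(2) by simp
    qed
    have inj: "\<pi> a = \<pi> b \<Longrightarrow> a = b" for a b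
      using permutes_inj[OF pi] by (auto dest: injD)
    show False
    proof (cases "r k \<le> running_max r (k - 1)")
      case True
      then have "\<pi> (r k) = r k" using fix_used rng[of k] kl by auto
      then show False using l inj by metis
    next
      case False
      moreover have "r k \<le> running_max r (k - 1) + 1"
        using r kl by (auto simp: growth_functions_def)
      ultimately have rk: "r k = running_max r (k - 1) + 1" by simp
      have "\<not> l < r k"
      proof
        assume "l < r k"
        then have "\<pi> l = l" using fix_used[of l] kl rk by auto
        then show False using l by simp
      qed
      then have "r k < l" using l by simp
      then have "?A k (r k) = ?A k (\<pi> (r k))"
        using before[of k "r k"] kl rng[of k] by (auto simp: pos_before_def)
      then have "\<pi> (r k) = r k" using kl(1) by (cases "r k = \<pi> (r k)") simp_all
      then show False using l inj by metis
    qed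
  qed
  moreover have "?A \<in> zero_one_matrices p q"
    unfolding zero_one_matrices_def
  proof (intro CollectI conjI allI ballI impI)
    fix i j assume "(i, j) \<notin> {1..p} \<times> {1..q}"
    then have "\<not> (i \<in> {1..p} \<and> r i = j)" using rng[of i] by blast
    then show "?A i j = 0" by (rule if_not_P)
  qed simp
  moreover have "\<exists>!j. j \<in> {1..q} \<and> ?A i j = 1" if "i \<in> {1..p}" for i
  proof (rule ex1I)
    show "r i \<in> {1..q} \<and> ?A i (r i) = 1" using rng[OF that] that by simp
    fix j assume "j \<in> {1..q} \<and> ?A i j = 1"
    then show "j = r i" using that by (cases "r i = j") simp_all
  qed
  ultimately show ?thesis unfolding orbit_representatives_def column_orbit_def by blast
qed

lemma partitioning_orbitope_eq: "partitioning_orbitope p q = convex hull (vertex p ` growth_functions q p)"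
proof -
  have "{x \<in> coord_space p q. \<exists>A\<in>orbit_representatives p q.
         \<forall>(i, j)\<in>index_set p q. Poly_Mapping.lookup x (i, j) = real (A i j)} =
      vertex p ` growth_functions q p" (is "?L = ?R")
  proof
    show "?L \<subseteq> ?R"
    proof
      fix x assume "x \<in> ?L"
      then obtain A where x: "x \<in> coord_space p q" and A: "A \<in> orbit_representatives p q"
        and xA: "\<forall>(i, j)\<in>index_set p q. Poly_Mapping.lookup x (i, j) = real (A i j)"
        by blast
      from A obtain r where r: "r \<in> growth_functions q p"
        and Ar: "\<And>i j. A i j = (if i \<in> {1..p} \<and> r i = j then 1 else 0)"
        by (rule representative_rows) blast
      have "Poly_Mapping.lookup x (i, j) = Poly_Mapping.lookup (vertex p r) (i, j)" for i j
        using xA lookup_outside[OF x, of i j] lookup_outside[OF vertex_in_coord_space[OF r], of i j] Ar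
        by (cases "(i, j) \<in> index_set p q") (auto simp: lookup_vertex)
      then have "x = vertex p r" by (intro poly_mapping_eqI) auto
      then show "x \<in> ?R" using r by blast
    qed
    show "?R \<subseteq> ?L"
    proof
      fix x assume "x \<in> ?R"
      then obtain r where r: "r \<in> growth_functions q p" "x = vertex p r" by blast
      have "\<forall>(i, j)\<in>index_set p q. Poly_Mapping.lookup x (i, j)
          = real ((\<lambda>i j. if i \<in> {1..p} \<and> r i = j then 1 else 0) i j)"
        by (auto simp only: r(2) lookup_vertex of_nat_0 of_nat_1 split: if_split)
      then show "x \<in> ?L"
        using growth_function_matrix_representative[OF r(1)] vertex_in_coord_space[OF r(1)]
        unfolding r(2) by (intro CollectI conjI bexI)
    qed
  qed
  then show ?thesis by (simp add: partitioning_orbitope_def)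
qed

section \<open>Validity of the constraints at the vertices\<close>

text \<open>Compare the maximum just before the last row of the column with its last column number.
  If it is smaller, the maximum jumps to that number in the last row and the last cell is used.
  Otherwise, since the maximum grows by at most one per row, going back along the diagonal shows
  that the shortened column was reached as well.\<close>

lemma growth_function_meets_path:
  assumes r: "r \<in> growth_functions q p"
  assumes "1 \<le> \<eta>" "admissible_path \<eta> c" "c \<eta> + \<eta> - 1 \<le> p" "c \<eta> \<le> running_max r (c \<eta> + \<eta> - 1)"
  shows "\<exists>k\<in>{1..\<eta>}. r (c k + k - 1) = c k"
  using assms(2-)
proof (induction \<eta> rule: dec_induct)
  case base
  then have "2 \<le> c 1" by (simp add: admissible_path_def)
  then obtain i where i: "c 1 = Suc i" by (cases "c 1") auto
  then have "r (Suc i) = Suc i"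
    using base running_max_le[OF r, of i] growth_functions_le_index[OF r, of "Suc i"]
    by (auto simp: max_def split: if_splits)
  then have "r (c 1 + 1 - 1) = c 1" using i by simp
  then show ?case by (intro bexI[of _ 1]) simp_all
next
  case (step \<eta>)
  let ?c = "c \<eta>" and ?c' = "c (Suc \<eta>)"
  have ap: "admissible_path \<eta> c" and ge: "2 \<le> ?c"
    using step.prems step.hyps admissible_path_Suc admissible_path_ge2 by auto
  have le: "?c \<le> ?c'" using admissible_path_step[OF step.prems(1), of \<eta>] step.hyps by simp
  have row: "?c' + Suc \<eta> - 1 = Suc (?c' + \<eta> - 1)" using ge le by simp
  show ?case
  proof (cases "?c' \<le> running_max r (?c' + \<eta> - 1)")
    case True
    have "?c' + \<eta> - 1 = (?c + \<eta> - 1) + (?c' - ?c)" using le ge by simp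
    then have "running_max r (?c' + \<eta> - 1) \<le> running_max r (?c + \<eta> - 1) + (?c' - ?c)"
      using running_max_le_add[OF r, of "?c + \<eta> - 1" "?c' - ?c"] step.prems by simp
    then have "?c \<le> running_max r (?c + \<eta> - 1)" using True le by simp
    then show ?thesis using step.IH[OF ap] step.prems le by force
  next
    case False
    have "running_max r (?c' + Suc \<eta> - 1) = max (running_max r (?c' + \<eta> - 1)) (r (?c' + Suc \<eta> - 1))"
      unfolding row by simp
    moreover have "r (?c' + Suc \<eta> - 1) \<le> running_max r (?c' + \<eta> - 1) + 1"
      using r step.prems row unfolding growth_functions_def by force
    ultimately have "r (?c' + Suc \<eta> - 1) = ?c'" using False step.prems by linarith
    then show ?thesis by force
  qed
qed

lemma orbitope_system_cases [consumes 1, case_names row nonneg col]: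
  assumes "con \<in> orbitope_system p q"
  obtains i where "i \<in> {1..p}" "con = Sum_Eq_One (row_set q i)"
  | k where "k \<in> index_set p q" "\<And>j. j < q \<Longrightarrow> k \<noteq> (j, j)" "con = Nonneg k"
  | \<eta> j c where "1 \<le> \<eta>" "2 \<le> j" "diag_coord \<eta> j \<in> index_set p q" "admissible_columns \<eta> j c"
      "con = Diff_Nonpos (bar q (diag_coord \<eta> j)) (shifted_column \<eta> c)"
  using assms unfolding orbitope_system_def
proof (elim UnE CollectE exE conjE)
  fix i assume "con = Sum_Eq_One (row_set q i)" "i \<in> {1..p}"
  then show thesis using that(1) by simp
next
  fix k assume "con = Nonneg k" "k \<in> index_set p q - {(j, j) |j. j < q}"
  then show thesis using that(2)[of k] by auto
next
  fix \<eta> j c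
  assume "con = Diff_Nonpos (bar q (diag_coord \<eta> j)) (shifted_column \<eta> c)"
    "1 \<le> \<eta>" "2 \<le> j" "diag_coord \<eta> j \<in> index_set p q" "admissible_columns \<eta> j c"
  then show thesis using that(3) by simp
qed

lemma vertex_satisfies:
  assumes r: "r \<in> growth_functions q p" and con: "con \<in> orbitope_system p q"
  shows "satisfies (vertex p r) con"
proof -
  have rng: "r i \<in> {1..min i q}" if "i \<in> {1..p}" for i
    using r that growth_functions_le_index[OF r] by (auto simp: growth_functions_def)
  from con show ?thesis
  proof (cases rule: orbitope_system_cases)
    case (row i)
    then show ?thesis using rng[of i] by (simp add: coord_sum_row lookup_vertex)
  next
    case (nonneg k)
    then show ?thesis by (cases k) (simp add: lookup_vertex)
  next
    case (col \<eta> j c)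
    define i where "i = j + \<eta> - 1"
    have d: "diag_coord \<eta> j = (i, j)" by (simp add: diag_coord_def i_def)
    have ij: "i \<in> {1..p}" "j \<le> i" using col by (auto simp: d index_set_def)
    have ap: "admissible_path \<eta> c" and le: "c \<eta> \<le> j - 1"
      using col admissible_columns_iff by (auto split: if_splits)
    have nn: "0 \<le> column_sum (Poly_Mapping.lookup (vertex p r)) \<eta> c"
      unfolding column_sum_def by (intro sum_nonneg) (auto simp: diag_coord_def lookup_vertex)
    have barsum: "coord_sum (vertex p r) (bar q (i, j)) = (if r i \<in> {j..min i q} then 1 else 0)"
      using ij by (simp add: coord_sum_bar lookup_vertex)
    show ?thesis
    proof (cases "j \<le> r i")
      case True
      have ge: "2 \<le> c \<eta>" using admissible_path_ge2[OF ap, of \<eta>] col by simp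
      \<comment> \<open>A one in the bar puts the maximum before row i at j - 1 or more; going back
        j - 1 - \<open>c \<eta>\<close> rows lowers it by at most that amount.\<close>
      have "j \<le> running_max r (i - 1) + 1"
        using True r ij by (force simp: growth_functions_def)
      moreover have eq: "i - 1 = (c \<eta> + \<eta> - 1) + (j - 1 - c \<eta>)"
        using le ge col by (simp add: i_def)
      then have "running_max r (i - 1) \<le> running_max r (c \<eta> + \<eta> - 1) + (j - 1 - c \<eta>)"
        using running_max_le_add[OF r, of "c \<eta> + \<eta> - 1" "j - 1 - c \<eta>", folded eq] ij by auto
      ultimately have "c \<eta> \<le> running_max r (c \<eta> + \<eta> - 1)" using le col by linarith
      moreover have "c \<eta> + \<eta> - 1 \<le> p"
        using le_add1[of "c \<eta> + \<eta> - 1" "j - 1 - c \<eta>", folded eq] ij by auto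
      ultimately obtain k where k: "k \<in> {1..\<eta>}" "r (c k + k - 1) = c k"
        using growth_function_meets_path[OF r col(1) ap] by blast
      have "c k + k \<le> c \<eta> + \<eta>" using admissible_path_mono[OF ap, of k \<eta>] k by auto
      then have "c k + k - 1 \<in> {1..p}"
        using \<open>c \<eta> + \<eta> - 1 \<le> p\<close> k admissible_path_ge2[OF ap, of k] by auto
      then have "1 \<le> Poly_Mapping.lookup (vertex p r) (diag_coord k (c k))"
        using k by (simp add: diag_coord_def lookup_vertex)
      also have "\<dots> \<le> column_sum (Poly_Mapping.lookup (vertex p r)) \<eta> c"
        unfolding column_sum_def
        by (rule member_le_sum[OF k(1)]) (auto simp: diag_coord_def lookup_vertex)
      finally show ?thesis by (simp add: col(5) d barsum coord_sum_shifted_column[OF ap])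
    next
      case False
      then show ?thesis using nn by (simp add: col(5) d barsum coord_sum_shifted_column[OF ap])
    qed
  qed
qed

lemma lookup_scaleR [simp]:
  "Poly_Mapping.lookup (u *\<^sub>R x) k = u *\<^sub>R Poly_Mapping.lookup x k"
proof -
  have "finite {k. u *\<^sub>R Poly_Mapping.lookup x k \<noteq> 0}"
    by (rule finite_subset[OF _ finite_lookup[of x]]) auto
  then show ?thesis by (simp add: scaleR_poly_mapping_def)
qed

lemma coord_sum_convex:
  "coord_sum (u *\<^sub>R x + v *\<^sub>R y) T = u * coord_sum x T + v * coord_sum (y :: pos \<Rightarrow>\<^sub>0 real) T"
  by (simp add: coord_sum_def lookup_add sum.distrib sum_distrib_left)

lemma convex_solution_set: "convex (solution_set p q C)"
proof (rule convexI)
  fix x y and u v :: real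
  assume x: "x \<in> solution_set p q C" and y: "y \<in> solution_set p q C"
    and uv: "0 \<le> u" "0 \<le> v" "u + v = 1"
  have "satisfies (u *\<^sub>R x + v *\<^sub>R y) c" if "c \<in> C" for c
  proof -
    have c: "satisfies x c" "satisfies y c" using x y that by (auto simp: solution_set_def)
    show ?thesis
    proof (cases c)
      case (Sum_Eq_One T)
      then show ?thesis using c uv by (simp add: coord_sum_convex)
    next
      case (Nonneg k)
      then show ?thesis using c uv by (simp add: lookup_add)
    next
      case (Diff_Nonpos B S)
      have "u * coord_sum x B \<le> u * coord_sum x S" "v * coord_sum y B \<le> v * coord_sum y S"
        using c uv Diff_Nonpos by (auto intro: mult_left_mono)
      then show ?thesis by (simp add: Diff_Nonpos coord_sum_convex)
    qed
  qed
  moreover have "Poly_Mapping.keys (u *\<^sub>R x + v *\<^sub>R y) \<subseteq> Poly_Mapping.keys x \<union> Poly_Mapping.keys y"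
    by (auto simp: in_keys_iff lookup_add)
  ultimately show "u *\<^sub>R x + v *\<^sub>R y \<in> solution_set p q C"
    using x y unfolding solution_set_def coord_space_def by blast
qed

lemma orbitope_subset_solution_set:
  "partitioning_orbitope p q \<subseteq> solution_set p q (orbitope_system p q)"
  unfolding partitioning_orbitope_eq
  by (rule hull_minimal)
    (auto simp: solution_set_def vertex_in_coord_space vertex_satisfies
      convex_solution_set[unfolded solution_set_def])

section \<open>Completeness of the linear system\<close>

text \<open>Monotone coupling (north-west corner rule): lay out the \<open>v m\<close> and the
  \<open>z j\<close> as consecutive intervals on a line and let \<open>y m j\<close> be the length
  of the overlap of the m-th with the j-th. By the prefix condition the m-th v-interval ends before
  the j-th z-interval begins whenever m < j.\<close>

lemma staircase_transport:
  fixes z v :: "nat \<Rightarrow> real"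
  assumes z: "\<And>j. j < N \<Longrightarrow> 0 \<le> z j" and v: "\<And>m. m < N \<Longrightarrow> 0 \<le> v m"
    and prefix: "\<And>j. j \<le> N \<Longrightarrow> (\<Sum>l<j. v l) \<le> (\<Sum>l<j. z l)"
    and total: "(\<Sum>l<N. v l) = (\<Sum>l<N. z l)"
  obtains y where "\<And>m j. m < N \<Longrightarrow> j < N \<Longrightarrow> 0 \<le> y m j" "\<And>m j. m < j \<Longrightarrow> j < N \<Longrightarrow> y m j = 0"
    "\<And>m. m < N \<Longrightarrow> (\<Sum>j<N. y m j) = v m" "\<And>j. j < N \<Longrightarrow> (\<Sum>m<N. y m j) = z j"
proof -
  define Z where "Z j = (\<Sum>l<j. z l)" for j
  define V where "V m = (\<Sum>l<m. v l)" for m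
  define clamp :: "real \<Rightarrow> real \<Rightarrow> real \<Rightarrow> real" where "clamp a b t = max a (min b t)" for a b t
  define y where "y m j = clamp (V m) (V (Suc m)) (Z (Suc j)) - clamp (V m) (V (Suc m)) (Z j)" for m j
  have mono: "V i \<le> V j" "Z i \<le> Z j" if "i \<le> j" "j \<le> N" for i j
    unfolding V_def Z_def using that v z by (auto intro!: sum_mono2)
  have VZ: "V j \<le> Z j" if "j \<le> N" for j using prefix that by (simp add: V_def Z_def)
  have VN: "V N = Z N" using total by (simp add: V_def Z_def)
  \<comment> \<open>The overlap length is symmetric in the two intervals. Sums over j telescope in
    the original form, sums over m in this one.\<close>
  have y_swap: "y m j = clamp (Z j) (Z (Suc j)) (V (Suc m)) - clamp (Z j) (Z (Suc j)) (V m)"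
    if "m < N" "j < N" for m j
    using mono[of m "Suc m"] mono[of j "Suc j"] that unfolding y_def clamp_def by (auto simp: max_def min_def)
  show thesis
  proof (rule that[of y])
    fix m j assume mj: "m < N" "j < N"
    show "0 \<le> y m j"
      using mono[of m "Suc m"] mono[of j "Suc j"] mj unfolding y_def clamp_def by (auto simp: max_def min_def)
  next
    fix m j assume mj: "m < j" "j < N"
    have "V (Suc m) \<le> Z j" using mono(1)[of "Suc m" j] VZ[of j] mj by simp
    moreover have "Z j \<le> Z (Suc j)" using mono(2)[of j "Suc j"] mj by simp
    ultimately show "y m j = 0" by (auto simp: y_def clamp_def)
  next
    fix m assume m: "m < N"
    have "(\<Sum>j<N. y m j) = clamp (V m) (V (Suc m)) (Z N) - clamp (V m) (V (Suc m)) (Z 0)"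
      unfolding y_def by (rule sum_lessThan_telescope)
    also have "\<dots> = V (Suc m) - V m"
      using mono(1)[of m "Suc m"] mono(1)[of "Suc m" N] mono(1)[of 0 m] m VN
      by (auto simp: clamp_def Z_def[of 0] V_def[of 0] max_def min_def)
    finally show "(\<Sum>j<N. y m j) = v m" by (simp add: V_def)
  next
    fix j assume j: "j < N"
    have "(\<Sum>m<N. y m j) = (\<Sum>m<N. clamp (Z j) (Z (Suc j)) (V (Suc m)) - clamp (Z j) (Z (Suc j)) (V m))"
      using j by (intro sum.cong) (auto simp: y_swap)
    also have "\<dots> = clamp (Z j) (Z (Suc j)) (V N) - clamp (Z j) (Z (Suc j)) (V 0)"
      by (rule sum_lessThan_telescope)
    also have "\<dots> = Z (Suc j) - Z j"
      using mono(2)[of j "Suc j"] mono(2)[of "Suc j" N] mono(2)[of 0 j] j VN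
      by (auto simp: clamp_def Z_def[of 0] V_def[of 0] max_def min_def)
    finally show "(\<Sum>m<N. y m j) = z j" by (simp add: Z_def)
  qed
qed

text \<open>G and F are the tails of the maximum before and after the row, x is the row. The mass
  \<open>d j\<close> raises the maximum from j - 1 to j, \<open>v m\<close> stays in state m, and
  \<open>z j\<close> is what column j must still receive from states m \<ge> j. The inequalities
  between F, G and x make d, z and v nonnegative, and \<open>bar\<close> is the prefix condition for
  transporting v to z.\<close>

lemma row_kernel:
  fixes F G x :: "nat \<Rightarrow> real"
  assumes F: "F 0 = 1" "F (Suc q) = 0" and G: "G 0 = 1" "G (Suc q) = 0"
    and GF: "\<And>j. G j \<le> F j" and FG: "\<And>j. j \<le> q \<Longrightarrow> F j \<le> G j + x j" and FGS: "\<And>j. F (Suc j) \<le> G j"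
    and bar: "\<And>j. j \<le> q \<Longrightarrow> 1 - (\<Sum>l<j. x l) \<le> F j" and total: "(\<Sum>l<Suc q. x l) = 1" and x0: "x 0 = 0"
  obtains w where "\<And>m j. m \<le> q \<Longrightarrow> j \<le> q \<Longrightarrow> 0 \<le> w m j"
    "\<And>m j. m \<le> q \<Longrightarrow> j \<le> q \<Longrightarrow> \<not> (1 \<le> j \<and> j \<le> Suc m) \<Longrightarrow> w m j = 0"
    "\<And>m. m \<le> q \<Longrightarrow> (\<Sum>j\<le>q. w m j) = G m - G (Suc m)"
    "\<And>j. j \<le> q \<Longrightarrow> (\<Sum>m\<le>q. w m j) = x j"
    "\<And>n. n \<le> q \<Longrightarrow> (\<Sum>m\<le>q. \<Sum>j\<le>q. if max m j = n then w m j else 0) = F n - F (Suc n)"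
proof -
  define d where "d j = F j - G j" for j
  define z where "z j = x j - d j" for j
  define v where "v m = G m - F (Suc m)" for m
  \<comment> \<open>The slack of the prefix condition at j equals the slack of the bar condition at
    j.\<close>
  have diff: "(\<Sum>l<j. z l) - (\<Sum>l<j. v l) = F j - 1 + (\<Sum>l<j. x l)" for j
    by (induction j) (auto simp: z_def v_def d_def F)
  have sum_le: "(\<Sum>l<Suc q. g l) = (\<Sum>l\<le>q. g l)" for g :: "nat \<Rightarrow> real"
    by (simp add: lessThan_Suc_atMost)
  have zv: "j < Suc q \<Longrightarrow> 0 \<le> z j" "0 \<le> v m" "(\<Sum>l<Suc q. v l) = (\<Sum>l<Suc q. z l)" for j m
    using FG[of j] FGS[of m] diff[of "Suc q"] total F by (auto simp: z_def d_def v_def)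
  have prefix: "(\<Sum>l<j. v l) \<le> (\<Sum>l<j. z l)" if "j \<le> Suc q" for j
    using diff[of j] bar[of j] total F that by (cases "j = Suc q") auto
  obtain y where y: "\<And>m j. m < Suc q \<Longrightarrow> j < Suc q \<Longrightarrow> 0 \<le> y m j"
    "\<And>m j. m < j \<Longrightarrow> j < Suc q \<Longrightarrow> y m j = 0"
    "\<And>m. m < Suc q \<Longrightarrow> (\<Sum>j<Suc q. y m j) = v m" "\<And>j. j < Suc q \<Longrightarrow> (\<Sum>m<Suc q. y m j) = z j"
    using staircase_transport[OF zv(1,2) prefix zv(3)] by metis
  define w where "w m j = y m j + (if j = Suc m then d j else 0)" for m j
  \<comment> \<open>Column 0 is only an artefact of indexing from 0; \<open>z 0\<close> = 0 leaves
    no mass for it.\<close>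
  have y0: "y m 0 = 0" if "m \<le> q" for m
  proof -
    have "(\<Sum>m\<le>q. y m 0) = 0" using y(4)[of 0] x0 F G unfolding sum_le by (simp add: z_def d_def)
    then show ?thesis using y(1) that by (subst (asm) sum_nonneg_eq_0_iff) auto
  qed
  show thesis
  proof (rule that[of w])
    show "0 \<le> w m j" if "m \<le> q" "j \<le> q" for m j
      using y(1)[of m j] GF[of j] that by (auto simp: w_def d_def)
    show w0: "w m j = 0" if "m \<le> q" "j \<le> q" "\<not> (1 \<le> j \<and> j \<le> Suc m)" for m j
      using that y0[of m] y(2)[of m j] by (cases "j = 0") (auto simp: w_def)
    show "(\<Sum>j\<le>q. w m j) = G m - G (Suc m)" if "m \<le> q" for m
    proof -
      have "(\<Sum>j\<le>q. if j = Suc m then d j else 0) = d (Suc m)"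
        using that F G by (cases "m = q") (auto simp: d_def)
      then show ?thesis using y(3)[of m] that unfolding sum_le
        by (simp add: w_def sum.distrib v_def d_def)
    qed
    show "(\<Sum>m\<le>q. w m j) = x j" if "j \<le> q" for j
    proof -
      have "(\<Sum>m\<le>q. if j = Suc m then d j else 0) = d j"
      proof (cases j)
        case 0
        then show ?thesis using F G by (simp add: d_def)
      next
        case (Suc i)
        then show ?thesis using that by auto
      qed
      then show ?thesis using y(4)[of j] that unfolding sum_le
        by (simp add: w_def sum.distrib z_def)
    qed
    show "(\<Sum>m\<le>q. \<Sum>j\<le>q. if max m j = n then w m j else 0) = F n - F (Suc n)" if n: "n \<le> q" for n
    proof -
      have "(\<Sum>j\<le>q. if max m j = n then w m j else 0) =
          (if m = n then v n else 0) + (if Suc m = n then d n else 0)" if m: "m \<le> q" for m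
      proof -
        \<comment> \<open>Only d raises the maximum, since \<open>y m j\<close> vanishes for m < j.
          So the new maximum n arises by staying in state n or by moving from n - 1 to column
          n.\<close>
        have *: "(if max m j = n then w m j else 0) =
          (if m = n then y m j else 0) + (if j = n then if Suc m = n then d n else 0 else 0)" if j: "j \<le> q" for j
          using y(2)[of m j] m j by (auto simp: w_def max_def not_le)
        have "(\<Sum>j\<le>q. if max m j = n then w m j else 0) =
          (\<Sum>j\<le>q. if m = n then y m j else 0) + (\<Sum>j\<le>q. if j = n then if Suc m = n then d n else 0 else 0)"
          unfolding sum.distrib[symmetric] by (intro sum.cong) (auto simp: *)
        also have "(\<Sum>j\<le>q. if m = n then y m j else 0) = (if m = n then v n else 0)"
          using y(3)[of n] n unfolding sum_le by auto
        finally show ?thesis using n by simp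
      qed
      then have "(\<Sum>m\<le>q. \<Sum>j\<le>q. if max m j = n then w m j else 0) =
          (\<Sum>m\<le>q. if m = n then v n else 0) + (\<Sum>m\<le>q. if Suc m = n then d n else 0)"
        unfolding sum.distrib[symmetric] by (intro sum.cong) auto
      also have "(\<Sum>m\<le>q. if Suc m = n then d n else 0) = d n"
      proof (cases n)
        case 0
        then show ?thesis using F G by (simp add: d_def)
      next
        case (Suc i)
        then show ?thesis using n by auto
      qed
      finally show ?thesis using n by (simp add: v_def d_def)
    qed
  qed
qed

section \<open>Random growth functions as Markov chains\<close>

lemma running_max_cong: "(\<And>i. 1 \<le> i \<Longrightarrow> i \<le> n \<Longrightarrow> r i = s i) \<Longrightarrow> running_max r n = running_max s n"
  by (induction n) auto

lemma running_max_le_columns: "r \<in> growth_functions q n \<Longrightarrow> running_max r n \<le> q"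
proof -
  assume r: "r \<in> growth_functions q n"
  have "running_max r k \<le> q" if "k \<le> n" for k
    using that by (induction k) (use r in \<open>auto simp: growth_functions_def\<close>)
  then show ?thesis by simp
qed

lemma growth_functions_0: "growth_functions q 0 = {\<lambda>_. 0}"
  by (auto simp: growth_functions_def)

lemma growth_functions_Suc_iff:
  "r \<in> growth_functions q (Suc n) \<longleftrightarrow> r(Suc n := 0) \<in> growth_functions q n \<and>
    r (Suc n) \<in> {1..min q (Suc (running_max r n))}"
proof -
  let ?P = "\<lambda>r i. 1 \<le> r i \<and> r i \<le> q \<and> r i \<le> running_max r (i - 1) + 1"
  have rm: "running_max (r(Suc n := 0)) i = running_max r i" if "i \<le> n" for i
    using that by (intro running_max_cong) auto
  have "?P (r(Suc n := 0)) i \<longleftrightarrow> ?P r i" if "i \<in> {1..n}" for i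
  proof -
    have "i \<noteq> Suc n" "i - 1 \<le> n" using that by auto
    then show ?thesis using rm[of "i - 1"] by simp
  qed
  then have "(\<forall>i\<in>{1..Suc n}. ?P r i) \<longleftrightarrow> (\<forall>i\<in>{1..n}. ?P (r(Suc n := 0)) i) \<and> ?P r (Suc n)"
    by (simp add: atLeastAtMostSuc_conv conj_commute)
  moreover have "(\<forall>i. i \<notin> {1..Suc n} \<longrightarrow> r i = 0) \<longleftrightarrow> (\<forall>i. i \<notin> {1..n} \<longrightarrow> (r(Suc n := 0)) i = 0)"
    by (auto simp: atLeastAtMostSuc_conv)
  ultimately show ?thesis by (auto simp: growth_functions_def)
qed

lemma growth_functions_Suc:
  "bij_betw (\<lambda>(r, k). r(Suc n := k))
    (SIGMA r:growth_functions q n. {1..min q (Suc (running_max r n))}) (growth_functions q (Suc n))"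
    (is "bij_betw ?f ?A ?B")
proof (rule bij_betw_byWitness[where f' = "\<lambda>r. (r(Suc n := 0), r (Suc n))"])
  have rm: "running_max (r(Suc n := k)) n = running_max r n" for r k
    by (intro running_max_cong) auto
  have upd: "r(Suc n := 0) = r" if "r \<in> growth_functions q n" for r
    using that by (auto simp: growth_functions_def)
  show "\<forall>a\<in>?A. (\<lambda>r. (r(Suc n := 0), r (Suc n))) (?f a) = a" by (auto simp: upd)
  show "\<forall>r\<in>?B. ?f (r(Suc n := 0), r (Suc n)) = r" by simp
  show "?f ` ?A \<subseteq> ?B" by (auto simp: growth_functions_Suc_iff upd rm)
  show "(\<lambda>r. (r(Suc n := 0), r (Suc n))) ` ?B \<subseteq> ?A"
    by (auto simp: growth_functions_Suc_iff[of _ q n] rm)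
qed

lemma finite_growth_functions: "finite (growth_functions q n)"
proof (induction n)
  case (Suc n)
  then show ?case by (subst bij_betw_finite[OF growth_functions_Suc, symmetric]) auto
qed (simp add: growth_functions_0)

lemma sum_growth_functions_Suc:
  "(\<Sum>r\<in>growth_functions q (Suc n). g r) =
    (\<Sum>r\<in>growth_functions q n. \<Sum>k\<in>{1..min q (Suc (running_max r n))}. g (r(Suc n := k)))"
  by (subst sum.reindex_bij_betw[OF growth_functions_Suc, symmetric], subst sum.Sigma)
    (auto simp: finite_growth_functions case_prod_unfold)

text \<open>A prefix r with maximum m is extended by k with conditional probability
  \<open>w m k / u n m\<close>. The induction carries the law \<open>u n\<close> of the maximum, on
  which the next kernel acts, together with the marginals of all rows so far.\<close>

lemma growth_weights:
  fixes u :: "nat \<Rightarrow> nat \<Rightarrow> real" and f :: "pos \<Rightarrow> real"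
  assumes u0: "u 0 0 = 1" "\<And>m. 0 < m \<Longrightarrow> u 0 m = 0"
    and kernel: "\<And>i. i < p \<Longrightarrow> \<exists>w. (\<forall>m\<le>q. \<forall>j\<le>q. 0 \<le> w m j \<and> (\<not> (1 \<le> j \<and> j \<le> Suc m) \<longrightarrow> w m j = 0)) \<and>
      (\<forall>m\<le>q. (\<Sum>j\<le>q. w m j) = u i m) \<and> (\<forall>j\<le>q. (\<Sum>m\<le>q. w m j) = f (Suc i, j)) \<and>
      (\<forall>n\<le>q. (\<Sum>m\<le>q. \<Sum>j\<le>q. if max m j = n then w m j else 0) = u (Suc i) n)"
    and "n \<le> p"
  shows "\<exists>W. (\<forall>r\<in>growth_functions q n. 0 \<le> W r) \<and>
    (\<forall>m\<le>q. (\<Sum>r\<in>growth_functions q n. if running_max r n = m then W r else 0) = u n m) \<and>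
    (\<forall>i\<in>{1..n}. \<forall>j\<le>q. (\<Sum>r\<in>growth_functions q n. if r i = j then W r else 0) = f (i, j))"
  using \<open>n \<le> p\<close>
proof (induction n)
  case 0
  show ?case by (rule exI[of _ "\<lambda>_. 1"]) (auto simp: growth_functions_0 u0)
next
  case (Suc n)
  let ?G = "growth_functions q n"
  let ?m = "\<lambda>r. running_max r n"
  from Suc obtain W where W: "\<And>r. r \<in> ?G \<Longrightarrow> 0 \<le> W r"
    and Wu: "\<And>m. m \<le> q \<Longrightarrow> (\<Sum>r\<in>?G. if ?m r = m then W r else 0) = u n m"
    and Wf: "\<And>i j. i \<in> {1..n} \<Longrightarrow> j \<le> q \<Longrightarrow> (\<Sum>r\<in>?G. if r i = j then W r else 0) = f (i, j)"
    using Suc_leD by blast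
  from kernel[of n] Suc.prems obtain w where w: "\<And>m j. m \<le> q \<Longrightarrow> j \<le> q \<Longrightarrow> 0 \<le> w m j"
    and w0: "\<And>m j. m \<le> q \<Longrightarrow> j \<le> q \<Longrightarrow> \<not> (1 \<le> j \<and> j \<le> Suc m) \<Longrightarrow> w m j = 0"
    and wu: "\<And>m. m \<le> q \<Longrightarrow> (\<Sum>j\<le>q. w m j) = u n m"
    and wf: "\<And>j. j \<le> q \<Longrightarrow> (\<Sum>m\<le>q. w m j) = f (Suc n, j)"
    and wS: "\<And>k. k \<le> q \<Longrightarrow> (\<Sum>m\<le>q. \<Sum>j\<le>q. if max m j = k then w m j else 0) = u (Suc n) k"
    by auto
  have fin: "finite ?G" by (rule finite_growth_functions)
  have mq: "?m r \<le> q" if "r \<in> ?G" for r using running_max_le_columns that .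
  \<comment> \<open>Where \<open>u n (?m r)\<close> is 0 the quotient is 0 by convention. This
    agrees with what is wanted, because both W and w vanish on such states (\<open>W_null\<close>,
    \<open>w_null\<close>).\<close>
  define \<Phi> where "\<Phi> r k = W r * w (?m r) k / u n (?m r)" for r k
  define W' where "W' r = \<Phi> (r(Suc n := 0)) (r (Suc n))" for r
  have G0: "r (Suc n) = 0" if "r \<in> ?G" for r using that by (simp add: growth_functions_def)
  have W'_upd: "W' (r(Suc n := k)) = \<Phi> r k" if "r \<in> ?G" for r k
    using G0[OF that] by (simp add: W'_def fun_upd_idem)
  have w_null: "w m j = 0" if "m \<le> q" "j \<le> q" "u n m = 0" for m j
  proof -
    have "\<forall>j\<in>{..q}. w m j = 0"
      using wu[OF that(1)] w that by (subst (asm) that(3), subst (asm) sum_nonneg_eq_0_iff) auto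
    then show ?thesis using that by simp
  qed
  have W_null: "W r = 0" if "r \<in> ?G" "u n (?m r) = 0" for r
  proof -
    have "\<forall>s\<in>?G. (if ?m s = ?m r then W s else 0) = 0"
      using Wu[OF mq[OF that(1)]] W that fin by (subst (asm) that(2), subst (asm) sum_nonneg_eq_0_iff) auto
    then show ?thesis using that by force
  qed
  have sum\<Phi>: "(\<Sum>k\<le>q. \<Phi> r k) = W r" if "r \<in> ?G" for r
  proof -
    have "(\<Sum>k\<le>q. \<Phi> r k) = W r * (\<Sum>k\<le>q. w (?m r) k) / u n (?m r)"
      by (simp add: \<Phi>_def sum_distrib_left sum_divide_distrib)
    then show ?thesis using wu[OF mq[OF that]] W_null[OF that] by simp
  qed
  \<comment> \<open>The prefixes with maximum m have total weight \<open>u n m\<close>, so summing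
    over them cancels the conditioning and leaves one copy of \<open>h m\<close>.\<close>
  have average: "(\<Sum>r\<in>?G. W r * h (?m r) / u n (?m r)) = (\<Sum>m\<le>q. h m)"
    if "\<And>m. m \<le> q \<Longrightarrow> u n m = 0 \<Longrightarrow> h m = 0" for h
  proof -
    have "(\<Sum>m\<le>q. h m) = (\<Sum>m\<le>q. u n m * h m / u n m)"
      using that by (intro sum.cong) auto
    also have "\<dots> = (\<Sum>m\<le>q. \<Sum>r\<in>?G. if ?m r = m then W r * h m / u n m else 0)"
      by (intro sum.cong refl, subst Wu[symmetric])
        (auto simp: sum_distrib_right sum_divide_distrib intro!: sum.cong)
    also have "\<dots> = (\<Sum>r\<in>?G. \<Sum>m\<le>q. if ?m r = m then W r * h m / u n m else 0)"
      by (rule sum.swap)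
    also have "\<dots> = (\<Sum>r\<in>?G. W r * h (?m r) / u n (?m r))"
      using mq by (intro sum.cong) auto
    finally show ?thesis by simp
  qed
  have split: "(\<Sum>r\<in>growth_functions q (Suc n). if P r then W' r else 0) =
      (\<Sum>r\<in>?G. \<Sum>k\<le>q. if P (r(Suc n := k)) then \<Phi> r k else 0)" for P
  proof -
    have "(\<Sum>k\<in>{1..min q (Suc (?m r))}. if P (r(Suc n := k)) then W' (r(Suc n := k)) else 0) =
        (\<Sum>k\<le>q. if P (r(Suc n := k)) then \<Phi> r k else 0)" if "r \<in> ?G" for r
      using w0[OF mq[OF that]] by (intro sum.mono_neutral_cong_left) (auto simp: W'_upd[OF that] \<Phi>_def)
    then show ?thesis unfolding sum_growth_functions_Suc by (rule sum.cong[OF refl])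
  qed
  show ?case
  proof (intro exI[of _ W'] conjI ballI allI impI)
    fix r assume "r \<in> growth_functions q (Suc n)"
    then obtain s k where s: "s \<in> ?G" "k \<le> q" "r = s(Suc n := k)"
      using bij_betw_imp_surj_on[OF growth_functions_Suc[of n q]] by fastforce
    have "0 \<le> u n (?m s)" using wu[OF mq[OF s(1)], symmetric] w[OF mq[OF s(1)]] by (auto intro: sum_nonneg)
    then show "0 \<le> W' r" using W[OF s(1)] w[OF mq[OF s(1)] s(2)] by (simp add: s(3) W'_upd[OF s(1)] \<Phi>_def)
  next
    fix k assume k: "k \<le> q"
    have "(\<Sum>r\<in>growth_functions q (Suc n). if running_max r (Suc n) = k then W' r else 0) =
        (\<Sum>r\<in>?G. \<Sum>j\<le>q. if max (?m r) j = k then \<Phi> r j else 0)"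
    proof -
      have "running_max (r(Suc n := j)) n = ?m r" for r j by (rule running_max_cong) auto
      then show ?thesis by (simp add: split)
    qed
    also have "\<dots> = (\<Sum>r\<in>?G. W r * (\<Sum>j\<le>q. if max (?m r) j = k then w (?m r) j else 0) / u n (?m r))"
      by (intro sum.cong refl) (auto simp: sum_distrib_left sum_divide_distrib \<Phi>_def intro!: sum.cong)
    also have "\<dots> = (\<Sum>m\<le>q. \<Sum>j\<le>q. if max m j = k then w m j else 0)"
      by (rule average) (auto intro!: sum.neutral simp: w_null)
    finally show "(\<Sum>r\<in>growth_functions q (Suc n). if running_max r (Suc n) = k then W' r else 0) = u (Suc n) k"
      by (simp add: wS[OF k])
  next
    fix i j assume i: "i \<in> {1..Suc n}" and j: "j \<le> q"
    show "(\<Sum>r\<in>growth_functions q (Suc n). if r i = j then W' r else 0) = f (i, j)"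
    proof (cases "i = Suc n")
      case True
      have "(\<Sum>r\<in>growth_functions q (Suc n). if r i = j then W' r else 0) =
          (\<Sum>r\<in>?G. W r * w (?m r) j / u n (?m r))"
        using True j by (simp add: split \<Phi>_def)
      also have "\<dots> = (\<Sum>m\<le>q. w m j)" by (rule average) (auto simp: w_null j)
      finally show ?thesis using wf[OF j] True by simp
    next
      case False
      have "(\<Sum>r\<in>growth_functions q (Suc n). if r i = j then W' r else 0) =
          (\<Sum>r\<in>?G. if r i = j then W r else 0)"
        unfolding split using False by (intro sum.cong refl) (simp add: sum\<Phi>)
      then show ?thesis using Wf[of i j] i j False by simp
    qed
  qed
qed

lemma growth_weights_imp_in_orbitope:
  assumes x: "x \<in> coord_space p q"
    and W: "\<And>r. r \<in> growth_functions q p \<Longrightarrow> 0 \<le> W r" "(\<Sum>r\<in>growth_functions q p. W r) = 1"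
    and Wx: "\<And>i j. i \<in> {1..p} \<Longrightarrow> j \<le> q \<Longrightarrow>
      (\<Sum>r\<in>growth_functions q p. if r i = j then W r else 0) = Poly_Mapping.lookup x (i, j)"
  shows "x \<in> partitioning_orbitope p q"
proof -
  have "x = (\<Sum>r\<in>growth_functions q p. W r *\<^sub>R vertex p r)"
  proof (rule poly_mapping_eqI)
    fix k :: pos
    obtain i j where k: "k = (i, j)" by force
    have sum: "Poly_Mapping.lookup (\<Sum>r\<in>growth_functions q p. W r *\<^sub>R vertex p r) k =
        (\<Sum>r\<in>growth_functions q p. if i \<in> {1..p} \<and> r i = j then W r else 0)"
      unfolding lookup_sum k by (intro sum.cong) (auto simp: lookup_vertex)
    show "Poly_Mapping.lookup x k = Poly_Mapping.lookup (\<Sum>r\<in>growth_functions q p. W r *\<^sub>R vertex p r) k"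
    proof (cases "i \<in> {1..p} \<and> j \<le> q")
      case True
      then show ?thesis unfolding sum using Wx[of i j] by (simp add: k)
    next
      case False
      then have "(i, j) \<notin> index_set p q" by (auto simp: index_set_def)
      then have "Poly_Mapping.lookup x k = 0" using lookup_outside[OF x] by (simp add: k)
      moreover have "(\<Sum>r\<in>growth_functions q p. if i \<in> {1..p} \<and> r i = j then W r else 0) = 0"
        using False by (intro sum.neutral) (auto simp: growth_functions_def)
      ultimately show ?thesis unfolding sum by simp
    qed
  qed
  also have "\<dots> \<in> convex hull (vertex p ` growth_functions q p)"
    using W by (intro convex_sum finite_growth_functions convex_convex_hull) (auto intro: hull_inc)
  finally show ?thesis by (simp add: partitioning_orbitope_eq)
qed

section \<open>Tail probabilities of a feasible point\<close>

lemma solution_set_shifted_columns: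
  assumes x: "x \<in> solution_set p q (orbitope_system p q)"
    and "3 \<le> j" "j \<le> q" "j \<le> i" "i \<le> p"
  shows "coord_sum x (bar q (i, j)) \<le> cheapest (Poly_Mapping.lookup x) (i - 1) (j - 1)"
proof -
  have "lower_triangular (Poly_Mapping.lookup x)"
    using x lookup_outside[of x p q]
    by (auto simp: lower_triangular_def solution_set_def index_set_def)
  moreover have "\<forall>\<eta> j c. 1 \<le> \<eta> \<and> 2 \<le> j \<and> diag_coord \<eta> j \<in> index_set p q \<and> admissible_columns \<eta> j c \<longrightarrow>
      satisfies x (Diff_Nonpos (bar q (diag_coord \<eta> j)) (shifted_column \<eta> c))"
    using x unfolding solution_set_def orbitope_system_def by blast
  ultimately show ?thesis
    using shifted_column_constraints_iff[of x p q] assms by simp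
qed

text \<open>The signs of the diagonal entries missing from the system follow from the inequalities
  of length 1: they give x_qq \<le> ... \<le> x_22, and x_qq \<ge> 0 is listed, while x_11 = 1 is
  the first row equation.\<close>

lemma solution_set_nonneg:
  assumes q: "2 \<le> q" "q \<le> p" and x: "x \<in> solution_set p q (orbitope_system p q)"
  shows "0 \<le> Poly_Mapping.lookup x (i, j)"
proof -
  let ?f = "Poly_Mapping.lookup x"
  have van: "lower_triangular ?f"
    using x lookup_outside[of x p q]
    by (auto simp: lower_triangular_def solution_set_def index_set_def)
  have nn: "0 \<le> ?f k" if "k \<in> index_set p q" "\<And>j. j < q \<Longrightarrow> k \<noteq> (j, j)" for k
  proof -
    have "Nonneg k \<in> orbitope_system p q" using that unfolding orbitope_system_def by blast
    then have "satisfies x (Nonneg k)" using x by (auto simp: solution_set_def)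
    then show ?thesis by simp
  qed
  have diag: "0 \<le> ?f (j, j)" if "2 \<le> j" "j \<le> q" for j
    using that(2,1)
  proof (induction j rule: inc_induct)
    case base
    then show ?case using q by (intro nn) (auto simp: index_set_def)
  next
    case (step j)
    have "coord_sum x (bar q (Suc j, Suc j)) \<le> cheapest ?f j j"
      using solution_set_shifted_columns[OF x, of "Suc j" "Suc j"] step q by simp
    moreover obtain i where "j = Suc i" using step by (cases j) auto
    ultimately show ?case using step cheapest_diag[OF van, of i] by (simp add: coord_sum_bar)
  qed
  have "satisfies x (Sum_Eq_One (row_set q 1))"
    using x q unfolding solution_set_def orbitope_system_def by fastforce
  then have one: "?f (1, 1) = 1" using q by (simp add: coord_sum_row)
  show ?thesis
  proof (cases "(i, j) \<in> index_set p q \<and> i = j")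
    case True
    then show ?thesis using diag[of j] one by (cases "j = 1") (auto simp: index_set_def)
  next
    case False
    then show ?thesis using nn[of "(i, j)"] x lookup_outside[of x p q i j]
      by (cases "(i, j) \<in> index_set p q") (auto simp: solution_set_def)
  qed
qed

lemma cheapest_nonneg: "(\<And>k. 0 \<le> f k) \<Longrightarrow> 0 \<le> cheapest f i j"
  by (induction i arbitrary: j) auto

text \<open>A convex combination of growth functions is a random growth function, built row by row as a
  Markov chain in the current maximum. \<^term>\<open>max_tail\<close> is the largest possible probability that
  the maximum of the first \<^term>\<open>i\<close> values is at least \<^term>\<open>j\<close>.\<close>

definition max_tail :: "nat \<Rightarrow> (pos \<Rightarrow> real) \<Rightarrow> nat \<Rightarrow> nat \<Rightarrow> real" where
  "max_tail q f i j = (if j = 0 then 1 else if q < j then 0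
     else if j = 1 then (if i = 0 then 0 else 1) else min 1 (cheapest f i j))"

context
  fixes p q :: nat and x :: "pos \<Rightarrow>\<^sub>0 real"
  assumes q: "2 \<le> q" "q \<le> p" and x: "x \<in> solution_set p q (orbitope_system p q)"
begin

private abbreviation "f \<equiv> Poly_Mapping.lookup x"
private abbreviation "F \<equiv> max_tail q f"

private lemma in_coord_space: "x \<in> coord_space p q"
  using x by (simp add: solution_set_def)

private lemma triangular: "lower_triangular f"
  using lookup_outside[OF in_coord_space] by (auto simp: lower_triangular_def index_set_def)

private lemma nonneg: "0 \<le> f k"
  using solution_set_nonneg[OF q x] by (cases k) auto

private lemma col_0: "f (i, 0) = 0"
  using lookup_outside[OF in_coord_space, of i 0] by (simp add: index_set_def)

private lemma F_nonneg: "0 \<le> F i j"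
  using cheapest_nonneg[of f, OF nonneg] by (simp add: max_tail_def)

private lemma prefix_sum:
  assumes i: "i \<in> {1..p}"
  shows "1 - (\<Sum>l<j. f (i, l)) = (if j \<le> min i q then if j = 0 then 1 else coord_sum x (bar q (i, j)) else 0)"
proof -
  have "satisfies x (Sum_Eq_One (row_set q i))"
    using x i unfolding solution_set_def orbitope_system_def by blast
  then have row: "(\<Sum>l\<in>{1..min i q}. f (i, l)) = 1" by (simp add: coord_sum_row)
  have outside: "f (i, l) = 0" if "l = 0 \<or> min i q < l" for l
    using that i lookup_outside[OF in_coord_space, of i l]
    by (auto simp: index_set_def min_def split: if_splits)
  show ?thesis
  proof (cases "j \<le> min i q")
    case True
    have "(\<Sum>l\<in>{1..min i q}. f (i, l)) = (\<Sum>l\<in>{0..min i q}. f (i, l))"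
      using outside by (intro sum.mono_neutral_left) (auto intro: Suc_leI gr0I)
    also have "{0..min i q} = {..<j} \<union> {j..min i q}" using True by auto
    also have "(\<Sum>l\<in>{..<j} \<union> {j..min i q}. f (i, l)) = (\<Sum>l<j. f (i, l)) + (\<Sum>l\<in>{j..min i q}. f (i, l))"
      by (intro sum.union_disjoint) auto
    finally show ?thesis using True row by (simp add: coord_sum_bar)
  next
    case False
    have "(\<Sum>l\<in>{1..min i q}. f (i, l)) = (\<Sum>l<j. f (i, l))"
      using False outside by (intro sum.mono_neutral_left) (auto intro: Suc_leI gr0I)
    then show ?thesis using False row by auto
  qed
qed

private lemma row_total: "i \<in> {1..p} \<Longrightarrow> (\<Sum>l<Suc q. f (i, l)) = 1"
  using prefix_sum[of i "Suc q"] by simp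

private lemma F_le_add: "Suc i \<le> p \<Longrightarrow> F (Suc i) j \<le> F i j + f (Suc i, j)"
proof -
  assume "Suc i \<le> p"
  \<comment> \<open>In row 1 the tail at column 1 jumps from 0 to 1, and x_11 = 1 pays for this
    jump.\<close>
  then have "i = 0 \<Longrightarrow> f (1, 1) = 1"
    using prefix_sum[of 1 2] col_0 q by (simp add: numeral_2_eq_2)
  then show ?thesis
    using nonneg[of "(Suc i, j)"] cheapest_le_extend[of f i j] by (auto simp: max_tail_def)
qed

text \<open>Strictly below the diagonal this is the diagonal move of the recursion. On the diagonal,
  where that move is withheld, it is the inequality x_(j+1,j+1) \<le> x_jj. In column 2 it is the
  cap by 1, the tail at column 1.\<close>

private lemma F_le_diag: "Suc i \<le> p \<Longrightarrow> F (Suc i) (Suc j) \<le> F i j"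
proof -
  assume i: "Suc i \<le> p"
  consider "j = 0 \<or> q \<le> j" | "j = 1" "i = 0" | "j = 1" "0 < i" | "2 \<le> j" "j < q" by linarith
  then show ?thesis
  proof cases
    case 1
    then show ?thesis using F_nonneg[of i j] by (auto simp: max_tail_def)
  next
    case 2
    then show ?thesis using triangular by (simp add: max_tail_def lower_triangular_def)
  next
    case 3
    then show ?thesis using q by (simp add: max_tail_def)
  next
    case 4
    consider "i < j" | "i = j" | "j < i" by linarith
    then have "cheapest f (Suc i) (Suc j) \<le> cheapest f i j"
    proof cases
      case 1
      then show ?thesis by (simp add: cheapest_above_diag[OF triangular] del: cheapest.simps)
    next
      case 2
      obtain k where "j = Suc k" using 4 by (cases j) auto
      then show ?thesis
        using solution_set_shifted_columns[OF x, of "Suc j" "Suc j"] 4 q 2 cheapest_diag[OF triangular, of j]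
        by (simp add: coord_sum_bar del: cheapest.simps)
    qed (use 4 in auto)
    then show ?thesis using 4 by (auto simp: max_tail_def)
  qed
qed

text \<open>A vertical move adds a nonnegative entry. After a diagonal move the new value is
  \<open>F (Suc i) (j - 1)\<close>; by induction this is at least \<open>F i (j - 1)\<close>, which
  by \<open>F_le_diag\<close> bounds the old value.\<close>

private lemma F_mono: "Suc i \<le> p \<Longrightarrow> F i j \<le> F (Suc i) j"
proof (induction i arbitrary: j)
  case 0
  show ?case using F_nonneg[of "Suc 0" j] by (auto simp: max_tail_def)
next
  case (Suc i)
  show ?case
  proof (cases "2 < j \<and> j \<le> q \<and> j \<le> Suc i \<and> cheapest f (Suc i) (j - 1) < cheapest f (Suc i) j + f (Suc (Suc i), j)")
    case True
    then obtain k where k: "j = Suc k" "2 \<le> k" by (cases j) auto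
    have "F (Suc i) j \<le> F i k" using F_le_diag[of i k] Suc.prems k by simp
    also have "\<dots> \<le> F (Suc i) k" using Suc by simp
    finally have "F (Suc i) j \<le> F (Suc i) k" .
    moreover have "cheapest f (Suc (Suc i)) j = cheapest f (Suc i) k"
      unfolding cheapest.simps(2)[of f "Suc i" j] using True k by (simp del: cheapest.simps)
    then have "F (Suc i) k = F (Suc (Suc i)) j"
      using True k by (simp add: max_tail_def del: cheapest.simps)
    ultimately show ?thesis by simp
  next
    case False
    then have "cheapest f (Suc i) j \<le> cheapest f (Suc (Suc i)) j" if "j \<le> q"
      unfolding cheapest.simps(2)[of f "Suc i" j]
      using that nonneg[of "(Suc (Suc i), j)"] by (auto simp del: cheapest.simps)
    then show ?thesis by (auto simp: max_tail_def simp del: cheapest.simps)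
  qed
qed

text \<open>The move taken by the recursion selects the inequality: after a diagonal move it is the
  one for the bar starting in column j, after a vertical move the one for the bar starting in column
  j + 1, with x_(i+1,j) added to both sides. If the latter bar is empty, nonnegativity of
  \<open>cheapest\<close> takes its place.\<close>

private lemma bar_le_F:
  assumes i: "Suc i \<le> p" and j: "j \<le> q"
  shows "1 - (\<Sum>l<j. f (Suc i, l)) \<le> F (Suc i) j"
proof (cases "2 \<le> j")
  case False
  then have "j = 0 \<or> j = 1" by auto
  then show ?thesis using q col_0 by (auto simp: max_tail_def)
next
  case True
  have le1: "1 - (\<Sum>l<j. f (Suc i, l)) \<le> 1" using nonneg by (simp add: sum_nonneg)
  note bars = prefix_sum[of "Suc i"] solution_set_shifted_columns[OF x, of _ "Suc i"]
  have "1 - (\<Sum>l<j. f (Suc i, l)) \<le> cheapest f (Suc i) j"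
  proof (cases "2 < j \<and> j \<le> i \<and> cheapest f i (j - 1) < cheapest f i j + f (Suc i, j)")
    case True
    then show ?thesis using bars(1)[of j] bars(2)[of j] i j by simp
  next
    case False
    have "1 - (\<Sum>l<Suc j. f (Suc i, l)) \<le> cheapest f i j"
      using bars(1)[of "Suc j"] bars(2)[of "Suc j"] i True cheapest_nonneg[of f i j, OF nonneg]
      by (auto split: if_splits)
    then show ?thesis using False by auto
  qed
  then show ?thesis using le1 True j by (simp add: max_tail_def)
qed

lemma solution_in_orbitope: "x \<in> partitioning_orbitope p q"
proof -
  define u where "u i m = F i m - F i (Suc m)" for i m
  have "\<exists>W. (\<forall>r\<in>growth_functions q p. 0 \<le> W r) \<and>
    (\<forall>m\<le>q. (\<Sum>r\<in>growth_functions q p. if running_max r p = m then W r else 0) = u p m) \<and>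
    (\<forall>i\<in>{1..p}. \<forall>j\<le>q. (\<Sum>r\<in>growth_functions q p. if r i = j then W r else 0) = f (i, j))"
  proof (rule growth_weights[where p = p])
    show "u 0 0 = 1" using q by (simp add: u_def max_tail_def)
    show "u 0 m = 0" if "0 < m" for m using that by (simp add: u_def max_tail_def)
    fix i assume i: "i < p"
    show "\<exists>w. (\<forall>m\<le>q. \<forall>j\<le>q. 0 \<le> w m j \<and> (\<not> (1 \<le> j \<and> j \<le> Suc m) \<longrightarrow> w m j = 0)) \<and>
      (\<forall>m\<le>q. (\<Sum>j\<le>q. w m j) = u i m) \<and> (\<forall>j\<le>q. (\<Sum>m\<le>q. w m j) = f (Suc i, j)) \<and>
      (\<forall>n\<le>q. (\<Sum>m\<le>q. \<Sum>j\<le>q. if max m j = n then w m j else 0) = u (Suc i) n)"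
    proof (rule row_kernel[of "F (Suc i)" q "F i" "\<lambda>j. f (Suc i, j)"])
      show "F (Suc i) 0 = 1" "F (Suc i) (Suc q) = 0" "F i 0 = 1" "F i (Suc q) = 0"
        by (simp_all add: max_tail_def)
      show "F i j \<le> F (Suc i) j" "F (Suc i) j \<le> F i j + f (Suc i, j)" "F (Suc i) (Suc j) \<le> F i j" for j
        using F_mono F_le_add F_le_diag i by auto
      show "1 - (\<Sum>l<j. f (Suc i, l)) \<le> F (Suc i) j" if "j \<le> q" for j
        using bar_le_F i that by simp
      show "(\<Sum>l<Suc q. f (Suc i, l)) = 1" "f (Suc i, 0) = 0" using row_total[of "Suc i"] i col_0 by auto
    next
      fix w assume "\<And>m j. m \<le> q \<Longrightarrow> j \<le> q \<Longrightarrow> 0 \<le> w m j"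
        "\<And>m j. m \<le> q \<Longrightarrow> j \<le> q \<Longrightarrow> \<not> (1 \<le> j \<and> j \<le> Suc m) \<Longrightarrow> w m j = 0"
        "\<And>m. m \<le> q \<Longrightarrow> (\<Sum>j\<le>q. w m j) = F i m - F i (Suc m)"
        "\<And>j. j \<le> q \<Longrightarrow> (\<Sum>m\<le>q. w m j) = f (Suc i, j)"
        "\<And>n. n \<le> q \<Longrightarrow> (\<Sum>m\<le>q. \<Sum>j\<le>q. if max m j = n then w m j else 0) = F (Suc i) n - F (Suc i) (Suc n)"
      then show ?thesis unfolding u_def by (intro exI[of _ w] conjI allI impI) blast+
    qed
  qed simp
  then obtain W where W: "\<And>r. r \<in> growth_functions q p \<Longrightarrow> 0 \<le> W r"
    and Wu: "\<And>m. m \<le> q \<Longrightarrow> (\<Sum>r\<in>growth_functions q p. if running_max r p = m then W r else 0) = u p m"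
    and Wf: "\<And>i j. i \<in> {1..p} \<Longrightarrow> j \<le> q \<Longrightarrow> (\<Sum>r\<in>growth_functions q p. if r i = j then W r else 0) = f (i, j)"
    by blast
  have "(\<Sum>r\<in>growth_functions q p. W r) =
      (\<Sum>r\<in>growth_functions q p. \<Sum>m\<le>q. if running_max r p = m then W r else 0)"
    using running_max_le_columns by (intro sum.cong) auto
  also have "\<dots> = (\<Sum>m\<le>q. u p m)" by (subst sum.swap) (simp add: Wu)
  also have "\<dots> = 1" unfolding u_def by (subst sum_telescope) (simp add: max_tail_def)
  finally show ?thesis using growth_weights_imp_in_orbitope[OF in_coord_space, of W] W Wf by simp
qed

end

theorem partitioning_orbitope_eq_solution_set:
  assumes "2 \<le> q" "q \<le> p"
  shows "partitioning_orbitope p q = solution_set p q (orbitope_system p q)"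
  using orbitope_subset_solution_set solution_in_orbitope[OF assms] by blast

section \<open>Non-redundancy\<close>

definition point_of :: "nat \<Rightarrow> nat \<Rightarrow> (pos \<Rightarrow> real) \<Rightarrow> pos \<Rightarrow>\<^sub>0 real" where
  "point_of p q g = Abs_poly_mapping (\<lambda>k. if k \<in> index_set p q then g k else 0)"

lemma finite_index_set: "finite (index_set p q)"
  by (rule finite_subset[of _ "{1..p} \<times> {1..q}"]) (auto simp: index_set_def)

lemma lookup_point_of:
  "Poly_Mapping.lookup (point_of p q g) k = (if k \<in> index_set p q then g k else 0)"
proof -
  have "finite {k. (if k \<in> index_set p q then g k else 0) \<noteq> 0}"
    by (rule finite_subset[OF _ finite_index_set[of p q]]) auto
  then show ?thesis by (simp add: point_of_def)
qed

lemma point_of_in_coord_space: "point_of p q g \<in> coord_space p q"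
  by (auto simp: coord_space_def in_keys_iff lookup_point_of split: if_splits)

lemma point_of_row: "i \<in> {1..p} \<Longrightarrow> coord_sum (point_of p q g) (row_set q i) = (\<Sum>l\<in>{1..min i q}. g (i, l))"
  unfolding coord_sum_row by (intro sum.cong) (auto simp: lookup_point_of index_set_def)

lemma point_of_bar:
  "i \<in> {1..p} \<Longrightarrow> 1 \<le> j \<Longrightarrow> coord_sum (point_of p q g) (bar q (i, j)) = (\<Sum>l\<in>{j..min i q}. g (i, l))"
  unfolding coord_sum_bar by (intro sum.cong) (auto simp: lookup_point_of index_set_def)

lemma point_of_shifted_column:
  assumes "admissible_path \<eta> c" "1 \<le> \<eta>" "c \<eta> \<le> q" "c \<eta> + \<eta> - 1 \<le> p"
  shows "coord_sum (point_of p q g) (shifted_column \<eta> c) = column_sum g \<eta> c"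
  unfolding coord_sum_shifted_column[OF assms(1)] column_sum_def
proof (intro sum.cong refl)
  fix k assume k: "k \<in> {1..\<eta>}"
  then have "2 \<le> c k" "c k \<le> c \<eta>"
    using admissible_path_ge2[OF assms(1)] admissible_path_mono[OF assms(1)] by auto
  then have "diag_coord k (c k) \<in> index_set p q"
    using k assms by (auto simp: diag_coord_def index_set_def)
  then show "Poly_Mapping.lookup (point_of p q g) (diag_coord k (c k)) = g (diag_coord k (c k))"
    by (simp add: lookup_point_of)
qed

definition irredundant :: "nat \<Rightarrow> nat \<Rightarrow> lin_constraint \<Rightarrow> bool" where
  "irredundant p q con \<longleftrightarrow> (\<exists>x :: pos \<Rightarrow>\<^sub>0 real. x \<in> coord_space p q \<and> \<not> satisfies x con \<and>
     (\<forall>con'\<in>orbitope_system p q. con' \<noteq> con \<longrightarrow> satisfies x con'))"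

lemma irredundantI:
  assumes "\<not> satisfies (point_of p q g) con"
    "\<And>con'. con' \<in> orbitope_system p q \<Longrightarrow> con' \<noteq> con \<Longrightarrow> satisfies (point_of p q g) con'"
  shows "irredundant p q con"
  unfolding irredundant_def using assms point_of_in_coord_space by blast

lemma nonredundantI:
  assumes "\<And>con. con \<in> orbitope_system p q \<Longrightarrow> irredundant p q con"
  shows "nonredundant p q (orbitope_system p q)"
  unfolding nonredundant_def
proof
  fix con assume con: "con \<in> orbitope_system p q"
  with assms[OF con] obtain x :: "pos \<Rightarrow>\<^sub>0 real" where x: "x \<in> coord_space p q" "\<not> satisfies x con"
    "\<And>con'. con' \<in> orbitope_system p q \<Longrightarrow> con' \<noteq> con \<Longrightarrow> satisfies x con'"
    unfolding irredundant_def by blast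
  have "x \<in> solution_set p q (orbitope_system p q - {con})"
    using x by (auto simp: solution_set_def)
  moreover have "x \<notin> solution_set p q (orbitope_system p q)"
    using x con by (auto simp: solution_set_def)
  ultimately show "solution_set p q (orbitope_system p q) \<subset> solution_set p q (orbitope_system p q - {con})"
    by (auto simp: solution_set_def)
qed

lemma shifted_column_cong:
  "(\<And>k. k \<in> {1..\<eta>} \<Longrightarrow> c k = c' k) \<Longrightarrow> shifted_column \<eta> c = shifted_column \<eta> c'"
  unfolding shifted_column_def by force

lemma shifted_constraintE:
  assumes "1 \<le> \<eta>" "2 \<le> j" "diag_coord \<eta> j \<in> index_set p q" "admissible_columns \<eta> j c"
  shows "diag_coord \<eta> j = (j + \<eta> - 1, j)" "admissible_path \<eta> c" "3 \<le> j" "j \<le> q" "j + \<eta> - 1 \<in> {1..p}"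
    "c \<eta> \<le> j - 1" "\<eta> = 1 \<Longrightarrow> c 1 = j - 1" "c \<eta> \<le> q" "c \<eta> + \<eta> - 1 \<le> p"
    "\<And>k. k \<in> {1..\<eta>} \<Longrightarrow> 2 \<le> c k \<and> c k \<le> j - 1 \<and> c k + k \<le> j + \<eta> - 1"
proof -
  show ap: "admissible_path \<eta> c" and le: "c \<eta> \<le> j - 1" and "\<eta> = 1 \<Longrightarrow> c 1 = j - 1"
    using assms admissible_columns_iff by (auto split: if_splits)
  show dc: "diag_coord \<eta> j = (j + \<eta> - 1, j)" by (simp add: diag_coord_def)
  show "3 \<le> j" using le admissible_path_ge2[OF ap, of \<eta>] assms by simp
  show j: "j \<le> q" "j + \<eta> - 1 \<in> {1..p}" using assms(3) by (auto simp: dc index_set_def)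
  show "c \<eta> \<le> q" "c \<eta> + \<eta> - 1 \<le> p" using le j by auto
  show "2 \<le> c k \<and> c k \<le> j - 1 \<and> c k + k \<le> j + \<eta> - 1" if "k \<in> {1..\<eta>}" for k
    using le that assms admissible_path_ge2[OF ap, of k] admissible_path_mono[OF ap, of k \<eta>] by auto
qed

text \<open>The columns from the second one on determine a point satisfying the row equations; the first
  column does not occur in the shifted column inequalities.\<close>

definition filled :: "nat \<Rightarrow> (nat \<Rightarrow> nat \<Rightarrow> real) \<Rightarrow> pos \<Rightarrow> real" where
  "filled q w = (\<lambda>(i, j). if j = 1 then 1 - (\<Sum>l\<in>{2..min i q}. w i l) else w i j)"

lemma column_sum_filled:
  "(\<And>k. k \<in> {1..\<eta>} \<Longrightarrow> 2 \<le> c k) \<Longrightarrow> column_sum (filled q w) \<eta> c = column_sum (\<lambda>(i, j). w i j) \<eta> c"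
  unfolding column_sum_def by (intro sum.cong) (force simp: filled_def diag_coord_def)+

text \<open>\<open>con0\<close> is the constraint to be violated, so every obligation is imposed
  only away from it. The bound on the row sums expresses nonnegativity of the first column.\<close>

lemma filled_satisfies:
  assumes "1 \<le> q"
    and row: "\<And>i. i \<in> {1..p} \<Longrightarrow> Nonneg (i, 1) \<noteq> con0 \<Longrightarrow> (\<Sum>l\<in>{2..min i q}. w i l) \<le> 1"
    and nonneg: "\<And>i j. (i, j) \<in> index_set p q \<Longrightarrow> 2 \<le> j \<Longrightarrow> Nonneg (i, j) \<noteq> con0 \<Longrightarrow> 0 \<le> w i j"
    and col: "\<And>\<eta> j c. 1 \<le> \<eta> \<Longrightarrow> 2 \<le> j \<Longrightarrow> diag_coord \<eta> j \<in> index_set p q \<Longrightarrow> admissible_columns \<eta> j c \<Longrightarrow>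
      Diff_Nonpos (bar q (diag_coord \<eta> j)) (shifted_column \<eta> c) \<noteq> con0 \<Longrightarrow>
      (\<Sum>l\<in>{j..min (j + \<eta> - 1) q}. w (j + \<eta> - 1) l) \<le> column_sum (\<lambda>(i, j). w i j) \<eta> c"
    and con: "con \<in> orbitope_system p q" "con \<noteq> con0"
  shows "satisfies (point_of p q (filled q w)) con"
  using con(1)
proof (cases rule: orbitope_system_cases)
  case (row i)
  have "{1..min i q} = insert 1 {2..min i q}" using row assms(1) by auto
  then show ?thesis using row by (simp add: point_of_row filled_def)
next
  case (nonneg k)
  then show ?thesis using assms(2,3) con(2)
    by (cases k) (auto simp: lookup_point_of filled_def index_set_def)
next
  case (col \<eta> j c)
  note E = shifted_constraintE[OF col(1-4)]
  have "coord_sum (point_of p q (filled q w)) (bar q (diag_coord \<eta> j)) = (\<Sum>l\<in>{j..min (j + \<eta> - 1) q}. filled q w (j + \<eta> - 1, l))"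
    unfolding E(1) using E(3) by (intro point_of_bar E) simp
  also have "\<dots> = (\<Sum>l\<in>{j..min (j + \<eta> - 1) q}. w (j + \<eta> - 1) l)"
    using E(3) by (intro sum.cong) (auto simp: filled_def)
  also have "\<dots> \<le> column_sum (\<lambda>(i, j). w i j) \<eta> c"
    using assms(4)[OF col(1-4)] col(5) con(2) by simp
  also have "\<dots> = coord_sum (point_of p q (filled q w)) (shifted_column \<eta> c)"
    using E(10) by (subst point_of_shifted_column[OF E(2) col(1) E(8,9)], subst column_sum_filled) auto
  finally show ?thesis by (simp add: col(5))
qed

section \<open>Points violating a row equation or a sign constraint\<close>

lemma row_equation_irredundant:
  assumes i0: "i0 \<in> {1..p}" and q: "1 \<le> q"
  shows "irredundant p q (Sum_Eq_One (row_set q i0))"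
proof -
  \<comment> \<open>All mass sits in column 1, which occurs in no shifted column inequality, so the
    doubled entry disturbs only its own row equation.\<close>
  define g :: "pos \<Rightarrow> real" where "g = (\<lambda>(i, j). if j = 1 then if i = i0 then 2 else 1 else 0)"
  have row_sum: "coord_sum (point_of p q g) (row_set q i) = (if i = i0 then 2 else 1)" if "i \<in> {1..p}" for i
  proof -
    have "(\<Sum>l\<in>{1..min i q}. g (i, l)) = (\<Sum>l\<in>{1}. g (i, l))"
      using that q by (intro sum.mono_neutral_right) (auto simp: g_def)
    then show ?thesis using that by (simp add: point_of_row g_def)
  qed
  have "satisfies (point_of p q g) con"
    if "con \<in> orbitope_system p q" "con \<noteq> Sum_Eq_One (row_set q i0)" for con
    using that(1)
  proof (cases rule: orbitope_system_cases)
    case (row i)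
    then show ?thesis using row_sum[of i] that(2) by auto
  next
    case (nonneg k)
    then show ?thesis by (cases k) (auto simp: lookup_point_of g_def)
  next
    case (col \<eta> j c)
    note E = shifted_constraintE[OF col(1-4)]
    have "coord_sum (point_of p q g) (bar q (diag_coord \<eta> j)) = 0"
      unfolding E(1) using E(3) by (subst point_of_bar[OF E(5)]) (auto simp: g_def intro!: sum.neutral)
    moreover have "0 \<le> coord_sum (point_of p q g) (shifted_column \<eta> c)"
      unfolding coord_sum_def by (intro sum_nonneg) (auto simp: lookup_point_of g_def)
    ultimately show ?thesis by (simp add: col(5))
  qed
  moreover have "\<not> satisfies (point_of p q g) (Sum_Eq_One (row_set q i0))" using row_sum[OF i0] by simp
  ultimately show ?thesis by (intro irredundantI) auto
qed

lemma first_column_nonneg_irredundant: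
  assumes q: "2 \<le> q" and i0: "2 \<le> i0" "i0 \<le> p"
  shows "irredundant p q (Nonneg (i0, 1))"
proof -
  \<comment> \<open>The 2 in column 2 makes the filled entry in column 1 equal to -1. The bars of
    the system start in column 3 or later, so weight in column 2 can only enlarge right-hand
    sides.\<close>
  define w :: "nat \<Rightarrow> nat \<Rightarrow> real" where "w i j = (if i = i0 \<and> j = 2 then 2 else 0)" for i j
  have "satisfies (point_of p q (filled q w)) con"
    if "con \<in> orbitope_system p q" "con \<noteq> Nonneg (i0, 1)" for con
  proof (rule filled_satisfies[OF _ _ _ _ that])
    show "(\<Sum>l\<in>{2..min i q}. w i l) \<le> 1" if "Nonneg (i, 1) \<noteq> Nonneg (i0, 1)" for i
      using that by (simp add: w_def)
    fix \<eta> j c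
    assume a: "1 \<le> \<eta>" "2 \<le> j" "diag_coord \<eta> j \<in> index_set p q" "admissible_columns \<eta> j c"
    have "(\<Sum>l\<in>{j..min (j + \<eta> - 1) q}. w (j + \<eta> - 1) l) = 0"
      using shifted_constraintE(3)[OF a] by (intro sum.neutral) (auto simp: w_def)
    moreover have "0 \<le> column_sum (\<lambda>(i, j). w i j) \<eta> c"
      unfolding column_sum_def by (intro sum_nonneg) (auto simp: w_def diag_coord_def)
    ultimately show "(\<Sum>l\<in>{j..min (j + \<eta> - 1) q}. w (j + \<eta> - 1) l) \<le> column_sum (\<lambda>(i, j). w i j) \<eta> c"
      by simp
  qed (use q in \<open>auto simp: w_def\<close>)
  moreover have "(\<Sum>l\<in>{2..min i0 q}. w i0 l) = 2" using q i0 by (simp add: w_def)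
  then have "\<not> satisfies (point_of p q (filled q w)) (Nonneg (i0, 1))"
    using q i0 by (simp add: lookup_point_of filled_def index_set_def)
  ultimately show ?thesis by (intro irredundantI)
qed

lemma column_sum_ge_first:
  fixes f :: "pos \<Rightarrow> 'a::linordered_idom"
  assumes "1 \<le> \<eta>" "\<And>k. k \<in> {2..\<eta>} \<Longrightarrow> 0 \<le> f (diag_coord k (c k))"
  shows "f (c 1, c 1) \<le> column_sum f \<eta> c"
proof -
  have "{1..\<eta>} = insert 1 {2..\<eta>}" using assms(1) by auto
  then have "column_sum f \<eta> c = f (c 1, c 1) + (\<Sum>k\<in>{2..\<eta>}. f (diag_coord k (c k)))"
    by (simp add: column_sum_def diag_coord_def)
  then show ?thesis using sum_nonneg[of "{2..\<eta>}" "\<lambda>k. f (diag_coord k (c k))"] assms(2) by simp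
qed

lemma later_column_nonneg_irredundant:
  assumes q: "2 \<le> q" "q \<le> p" and k0: "(i0, j0) \<in> index_set p q" "2 \<le> j0" "i0 = j0 \<Longrightarrow> j0 = q"
  shows "irredundant p q (Nonneg (i0, j0))"
proof -
  \<comment> \<open>The entry -1 is paid for on the diagonal: a shifted column through (i0, j0) with
    j0 < i0 starts at some (c_1, c_1) with c_1 \<le> j0, where the weight is 1. If i0 = j0 = q, no
    shifted column contains the cell, because their columns stay below q.\<close>
  define w :: "nat \<Rightarrow> nat \<Rightarrow> real" where
    "w i j = (if (i, j) = (i0, j0) then -1 else if i = j \<and> 2 \<le> j \<and> j \<le> j0 \<and> j < i0 then 1 else 0)" for i j
  have sum_le: "(\<Sum>l\<in>A. w i l) \<le> 1" if "finite A" for A i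
  proof -
    have "(\<Sum>l\<in>A. w i l) \<le> (\<Sum>l\<in>A. if l = i then 1 else 0)"
      by (intro sum_mono) (auto simp: w_def)
    then show ?thesis using that by (auto split: if_splits)
  qed
  have "satisfies (point_of p q (filled q w)) con"
    if "con \<in> orbitope_system p q" "con \<noteq> Nonneg (i0, j0)" for con
  proof (rule filled_satisfies[OF _ _ _ _ that])
    fix \<eta> j c
    assume a: "1 \<le> \<eta>" "2 \<le> j" "diag_coord \<eta> j \<in> index_set p q" "admissible_columns \<eta> j c"
    note E = shifted_constraintE[OF a]
    define i where "i = j + \<eta> - 1"
    let ?f = "\<lambda>(i, j). w i j"
    have nonneg: "0 \<le> ?f (diag_coord k (c k))" if "diag_coord k (c k) \<noteq> (i0, j0)" for k
      using that by (auto simp: w_def diag_coord_def)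
    show "(\<Sum>l\<in>{j..min (j + \<eta> - 1) q}. w (j + \<eta> - 1) l) \<le> column_sum ?f \<eta> c"
      unfolding i_def[symmetric]
    proof (cases "i \<le> j0 \<and> i < i0")
      case True
      \<comment> \<open>A bar in such a row can contain a diagonal one. The shifted column starts
        further up on the diagonal, also with weight 1, and stays above row i0.\<close>
      have "1 \<le> ?f (c 1, c 1)" using True E(10)[of 1] a(1) by (auto simp: w_def i_def)
      also have "\<dots> \<le> column_sum ?f \<eta> c"
      proof (rule column_sum_ge_first[OF a(1)])
        fix k assume "k \<in> {2..\<eta>}"
        then show "0 \<le> ?f (diag_coord k (c k))"
          using E(10)[of k] True by (intro nonneg) (auto simp: diag_coord_def i_def)
      qed
      finally show "(\<Sum>l\<in>{j..min i q}. w i l) \<le> column_sum ?f \<eta> c"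
        using sum_le[of "{j..min i q}" i] by simp
    next
      case False
      have "(\<Sum>l\<in>{j..min i q}. w i l) \<le> 0"
        using False by (intro sum_nonpos) (auto simp: w_def)
      also have "0 \<le> column_sum ?f \<eta> c"
      proof (cases "\<exists>k\<in>{1..\<eta>}. diag_coord k (c k) = (i0, j0)")
        case True
        then obtain k where k: "k \<in> {1..\<eta>}" "c k + k - 1 = i0" "c k = j0" by (auto simp: diag_coord_def)
        have "i0 \<noteq> j0" using k E(10)[of k] E(4) k0 by auto
        then have k1: "k \<noteq> 1" "j0 < i0" using k by auto
        have other: "0 \<le> ?f (diag_coord l (c l))" if "l \<in> {1..\<eta>}" "l \<noteq> k" for l
        proof (rule nonneg)
          have "l < k \<Longrightarrow> c l + l < c k + k" "k < l \<Longrightarrow> c k + k < c l + l"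
            using that k by (auto intro!: row_lt_in_path[OF E(2)])
          then show "diag_coord l (c l) \<noteq> (i0, j0)"
            using that k by (auto simp: diag_coord_def)
        qed
        have "column_sum ?f \<eta> c = ?f (diag_coord k (c k)) +
            (?f (diag_coord 1 (c 1)) + (\<Sum>l\<in>{1..\<eta>} - {k} - {1}. ?f (diag_coord l (c l))))"
          unfolding column_sum_def using k k1 a(1)
          by (subst sum.remove[of _ k], simp_all, subst sum.remove[of _ 1], simp_all)
        moreover have "?f (diag_coord k (c k)) = -1" using k by (simp add: diag_coord_def w_def)
        moreover have "c 1 \<le> j0" using admissible_path_mono[OF E(2), of 1 k] k by auto
        then have "?f (diag_coord 1 (c 1)) = 1"
          using k1 E(10)[of 1] a(1) by (simp add: diag_coord_def w_def)
        moreover have "0 \<le> (\<Sum>l\<in>{1..\<eta>} - {k} - {1}. ?f (diag_coord l (c l)))"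
          using other by (intro sum_nonneg) blast
        ultimately show ?thesis by linarith
      next
        case False
        then show ?thesis unfolding column_sum_def using nonneg by (intro sum_nonneg) blast
      qed
      finally show "(\<Sum>l\<in>{j..min i q}. w i l) \<le> column_sum ?f \<eta> c" .
    qed
  qed (use q sum_le in \<open>auto simp: w_def\<close>)
  moreover have "\<not> satisfies (point_of p q (filled q w)) (Nonneg (i0, j0))"
    using k0 by (simp add: lookup_point_of filled_def w_def)
  ultimately show ?thesis by (intro irredundantI)
qed

section \<open>Points violating a single shifted column inequality\<close>

text \<open>The shifted column inequalities are homogeneous and avoid the first column, so violating
  weights may be scaled down until the first column can be filled up.\<close>

lemma shifted_column_irredundantI:
  fixes w :: "nat \<Rightarrow> nat \<Rightarrow> int"
  assumes q: "1 \<le> q" and nonneg: "\<And>i j. 2 \<le> j \<Longrightarrow> j \<le> q \<Longrightarrow> j \<le> i \<Longrightarrow> 0 \<le> w i j"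
    and a0: "1 \<le> \<eta>0" "2 \<le> j0" "diag_coord \<eta>0 j0 \<in> index_set p q" "admissible_columns \<eta>0 j0 c0"
    and viol: "column_sum (\<lambda>(i, j). w i j) \<eta>0 c0 < (\<Sum>l\<in>{j0..min (j0 + \<eta>0 - 1) q}. w (j0 + \<eta>0 - 1) l)"
    and col: "\<And>\<eta> j c. 1 \<le> \<eta> \<Longrightarrow> 2 \<le> j \<Longrightarrow> diag_coord \<eta> j \<in> index_set p q \<Longrightarrow> admissible_columns \<eta> j c \<Longrightarrow>
      \<not> (\<eta> = \<eta>0 \<and> j = j0 \<and> (\<forall>k\<in>{1..\<eta>}. c k = c0 k)) \<Longrightarrow>
      (\<Sum>l\<in>{j..min (j + \<eta> - 1) q}. w (j + \<eta> - 1) l) \<le> column_sum (\<lambda>(i, j). w i j) \<eta> c"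
  shows "irredundant p q (Diff_Nonpos (bar q (diag_coord \<eta>0 j0)) (shifted_column \<eta>0 c0))"
proof -
  let ?con0 = "Diff_Nonpos (bar q (diag_coord \<eta>0 j0)) (shifted_column \<eta>0 c0)"
  define N where "N = 1 + (\<Sum>i\<in>{1..p}. \<Sum>l\<in>{2..min i q}. w i l)"
  have rows_nonneg: "0 \<le> (\<Sum>l\<in>{2..min i q}. w i l)" for i
    using nonneg by (intro sum_nonneg) auto
  then have N: "0 < N" unfolding N_def by (intro add_pos_nonneg) (auto intro: sum_nonneg simp del: min_def)
  define v :: "nat \<Rightarrow> nat \<Rightarrow> real" where "v i j = of_int (w i j) / of_int N" for i j
  have sum_v: "(\<Sum>l\<in>A. v i l) = of_int (\<Sum>l\<in>A. w i l) / of_int N" for A i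
    by (simp add: v_def sum_divide_distrib)
  have col_v: "column_sum (\<lambda>(i, j). v i j) \<eta> c = of_int (column_sum (\<lambda>(i, j). w i j) \<eta> c) / of_int N" for \<eta> c
    by (simp add: v_def column_sum_def sum_divide_distrib diag_coord_def)
  have "satisfies (point_of p q (filled q v)) con" if "con \<in> orbitope_system p q" "con \<noteq> ?con0" for con
  proof (rule filled_satisfies[OF q _ _ _ that])
    fix i assume "i \<in> {1..p}"
    then have "(\<Sum>l\<in>{2..min i q}. w i l) \<le> (\<Sum>i\<in>{1..p}. \<Sum>l\<in>{2..min i q}. w i l)"
      using rows_nonneg by (intro member_le_sum) auto
    then have "(\<Sum>l\<in>{2..min i q}. w i l) \<le> N" by (simp add: N_def)
    then show "(\<Sum>l\<in>{2..min i q}. v i l) \<le> 1" using N unfolding sum_v by (simp del: of_int_sum)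
  next
    fix i j assume "(i, j) \<in> index_set p q" "2 \<le> j"
    then show "0 \<le> v i j" using nonneg[of j i] N by (simp add: v_def index_set_def)
  next
    fix \<eta> j c
    assume a: "1 \<le> \<eta>" "2 \<le> j" "diag_coord \<eta> j \<in> index_set p q" "admissible_columns \<eta> j c"
      and ne: "Diff_Nonpos (bar q (diag_coord \<eta> j)) (shifted_column \<eta> c) \<noteq> ?con0"
    have "\<not> (\<eta> = \<eta>0 \<and> j = j0 \<and> (\<forall>k\<in>{1..\<eta>}. c k = c0 k))"
      using ne shifted_column_cong[of \<eta> c c0] by auto
    from col[OF a this]
    show "(\<Sum>l\<in>{j..min (j + \<eta> - 1) q}. v (j + \<eta> - 1) l) \<le> column_sum (\<lambda>(i, j). v i j) \<eta> c"
      using N unfolding sum_v col_v by (simp add: divide_right_mono del: of_int_sum)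
  qed
  moreover have "\<not> satisfies (point_of p q (filled q v)) ?con0"
  proof -
    note E = shifted_constraintE[OF a0]
    have "coord_sum (point_of p q (filled q v)) (shifted_column \<eta>0 c0) = column_sum (\<lambda>(i, j). v i j) \<eta>0 c0"
      using E(10) by (subst point_of_shifted_column[OF E(2) a0(1) E(8,9)], subst column_sum_filled) auto
    also have "\<dots> < (\<Sum>l\<in>{j0..min (j0 + \<eta>0 - 1) q}. v (j0 + \<eta>0 - 1) l)"
      using viol N unfolding sum_v col_v by (simp add: divide_strict_right_mono del: of_int_sum)
    also have "\<dots> = (\<Sum>l\<in>{j0..min (j0 + \<eta>0 - 1) q}. filled q v (j0 + \<eta>0 - 1, l))"
      using E(3) by (intro sum.cong) (auto simp: filled_def)
    also have "\<dots> = coord_sum (point_of p q (filled q v)) (bar q (diag_coord \<eta>0 j0))"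
      unfolding E(1) using E(3) by (intro point_of_bar[symmetric] E) simp
    finally show ?thesis by simp
  qed
  ultimately show ?thesis by (intro irredundantI)
qed

lemma diagonal_inequality_irredundant:
  assumes q: "2 \<le> q" "q \<le> p"
    and a0: "2 \<le> j0" "diag_coord 1 j0 \<in> index_set p q" "admissible_columns 1 j0 c0"
  shows "irredundant p q (Diff_Nonpos (bar q (diag_coord 1 j0)) (shifted_column 1 c0))"
proof -
  \<comment> \<open>Ones on the diagonal up to j0 with a gap at j0 - 1. If a bar of nonzero weight
    faces a column starting in the gap, the bar is the one at (j0, j0), and then the column has
    length 1 and the constraint is the given one.\<close>
  define w :: "nat \<Rightarrow> nat \<Rightarrow> int" where
    "w i j = (if i = j \<and> 2 \<le> j \<and> j \<le> j0 \<and> j \<noteq> j0 - 1 then 1 else 0)" for i j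
  have nonneg: "0 \<le> w i j" for i j by (simp add: w_def)
  note E0 = shifted_constraintE[OF order_refl a0]
  show ?thesis
  proof (rule shifted_column_irredundantI[where w = w, OF _ nonneg order_refl a0])
    show "1 \<le> q" using q by simp
    have "column_sum (\<lambda>(i, j). w i j) 1 c0 = 0"
      using E0(7) by (simp add: column_sum_def diag_coord_def w_def)
    moreover have "min j0 q = j0" using E0 by simp
    then have "(\<Sum>l\<in>{j0..min (j0 + 1 - 1) q}. w (j0 + 1 - 1) l) = 1"
      using E0 by (simp add: w_def)
    ultimately show "column_sum (\<lambda>(i, j). w i j) 1 c0 < (\<Sum>l\<in>{j0..min (j0 + 1 - 1) q}. w (j0 + 1 - 1) l)"
      by linarith
  next
    fix \<eta> j c
    assume a: "1 \<le> \<eta>" "2 \<le> j" "diag_coord \<eta> j \<in> index_set p q" "admissible_columns \<eta> j c"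
      and ne: "\<not> (\<eta> = 1 \<and> j = j0 \<and> (\<forall>k\<in>{1..\<eta>}. c k = c0 k))"
    note E = shifted_constraintE[OF a]
    define i where "i = j + \<eta> - 1"
    let ?f = "\<lambda>(i, j). w i j"
    have first: "w (c 1) (c 1) \<le> column_sum ?f \<eta> c"
      using column_sum_ge_first[OF a(1), of ?f c] nonneg by (simp add: diag_coord_def)
    have "(\<Sum>l\<in>{j..min i q}. w i l) \<le> column_sum ?f \<eta> c"
    proof (cases "i \<le> j0 \<and> i \<noteq> j0 - 1")
      case True
      have "c 1 \<noteq> j0 - 1"
      proof
        assume c1: "c 1 = j0 - 1"
        then have "j = j0" "i = j0" using E(10)[of 1] a(1) True E0(3) by (auto simp: i_def)
        then show False using ne c1 E0(7) a(1) by (auto simp: i_def)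
      qed
      then have "w (c 1) (c 1) = 1" using E(10)[of 1] a(1) True by (auto simp: w_def i_def)
      moreover have "(\<Sum>l\<in>{j..min i q}. w i l) \<le> (\<Sum>l\<in>{j..min i q}. if l = i then 1 else 0)"
        by (intro sum_mono) (auto simp: w_def)
      then have "(\<Sum>l\<in>{j..min i q}. w i l) \<le> 1" by (auto split: if_splits)
      ultimately show ?thesis using first by linarith
    next
      case False
      have "(\<Sum>l\<in>{j..min i q}. w i l) = 0"
        using False by (intro sum.neutral) (auto simp: w_def)
      then show ?thesis using first nonneg[of "c 1" "c 1"] by linarith
    qed
    then show "(\<Sum>l\<in>{j..min (j + \<eta> - 1) q}. w (j + \<eta> - 1) l) \<le> column_sum ?f \<eta> c"
      by (simp add: i_def)
  qed
qed

text \<open>Weights under which a prescribed shifted column \<open>a\<close> of length \<open>n\<close> is the unique cheapest one.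
  A shifted column starting low and ending high crosses each threshold between neighbouring columns at
  exactly one step; \<open>crossing_cost n a T k c\<close> charges one unit for every threshold up to \<open>c\<close> that
  \<open>a\<close> does not cross at step \<open>k\<close>. Step 0 is the start, step \<open>n\<close> the end, and step 1 is
  forbidden by \<open>c\<^sub>1 = c\<^sub>2\<close>, which leaves its cost \<open>T\<close> per threshold free.\<close>

definition crossing_cost :: "nat \<Rightarrow> (nat \<Rightarrow> nat) \<Rightarrow> nat \<Rightarrow> nat \<Rightarrow> nat \<Rightarrow> int" where
  "crossing_cost n a T k c =
     (if k = 0 then max (int c) (int (a 1)) - int (a 1)
      else if k = 1 then int T * int c
      else if k < n then min (int c) (int (a k)) + max (int c) (int (a (Suc k))) - int (a (Suc k))
      else min (int c) (int (a n)))"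

text \<open>Summation by parts: regrouped by steps instead of entries, the sum charges
  \<open>P k (c (Suc k)) - P k (c k)\<close> for moving from column \<open>c k\<close> to column
  \<open>c (Suc k)\<close>.\<close>

lemma sum_potential_differences:
  fixes P :: "nat \<Rightarrow> nat \<Rightarrow> int"
  assumes "1 \<le> \<eta>"
  shows "(\<Sum>k\<in>{1..\<eta>}. P (k - 1) (c k) - P k (c k)) =
    P 0 (c 1) + (\<Sum>k\<in>{1..<\<eta>}. P k (c (Suc k)) - P k (c k)) - P \<eta> (c \<eta>)"
  using assms by (induction \<eta> rule: dec_induct) auto

context
  fixes n T q :: nat and a :: "nat \<Rightarrow> nat"
  assumes n: "2 \<le> n" and a: "admissible_path n a" and T: "q \<le> T" "1 \<le> q"
begin

private abbreviation "P \<equiv> crossing_cost n a T"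

lemma crossing_cost_mono: "c \<le> d \<Longrightarrow> P k c \<le> P k d"
  by (auto simp: crossing_cost_def min_def max_def mult_left_mono)

lemma crossing_cost_nonneg: "0 \<le> P k c"
proof (cases "2 \<le> k \<and> k < n")
  case True
  then have "a k \<le> a (Suc k)" using admissible_path_step[OF a, of k] by simp
  then show ?thesis using True by (auto simp: crossing_cost_def min_def max_def)
next
  case False
  then show ?thesis by (auto simp: crossing_cost_def)
qed

lemma crossing_cost_le:
  assumes "c \<le> q"
  shows "P k c \<le> int T * int q"
proof -
  have "int c \<le> int T * int q" using assms T by (simp add: order_trans[OF _ mult_right_mono[of 1 "int T" "int q"]])
  moreover have "int T * int c \<le> int T * int q" using assms by (simp add: mult_left_mono)
  moreover have "P k c \<le> int c" if "k \<noteq> 1"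
  proof (cases "2 \<le> k \<and> k < n")
    case True
    then have "a k \<le> a (Suc k)" using admissible_path_step[OF a, of k] by simp
    then show ?thesis using True by (auto simp: crossing_cost_def min_def max_def)
  next
    case False
    then show ?thesis using that by (auto simp: crossing_cost_def)
  qed
  moreover have "P 1 c = int T * int c" by (simp add: crossing_cost_def)
  ultimately show ?thesis by (cases "k = 1") (auto intro: order_trans)
qed

text \<open>Step 1 drops out because c_1 = c_2; the remaining steps move upwards in monotone
  potentials.\<close>

lemma path_cost_nonneg_steps:
  assumes "admissible_path \<eta> c" "2 \<le> \<eta>"
  shows "(\<Sum>k\<in>{1..\<eta>}. P (k - 1) (c k) - P k (c k)) =
      P 0 (c 1) + (\<Sum>k\<in>{2..<\<eta>}. P k (c (Suc k)) - P k (c k)) - P \<eta> (c \<eta>)"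
    and "\<And>k. k \<in> {2..<\<eta>} \<Longrightarrow> 0 \<le> P k (c (Suc k)) - P k (c k)"
proof -
  have "{1..<\<eta>} = insert 1 {2..<\<eta>}" using assms(2) by auto
  moreover have "c (Suc 1) = c 1" using assms by (simp add: admissible_path_def numeral_2_eq_2)
  ultimately show "(\<Sum>k\<in>{1..\<eta>}. P (k - 1) (c k) - P k (c k)) =
      P 0 (c 1) + (\<Sum>k\<in>{2..<\<eta>}. P k (c (Suc k)) - P k (c k)) - P \<eta> (c \<eta>)"
    using assms(2) by (subst sum_potential_differences) auto
  show "0 \<le> P k (c (Suc k)) - P k (c k)" if "k \<in> {2..<\<eta>}" for k
    using admissible_path_step[OF assms(1), of k] that crossing_cost_mono by simp
qed

text \<open>A bar that reaches the diagonal, read from right to left, is a path descending one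
  column per step. At step 1 it crosses one threshold downwards and earns T, which covers its
  starting cost since q \<le> T; further descents only lower the sum. What remains is at most
  \<open>- P \<eta> j\<close>, and \<open>c \<eta>\<close> < j makes the end term of the column at
  least as large.\<close>

lemma bar_cost_le_path_cost:
  assumes c: "admissible_path \<eta> c" "1 \<le> \<eta>" "c \<eta> \<le> j - 1" "\<eta> = 1 \<Longrightarrow> c 1 = j - 1" and j: "2 \<le> j" "j + \<eta> - 1 \<le> q"
  shows "(\<Sum>k\<in>{1..\<eta>}. P (k - 1) (j + \<eta> - k) - P k (j + \<eta> - k)) \<le> (\<Sum>k\<in>{1..\<eta>}. P (k - 1) (c k) - P k (c k))"
proof (cases "\<eta> = 1")
  case True
  obtain i where i: "j = Suc i" using j by (cases j) auto
  have "int T * int (Suc i) = int T * int i + int T" by (simp add: algebra_simps)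
  moreover have "1 \<le> int T" using T by simp
  ultimately show ?thesis using True c(4) i by (auto simp: crossing_cost_def max_def)
next
  case False
  then have \<eta>: "2 \<le> \<eta>" using c(2) by simp
  let ?b = "\<lambda>k. j + \<eta> - k"
  have split: "{1..<\<eta>} = insert 1 {2..<\<eta>}" using \<eta> by auto
  have "(\<Sum>k\<in>{1..\<eta>}. P (k - 1) (?b k) - P k (?b k)) =
      P 0 (?b 1) + (P 1 (?b 2) - P 1 (?b 1)) + (\<Sum>k\<in>{2..<\<eta>}. P k (?b (Suc k)) - P k (?b k)) - P \<eta> j"
  proof -
    have "(\<Sum>k\<in>{1..<\<eta>}. P k (?b (Suc k)) - P k (?b k)) =
        (P 1 (?b 2) - P 1 (?b 1)) + (\<Sum>k\<in>{2..<\<eta>}. P k (?b (Suc k)) - P k (?b k))"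
      unfolding split by (simp add: numeral_2_eq_2)
    then show ?thesis using c(2) by (subst sum_potential_differences) auto
  qed
  moreover have "(\<Sum>k\<in>{2..<\<eta>}. P k (?b (Suc k)) - P k (?b k)) \<le> 0"
    using crossing_cost_mono by (intro sum_nonpos) auto
  moreover have "P 1 (?b 2) - P 1 (?b 1) = - int T"
  proof -
    have "?b 1 = Suc (?b 2)" using \<eta> by simp
    then show ?thesis by (simp add: crossing_cost_def algebra_simps)
  qed
  moreover have "P 0 (?b 1) \<le> int T" using j T by (auto simp: crossing_cost_def)
  ultimately have "(\<Sum>k\<in>{1..\<eta>}. P (k - 1) (?b k) - P k (?b k)) \<le> - P \<eta> j" by linarith
  also have "\<dots> \<le> - P \<eta> (c \<eta>)" using crossing_cost_mono[of "c \<eta>" j] c(3) j by simp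
  also have "\<dots> \<le> (\<Sum>k\<in>{1..\<eta>}. P (k - 1) (c k) - P k (c k))"
  proof -
    have "0 \<le> (\<Sum>k\<in>{2..<\<eta>}. P k (c (Suc k)) - P k (c k))"
      by (rule sum_nonneg) (rule path_cost_nonneg_steps(2)[OF c(1) \<eta>])
    then show ?thesis
      using path_cost_nonneg_steps(1)[OF c(1) \<eta>] crossing_cost_nonneg[of 0 "c 1"] by linarith
  qed
  finally show ?thesis .
qed

text \<open>The path a crosses thresholds only where they are free, so only the end term
  survives.\<close>

lemma optimal_path_cost: "(\<Sum>k\<in>{1..n}. P (k - 1) (a k) - P k (a k)) = - int (a n)"
proof -
  have "P k (a (Suc k)) - P k (a k) = 0" if "k \<in> {2..<n}" for k
    using that admissible_path_step[OF a, of k] by (auto simp: crossing_cost_def)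
  then show ?thesis
    unfolding path_cost_nonneg_steps(1)[OF a n] using n by (simp add: crossing_cost_def)
qed

text \<open>At cost \<open>- int (a n)\<close> or less, all starting and crossing costs must vanish
  and the end term must be extremal. Then c starts at or below a, ends at or above a, and moves at
  step k only between \<open>a k\<close> and \<open>a (Suc k)\<close>. Induction forwards gives c
  \<le> a, induction backwards a \<le> c. Since costs are integers, strictness is a gap of at least
  1.\<close>

lemma other_path_cost:
  assumes c: "admissible_path n c" and ne: "\<exists>k\<in>{1..n}. c k \<noteq> a k"
  shows "- int (a n) < (\<Sum>k\<in>{1..n}. P (k - 1) (c k) - P k (c k))"
proof (rule ccontr)
  assume "\<not> ?thesis"
  moreover note path_cost_nonneg_steps[OF c n]
  moreover have "0 \<le> P 0 (c 1)" "P n (c n) \<le> int (a n)"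
    using n by (auto simp: crossing_cost_nonneg) (auto simp: crossing_cost_def)
  moreover have "0 \<le> (\<Sum>k\<in>{2..<n}. P k (c (Suc k)) - P k (c k))"
    using calculation(3) by (rule sum_nonneg)
  ultimately have 0: "P 0 (c 1) = 0" "P n (c n) = int (a n)"
    "(\<Sum>k\<in>{2..<n}. P k (c (Suc k)) - P k (c k)) = 0"
    by linarith+
  have step0: "P k (c (Suc k)) - P k (c k) = 0" if "k \<in> {2..<n}" for k
    using 0(3) path_cost_nonneg_steps(2)[OF c n] that by (subst (asm) sum_nonneg_eq_0_iff) auto
  have move: "c (Suc k) = c k \<or> a k \<le> c k \<and> c (Suc k) \<le> a (Suc k)" if "1 \<le> k" "k < n" for k
  proof (cases "k = 1")
    case True
    then show ?thesis using c n by (simp add: admissible_path_def numeral_2_eq_2)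
  next
    case False
    then show ?thesis
      using step0[of k] admissible_path_step[OF c, of k] admissible_path_step[OF a, of k] that
      by (auto simp: crossing_cost_def min_def max_def split: if_splits)
  qed
  have amono: "a k \<le> a (Suc k)" if "1 \<le> k" "k < n" for k using admissible_path_step[OF a] that .
  have low: "c k \<le> a k" if "1 \<le> k" "k \<le> n" for k
    using that
  proof (induction k rule: dec_induct)
    case base
    then show ?case using 0(1) by (auto simp: crossing_cost_def max_def split: if_splits)
  next
    case (step k)
    then show ?case using move[of k] amono[of k] by auto
  qed
  have high: "a k \<le> c k" if "k \<le> n" "1 \<le> k" for k
    using that
  proof (induction k rule: inc_induct)
    case base
    then show ?case using 0(2) n by (auto simp: crossing_cost_def min_def split: if_splits)
  next
    case (step k)
    then show ?case using amono[of k] move[of k] by auto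
  qed
  show False using ne low high by (meson atLeastAtMost_iff le_antisym)
qed

end

text \<open>The bar is made one unit heavier than the column a. Every other column of the same
  length costs at least that unit more by \<open>other_path_cost\<close>, and longer columns are
  dearer by the base weight K.\<close>

lemma long_column_inequality_irredundant:
  assumes q: "2 \<le> q" "q \<le> p" and n: "2 \<le> n"
    and a0: "2 \<le> j0" "diag_coord n j0 \<in> index_set p q" "admissible_columns n j0 a"
  shows "irredundant p q (Diff_Nonpos (bar q (diag_coord n j0)) (shifted_column n a))"
proof -
  have n1: "1 \<le> n" using n by simp
  note E0 = shifted_constraintE[OF n1 a0]
  define i0 where "i0 = j0 + n - 1"
  define P where "P = crossing_cost n a q"
  define h where "h k c = P (k - 1) c - P k c" for k c
  \<comment> \<open>With T = q this bounds the values of P on columns up to q, and hence also their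
    differences h.\<close>
  define M where "M = int q * int q"
  \<comment> \<open>Twice \<open>int p * M\<close> absorbs the potential parts of one column and one
    bar together; q + 1 covers the terms \<open>a n\<close> and 1 in the weight of the violated
    bar.\<close>
  define K where "K = 2 * (int p * M) + int q + 1"
  \<comment> \<open>Above row i0 a cell carries the base weight plus the potential difference of its
    diagonal i - c + 1. In row i0 only the first element of the bar has weight, one more than the
    cost of a.\<close>
  define w where "w i c = (if i < i0 then K + h (i - c + 1) c
    else if i = i0 \<and> c = j0 then int n * K - int (a n) + 1 else 0)" for i c
  have pre: "q \<le> q" "1 \<le> q" using q by auto
  note mono = crossing_cost_mono[OF n E0(2) pre, folded P_def]
  have h_bound: "\<bar>h k c\<bar> \<le> M" if "c \<le> q" for k c
    using crossing_cost_le[OF n E0(2) pre that, of k] crossing_cost_le[OF n E0(2) pre that, of "k - 1"]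
      crossing_cost_nonneg[OF n E0(2) pre, of k c] crossing_cost_nonneg[OF n E0(2) pre, of "k - 1" c]
    by (simp add: h_def P_def M_def)
  have M0: "0 \<le> M" by (simp add: M_def)
  have p1: "1 \<le> int p" using q by simp
  have MpM: "M \<le> int p * M" using mult_right_mono[OF p1 M0] by simp
  have K0: "0 \<le> K" using M0 by (simp add: K_def)
  have an: "int (a n) \<le> int q" using E0(8) by simp
  have K1: "int q \<le> K" using M0 by (simp add: K_def)
  have nK: "K \<le> int n * K" using mult_right_mono[of 1 "int n" K] n K0 by simp
  have nonneg: "0 \<le> w i c" if "2 \<le> c" "c \<le> q" "c \<le> i" for i c
  proof -
    have "0 \<le> K + h (i - c + 1) c" using h_bound[OF that(2), of "i - c + 1"] MpM M0 by (simp add: K_def)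
    moreover have "0 \<le> int n * K - int (a n) + 1" using an K1 nK by linarith
    ultimately show ?thesis by (simp add: w_def)
  qed
  have col_K: "column_sum (\<lambda>(i, j). w i j) \<eta> c = int \<eta> * K + (\<Sum>k\<in>{1..\<eta>}. h k (c k))"
    if "admissible_path \<eta> c" "1 \<le> \<eta>" "c \<eta> + \<eta> - 1 < i0" for \<eta> c
  proof -
    have "(\<lambda>(i, j). w i j) (diag_coord k (c k)) = K + h k (c k)" if k: "k \<in> {1..\<eta>}" for k
    proof -
      have "2 \<le> c k" "c k \<le> c \<eta>"
        using k admissible_path_ge2[OF \<open>admissible_path \<eta> c\<close>] admissible_path_mono[OF \<open>admissible_path \<eta> c\<close>]
        by auto
      then show ?thesis using k \<open>c \<eta> + \<eta> - 1 < i0\<close> by (auto simp: diag_coord_def w_def)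
    qed
    then show ?thesis unfolding column_sum_def by (simp add: sum.distrib)
  qed
  have sum_h: "\<bar>\<Sum>k\<in>A. h (f k) (g k)\<bar> \<le> int p * M" if "\<And>k. k \<in> A \<Longrightarrow> g k \<le> q" "card A \<le> p" for A f g
  proof -
    have "\<bar>\<Sum>k\<in>A. h (f k) (g k)\<bar> \<le> (\<Sum>k\<in>A. \<bar>h (f k) (g k)\<bar>)" by (rule sum_abs)
    also have "\<dots> \<le> int (card A) * M" using that h_bound by (intro sum_bounded_above) auto
    also have "\<dots> \<le> int p * M" using that M0 by (intro mult_right_mono) auto
    finally show ?thesis .
  qed
  show ?thesis
  proof (rule shifted_column_irredundantI[where w = w, OF pre(2) nonneg n1 a0])
    have "c n + n - 1 < i0" if "c n \<le> j0 - 1" for c :: "nat \<Rightarrow> nat"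
      using that E0(3) n by (simp add: i0_def)
    then have "column_sum (\<lambda>(i, j). w i j) n a = int n * K - int (a n)"
      using col_K[OF E0(2) n1] E0(6) optimal_path_cost[OF n E0(2) pre] by (simp add: h_def P_def)
    moreover have "(\<Sum>l\<in>{j0..min i0 q}. w i0 l) = (\<Sum>l\<in>{j0..min i0 q}. if l = j0 then int n * K - int (a n) + 1 else 0)"
      by (intro sum.cong) (auto simp: w_def)
    moreover have "j0 \<in> {j0..min i0 q}" using E0(4) n by (auto simp: i0_def)
    ultimately show "column_sum (\<lambda>(i, j). w i j) n a < (\<Sum>l\<in>{j0..min (j0 + n - 1) q}. w (j0 + n - 1) l)"
      unfolding i0_def[symmetric] by simp
  next
    fix \<eta> j c
    assume a: "1 \<le> \<eta>" "2 \<le> j" "diag_coord \<eta> j \<in> index_set p q" "admissible_columns \<eta> j c"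
      and ne: "\<not> (\<eta> = n \<and> j = j0 \<and> (\<forall>k\<in>{1..\<eta>}. c k = a k))"
    note E = shifted_constraintE[OF a]
    define i where "i = j + \<eta> - 1"
    let ?f = "\<lambda>(i, j). w i j"
    have col_nonneg: "0 \<le> column_sum ?f \<eta> c"
      unfolding column_sum_def
    proof (rule sum_nonneg)
      fix k assume k: "k \<in> {1..\<eta>}"
      then have "2 \<le> c k" "c k \<le> q" "c k \<le> c k + k - 1" using E(4) E(10)[OF k] k by auto
      then show "0 \<le> ?f (diag_coord k (c k))"
        using k nonneg[of "c k" "c k + k - 1"] by (simp add: diag_coord_def)
    qed
    have cle: "c k \<le> q" if "k \<in> {1..\<eta>}" for k using E(10)[OF that] E(4) by linarith
    have \<eta>p: "\<eta> \<le> p" using E(5) a(2) by auto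
    have colH: "\<bar>\<Sum>k\<in>{1..\<eta>}. h k (c k)\<bar> \<le> int p * M" using sum_h[of "{1..\<eta>}" c "\<lambda>k. k"] cle \<eta>p by simp
    have last: "c \<eta> + \<eta> - 1 < i" using E(3,6) a(1) by (simp add: i_def)
    \<comment> \<open>Bars below row i0, or in row i0 starting right of j0, weigh nothing. For a
      start left of j0 the column has more than n cells and K decides; at j0 the uniqueness of a
      does. Above row i0, a bar cut off at column q has fewer cells than the column, so K decides
      again, while a bar reaching the diagonal has equally many, the base weights cancel and the
      potentials decide.\<close>
    consider "i0 < i" | "i = i0" "j0 < j" | "i = i0" "j < j0" | "i = i0" "j = j0" | "i < i0" "q < i" | "i < i0" "i \<le> q"
      by linarith
    then have "(\<Sum>l\<in>{j..min i q}. w i l) \<le> column_sum ?f \<eta> c"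
    proof cases
      case 1
      then have "(\<Sum>l\<in>{j..min i q}. w i l) = 0" by (intro sum.neutral) (auto simp: w_def)
      then show ?thesis using col_nonneg by simp
    next
      case 2
      then have "(\<Sum>l\<in>{j..min i q}. w i l) = 0" by (intro sum.neutral) (auto simp: w_def)
      then show ?thesis using col_nonneg by simp
    next
      case 3
      have "(\<Sum>l\<in>{j..min i q}. w i l) \<le> (\<Sum>l\<in>{j..min i q}. if l = j0 then int n * K - int (a n) + 1 else 0)"
        using 3 by (intro sum_mono) (auto simp: w_def)
      also have "\<dots> \<le> int n * K - int (a n) + 1" using an K1 nK by (auto simp: sum.delta)
      also have "\<dots> \<le> int \<eta> * K - int p * M"
      proof -
        have "int n + 1 \<le> int \<eta>" using 3 E(3) by (simp add: i_def i0_def)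
        from mult_right_mono[OF this K0] have "int n * K + K \<le> int \<eta> * K" by (simp add: algebra_simps)
        moreover have "int p * M + 1 \<le> K" using M0 by (simp add: K_def)
        ultimately show ?thesis by linarith
      qed
      also have "\<dots> \<le> column_sum ?f \<eta> c"
        using col_K[OF E(2) a(1)] last 3 colH by simp
      finally show ?thesis .
    next
      case 4
      then have \<eta>: "\<eta> = n" using E(3) by (simp add: i_def i0_def)
      have "\<exists>k\<in>{1..n}. c k \<noteq> a k" using ne 4 \<eta> by auto
      from other_path_cost[OF n E0(2) pre E(2)[unfolded \<eta>] this]
      have "int n * K - int (a n) + 1 \<le> column_sum ?f \<eta> c"
        using col_K[OF E(2) a(1)] last 4 by (simp add: \<eta> h_def P_def)
      moreover have "(\<Sum>l\<in>{j..min i q}. w i l) \<le> (\<Sum>l\<in>{j..min i q}. if l = j0 then int n * K - int (a n) + 1 else 0)"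
        using 4 by (intro sum_mono) (auto simp: w_def)
      moreover have "\<dots> \<le> int n * K - int (a n) + 1" using an K1 nK by (auto simp: sum.delta)
      ultimately show ?thesis by linarith
    next
      case 5
      have card: "card {j..min i q} = q + 1 - j" using 5 by simp
      have "(\<Sum>l\<in>{j..min i q}. w i l) = (\<Sum>l\<in>{j..min i q}. K + h (i - l + 1) l)"
        using 5 by (intro sum.cong) (auto simp: w_def)
      also have "\<dots> = int (q + 1 - j) * K + (\<Sum>l\<in>{j..min i q}. h (i - l + 1) l)"
        by (simp add: sum.distrib min.absorb4[OF 5(2)])
      also have "\<dots> \<le> int (q + 1 - j) * K + int p * M"
      proof -
        have "card {j..min i q} \<le> p" using E(3) q unfolding card by simp
        then show ?thesis using sum_h[of "{j..min i q}" "\<lambda>l. l" "\<lambda>l. i - l + 1"] by simp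
      qed
      also have "\<dots> \<le> int \<eta> * K - int p * M"
      proof -
        have "int (q + 1 - j) + 1 \<le> int \<eta>" using 5 E(3,4) by (simp add: i_def)
        from mult_right_mono[OF this K0] have "int (q + 1 - j) * K + K \<le> int \<eta> * K" by (simp add: algebra_simps)
        moreover have "2 * (int p * M) \<le> K" by (simp add: K_def)
        ultimately show ?thesis by linarith
      qed
      also have "\<dots> \<le> column_sum ?f \<eta> c"
        using col_K[OF E(2) a(1)] last 5 colH by simp
      finally show ?thesis .
    next
      case 6
      have "(\<Sum>l\<in>{j..min i q}. w i l) = (\<Sum>k\<in>{1..\<eta>}. K + h k (j + \<eta> - k))"
      proof (rule sum.reindex_bij_witness[of _ "\<lambda>k. j + \<eta> - k" "\<lambda>l. j + \<eta> - l"])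
        fix l assume l: "l \<in> {j..min i q}"
        then have "i - l + 1 = j + \<eta> - l" using a(1) by (auto simp: i_def)
        with l show "K + h (j + \<eta> - l) (j + \<eta> - (j + \<eta> - l)) = w i l"
          using 6 by (auto simp: w_def)
      qed (use 6 E(3) in \<open>auto simp: i_def\<close>)
      also have "\<dots> = int \<eta> * K + (\<Sum>k\<in>{1..\<eta>}. h k (j + \<eta> - k))" by (simp add: sum.distrib)
      also have "\<dots> \<le> int \<eta> * K + (\<Sum>k\<in>{1..\<eta>}. h k (c k))"
        using bar_cost_le_path_cost[OF n E0(2) pre E(2) a(1) E(6,7) a(2)] 6
        by (simp add: h_def P_def i_def)
      also have "\<dots> = column_sum ?f \<eta> c" using col_K[OF E(2) a(1)] last 6 by simp
      finally show ?thesis .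
    qed
    then show "(\<Sum>l\<in>{j..min (j + \<eta> - 1) q}. w (j + \<eta> - 1) l) \<le> column_sum ?f \<eta> c"
      by (simp add: i_def)
  qed
qed

theorem orbitope_system_nonredundant:
  assumes "2 \<le> q" "q \<le> p"
  shows "nonredundant p q (orbitope_system p q)"
proof (rule nonredundantI)
  fix con assume "con \<in> orbitope_system p q"
  then show "irredundant p q con"
  proof (cases rule: orbitope_system_cases)
    case (row i)
    then show ?thesis using row_equation_irredundant[of i p q] assms by simp
  next
    case (nonneg k)
    obtain i j where k: "k = (i, j)" by force
    have ij: "i \<le> p" "1 \<le> j" "j \<le> q" "j \<le> i"
      using nonneg k by (auto simp: index_set_def)
    have "i = j \<Longrightarrow> j = q" using nonneg(2)[of j] k ij by (cases "j < q") auto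
    show ?thesis
    proof (cases "j = 1")
      case True
      then have "2 \<le> i" using ij assms \<open>i = j \<Longrightarrow> j = q\<close> by (cases "i = j") auto
      then show ?thesis using first_column_nonneg_irredundant[of q i p] assms ij True by (simp add: nonneg k)
    next
      case False
      then show ?thesis
        using later_column_nonneg_irredundant[OF assms, of i j] nonneg ij \<open>i = j \<Longrightarrow> j = q\<close> by (simp add: k)
    qed
  next
    case (col \<eta> j c)
    show ?thesis
    proof (cases "\<eta> = 1")
      case True
      then show ?thesis using diagonal_inequality_irredundant[OF assms] col by simp
    next
      case False
      then show ?thesis using long_column_inequality_irredundant[OF assms _ col(2-4)] col by simp
    qed
  qed
qed

section \<open>Separation in linear time\<close>

primrec loop_free :: "com \<Rightarrow> bool" where
  "loop_free Skip \<longleftrightarrow> True"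
| "loop_free (NAssign a es e) \<longleftrightarrow> True"
| "loop_free (QAssign a es e) \<longleftrightarrow> True"
| "loop_free (Seq c d) \<longleftrightarrow> loop_free c \<and> loop_free d"
| "loop_free (Cond b c d) \<longleftrightarrow> loop_free c \<and> loop_free d"
| "loop_free (While b c) \<longleftrightarrow> False"

text \<open>A functional semantics for loop-free programs, which always terminate at a cost bounded
  independently of the store. The clauses for \<open>While\<close>, here and in
  \<open>cost_bound\<close>, are dummies.\<close>

primrec exec :: "com \<Rightarrow> store \<Rightarrow> store" where
  "exec Skip s = s"
| "exec (NAssign a es e) s = (update_cell (fst s) a (map (nval s) es) (nval s e), snd s)"
| "exec (QAssign a es e) s = (fst s, update_cell (snd s) a (map (nval s) es) (qval s e))"
| "exec (Seq c d) s = exec d (exec c s)"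
| "exec (Cond b c d) s = (if bval s b then exec c s else exec d s)"
| "exec (While b c) s = s"

primrec cost_bound :: "com \<Rightarrow> nat" where
  "cost_bound Skip = 1"
| "cost_bound (NAssign a es e) = 1 + sum_list (map ncost es) + ncost e"
| "cost_bound (QAssign a es e) = 1 + sum_list (map ncost es) + qcost e"
| "cost_bound (Seq c d) = cost_bound c + cost_bound d"
| "cost_bound (Cond b c d) = 1 + bcost b + max (cost_bound c) (cost_bound d)"
| "cost_bound (While b c) = 0"

lemma runs_exec: "loop_free c \<Longrightarrow> \<exists>t\<le>cost_bound c. runs c s t (exec c s)"
proof (induction c arbitrary: s)
  case Skip
  show ?case unfolding exec.simps cost_bound.simps by (rule exI) (rule conjI[OF order_refl runs.Skip])
next
  case NAssign
  show ?case unfolding exec.simps cost_bound.simps by (rule exI) (rule conjI[OF order_refl runs.NAssign])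
next
  case QAssign
  show ?case unfolding exec.simps cost_bound.simps by (rule exI) (rule conjI[OF order_refl runs.QAssign])
next
  case (Seq c d)
  then obtain t u where "t \<le> cost_bound c" "runs c s t (exec c s)"
    "u \<le> cost_bound d" "runs d (exec c s) u (exec d (exec c s))"
    by (metis loop_free.simps(4))
  then show ?case by (intro exI[of _ "t + u"]) (auto intro: runs.Seq)
next
  case (Cond b c d)
  show ?case
  proof (cases "bval s b")
    case True
    obtain t where "t \<le> cost_bound c" "runs c s t (exec c s)"
      using Cond by (metis loop_free.simps(5))
    then show ?thesis using True by (intro exI[of _ "1 + bcost b + t"]) (use runs.IfTrue[of s b c t] in auto)
  next
    case False
    obtain t where "t \<le> cost_bound d" "runs d s t (exec d s)"
      using Cond by (metis loop_free.simps(5))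
    then show ?thesis using False by (intro exI[of _ "1 + bcost b + t"]) (use runs.IfFalse[of s b d t] in auto)
  qed
qed simp

text \<open>The variant m bounds the number of iterations, and each iteration of a loop-free body
  has constant cost.\<close>

lemma runs_while:
  fixes m :: "store \<Rightarrow> nat"
  assumes "loop_free c" and "I s"
    and step: "\<And>s. I s \<Longrightarrow> bval s b \<Longrightarrow> I (exec c s) \<and> m (exec c s) < m s"
  shows "\<exists>t s'. runs (While b c) s t s' \<and> t \<le> (m s + 1) * (1 + bcost b + cost_bound c) \<and> I s' \<and> \<not> bval s' b"
  using \<open>I s\<close>
proof (induction "m s" arbitrary: s rule: less_induct)
  case less
  show ?case
  proof (cases "bval s b")
    case False
    then have "runs (While b c) s (1 + bcost b) s" by (rule runs.WhileFalse)
    then show ?thesis using less.prems False by (intro exI[of _ "1 + bcost b"] exI[of _ s]) auto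
  next
    case True
    from runs_exec[OF \<open>loop_free c\<close>, of s] obtain u where u: "u \<le> cost_bound c" "runs c s u (exec c s)" by auto
    note st = step[OF less.prems True]
    then obtain t s' where t: "runs (While b c) (exec c s) t s'"
      "t \<le> (m (exec c s) + 1) * (1 + bcost b + cost_bound c)" "I s'" "\<not> bval s' b"
      using less.hyps[of "exec c s"] by auto
    have "t \<le> m s * (1 + bcost b + cost_bound c)"
      by (rule le_trans[OF t(2)], rule mult_le_mono1) (use st in simp)
    then have "1 + bcost b + u + t \<le> (m s + 1) * (1 + bcost b + cost_bound c)"
      using u(1) by simp
    then show ?thesis using runs.WhileTrue[OF True u(2) t(1)] t(3,4) by blast
  qed
qed

section \<open>The separation program\<close>

abbreviation "nvar a \<equiv> NCell a []"
abbreviation "qvar a \<equiv> QCell a []"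

abbreviation "cell_x \<equiv> QCell ''x'' [nvar ''h'', nvar ''l'']"
abbreviation "cell_above \<equiv> QCell ''w'' [NSub (nvar ''h'') (NConst 1), nvar ''l'']"
abbreviation "cell_diag \<equiv> QCell ''w'' [NSub (nvar ''h'') (NConst 1), NSub (nvar ''l'') (NConst 1)]"

definition add_cell :: com where
  "add_cell = QAssign ''s'' [] (QAdd (qvar ''s'') cell_x)"

definition check_nonneg :: com where
  "check_nonneg = Cond (BAnd (QLess cell_x (QConst 0)) (BNot (BAnd (NEq (nvar ''h'') (nvar ''l'')) (NLess (nvar ''l'') (nvar ''q'')))))
     (Seq (NAssign ''answer'' [] (NConst 2)) (Seq (NAssign ''i'' [] (nvar ''h'')) (NAssign ''j'' [] (nvar ''l'')))) Skip"

definition check_column :: com where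
  "check_column = Cond (BAnd (BAnd (NLess (NConst 2) (nvar ''l'')) (BNot (NLess (nvar ''h'') (nvar ''l'')))) (QLess cell_diag (qvar ''s'')))
     (Seq (NAssign ''answer'' [] (NConst 3))
       (Seq (NAssign ''eta'' [] (NSub (NAdd (nvar ''h'') (NConst 1)) (nvar ''l''))) (NAssign ''j'' [] (nvar ''l'')))) Skip"

definition fill_tables :: com where
  "fill_tables = Cond (BAnd (BAnd (NLess (NConst 2) (nvar ''l'')) (NLess (nvar ''l'') (nvar ''h''))) (QLess cell_diag (QAdd cell_above cell_x)))
     (Seq (QAssign ''w'' [nvar ''h'', nvar ''l''] cell_diag)
       (NAssign ''t'' [nvar ''h'', nvar ''l''] (NCell ''t'' [NSub (nvar ''h'') (NConst 1), NSub (nvar ''l'') (NConst 1)])))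
     (Seq (QAssign ''w'' [nvar ''h'', nvar ''l''] (QAdd cell_above cell_x))
       (NAssign ''t'' [nvar ''h'', nvar ''l''] (nvar ''l'')))"

definition check_row :: com where
  "check_row = Cond (BNot (QEq (qvar ''s'') (QConst 1)))
     (Seq (NAssign ''answer'' [] (NConst 1)) (NAssign ''i'' [] (nvar ''h''))) Skip"

definition advance :: com where
  "advance = Cond (NLess (NConst 1) (nvar ''l'')) (NAssign ''l'' [] (NSub (nvar ''l'') (NConst 1)))
     (Seq check_row (Seq (NAssign ''l'' [] (nvar ''q'')) (Seq (NAssign ''h'' [] (NAdd (nvar ''h'') (NConst 1))) (QAssign ''s'' [] (QConst 0)))))"

text \<open>Rows are scanned from right to left, so \<open>s\<close> is the weight of the bar
  starting at the current cell. A violation does not stop the scan: a later one overwrites the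
  report, and any single valid report suffices.\<close>

definition scan_step :: com where
  "scan_step = Seq add_cell (Seq check_nonneg (Seq check_column (Seq fill_tables advance)))"

text \<open>Executes \<open>backtrack\<close> with the stored end columns: row v + k - 1 is where
  the cell for length k and column v lies.\<close>

definition trace_step :: com where
  "trace_step = Seq (NAssign ''v'' [] (NCell ''t'' [NSub (NAdd (nvar ''v'') (nvar ''k'')) (NConst 1), nvar ''v'']))
     (Seq (NAssign ''c'' [nvar ''k''] (nvar ''v'')) (NAssign ''k'' [] (NSub (nvar ''k'') (NConst 1))))"

definition scan_init :: com where
  "scan_init = Seq (NAssign ''h'' [] (NConst 1)) (NAssign ''l'' [] (nvar ''q''))"

definition trace_init :: com where
  "trace_init = Seq (NAssign ''k'' [] (nvar ''eta'')) (NAssign ''v'' [] (NSub (nvar ''j'') (NConst 1)))"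

abbreviation "scan_guard \<equiv> NLess (nvar ''h'') (NAdd (nvar ''p'') (NConst 1))"
abbreviation "trace_guard \<equiv> NLess (NConst 0) (nvar ''k'')"
abbreviation "answer_guard \<equiv> NEq (nvar ''answer'') (NConst 3)"

definition separation_program :: com where
  "separation_program = Seq scan_init (Seq (While scan_guard scan_step)
     (Cond answer_guard (Seq trace_init (While trace_guard trace_step)) Skip))"

lemma loop_free_steps:
  "loop_free scan_step" "loop_free trace_step" "loop_free scan_init" "loop_free trace_init"
  by (simp_all add: scan_step_def add_cell_def check_nonneg_def check_column_def fill_tables_def
      advance_def check_row_def trace_step_def scan_init_def trace_init_def)

section \<open>Correctness of the scan\<close>

text \<open>The bar sum in the form in which it is accumulated, up to column q; for an input in
  \<open>coord_space\<close> the cells above the diagonal contribute 0.\<close>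

definition suffix_sum :: "nat \<Rightarrow> (pos \<Rightarrow> rat) \<Rightarrow> nat \<Rightarrow> nat \<Rightarrow> rat" where
  "suffix_sum q f i j = (\<Sum>l\<in>{j..q}. f (i, l))"

definition nonneg_ok :: "nat \<Rightarrow> (pos \<Rightarrow> rat) \<Rightarrow> nat \<Rightarrow> nat \<Rightarrow> bool" where
  "nonneg_ok q f i j \<longleftrightarrow> 0 \<le> f (i, j) \<or> i = j \<and> j < q"

definition column_ok :: "nat \<Rightarrow> (pos \<Rightarrow> rat) \<Rightarrow> nat \<Rightarrow> nat \<Rightarrow> bool" where
  "column_ok q f i j \<longleftrightarrow> (2 < j \<and> j \<le> i \<longrightarrow> suffix_sum q f i j \<le> cheapest f (i - 1) (j - 1))"

definition row_ok :: "nat \<Rightarrow> (pos \<Rightarrow> rat) \<Rightarrow> nat \<Rightarrow> nat \<Rightarrow> bool" where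
  "row_ok q f i j \<longleftrightarrow> (j = 1 \<longrightarrow> suffix_sum q f i 1 = 1)"

definition violation_reported :: "nat \<Rightarrow> nat \<Rightarrow> (pos \<Rightarrow> rat) \<Rightarrow> store \<Rightarrow> bool" where
  "violation_reported p q f s \<longleftrightarrow>
    (let var = (\<lambda>a. fst s a []) in
     var ''answer'' = 1 \<and> var ''i'' \<in> {1..p} \<and> suffix_sum q f (var ''i'') 1 \<noteq> 1 \<or>
     var ''answer'' = 2 \<and> \<not> nonneg_ok q f (var ''i'') (var ''j'') \<or>
     var ''answer'' = 3 \<and> 1 \<le> var ''eta'' \<and> 3 \<le> var ''j'' \<and> var ''j'' \<le> q \<and> var ''j'' + var ''eta'' - 1 \<le> p \<and>
       cheapest f (var ''j'' + var ''eta'' - 2) (var ''j'' - 1) < suffix_sum q f (var ''j'' + var ''eta'' - 1) (var ''j''))"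

text \<open>Once a violation is stored, nothing is claimed about the other cells; \<open>ok\<close>
  matters only while the answer is still 0.\<close>

definition reported :: "nat \<Rightarrow> nat \<Rightarrow> (pos \<Rightarrow> rat) \<Rightarrow> bool \<Rightarrow> store \<Rightarrow> bool" where
  "reported p q f ok s \<longleftrightarrow> fst s ''answer'' [] = 0 \<and> ok \<or> violation_reported p q f s"

text \<open>The cell (i, j) is the next to be visited. Row 0 is included because the recursion reads
  it in row 1, where the initial zeros of the store are the correct values.\<close>

definition scanned :: "nat \<Rightarrow> nat \<Rightarrow> nat \<Rightarrow> pos set" where
  "scanned q i j = {(a, b). b \<in> {1..q} \<and> (a < i \<or> a = i \<and> j < b)}"

definition frame :: "nat \<Rightarrow> nat \<Rightarrow> (pos \<Rightarrow> rat) \<Rightarrow> nat \<Rightarrow> nat \<Rightarrow> store \<Rightarrow> bool" where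
  "frame p q f i j s \<longleftrightarrow> fst s ''p'' [] = p \<and> fst s ''q'' [] = q \<and> fst s ''h'' [] = i \<and> fst s ''l'' [] = j \<and>
     (\<forall>a b. snd s ''x'' [a, b] = f (a, b))"

text \<open>The end columns are exempt in row 0: there the store holds 0, whereas
  \<open>last_col\<close> returns the column itself.\<close>

definition tables :: "(pos \<Rightarrow> rat) \<Rightarrow> pos set \<Rightarrow> store \<Rightarrow> bool" where
  "tables f G s \<longleftrightarrow> (\<forall>(a, b)\<in>G. snd s ''w'' [a, b] = cheapest f a b \<and> (1 \<le> a \<longrightarrow> fst s ''t'' [a, b] = last_col f a b))"

definition cells_ok :: "nat \<Rightarrow> (pos \<Rightarrow> rat) \<Rightarrow> pos set \<Rightarrow> bool" where
  "cells_ok q f G \<longleftrightarrow> (\<forall>(a, b)\<in>G. 1 \<le> a \<longrightarrow> nonneg_ok q f a b \<and> column_ok q f a b \<and> row_ok q f a b)"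

definition scan_inv :: "nat \<Rightarrow> nat \<Rightarrow> (pos \<Rightarrow> rat) \<Rightarrow> nat \<Rightarrow> nat \<Rightarrow> store \<Rightarrow> bool" where
  "scan_inv p q f i j s \<longleftrightarrow> frame p q f i j s \<and> snd s ''s'' [] = suffix_sum q f i (Suc j) \<and>
     tables f (scanned q i j) s \<and> reported p q f (cells_ok q f (scanned q i j)) s"

lemma exec_add_cell:
  assumes "frame p q f i j s" "snd s ''s'' [] = suffix_sum q f i (Suc j)" "j \<le> q"
  shows "frame p q f i j (exec add_cell s)" "snd (exec add_cell s) ''s'' [] = suffix_sum q f i j"
    "tables f G (exec add_cell s) = tables f G s" "reported p q f ok (exec add_cell s) = reported p q f ok s"
proof -
  have "{j..q} = insert j {Suc j..q}" using assms(3) by auto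
  then have "suffix_sum q f i j = f (i, j) + suffix_sum q f i (Suc j)" by (simp add: suffix_sum_def)
  then show "snd (exec add_cell s) ''s'' [] = suffix_sum q f i j"
    using assms by (simp add: add_cell_def frame_def update_cell_def)
qed (use assms in \<open>auto simp: add_cell_def frame_def update_cell_def tables_def reported_def violation_reported_def\<close>)

lemma exec_check_nonneg:
  assumes "frame p q f i j s"
  shows "frame p q f i j (exec check_nonneg s)" "snd (exec check_nonneg s) = snd s"
    "tables f G (exec check_nonneg s) = tables f G s"
    "reported p q f ok s \<Longrightarrow> reported p q f (ok \<and> nonneg_ok q f i j) (exec check_nonneg s)"
  using assms
  by (auto simp: check_nonneg_def frame_def update_cell_def tables_def reported_def violation_reported_def nonneg_ok_def Let_def)

lemma exec_check_column:
  assumes "frame p q f i j s" "snd s ''s'' [] = suffix_sum q f i j" "tables f (scanned q i j) s"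
    "1 \<le> i" "i \<le> p" "1 \<le> j" "j \<le> q"
  shows "frame p q f i j (exec check_column s)" "snd (exec check_column s) = snd s"
    "tables f G (exec check_column s) = tables f G s"
    "reported p q f ok s \<Longrightarrow> reported p q f (ok \<and> column_ok q f i j) (exec check_column s)"
proof -
  show "reported p q f (ok \<and> column_ok q f i j) (exec check_column s)" if "reported p q f ok s"
  proof (cases "2 < j \<and> j \<le> i")
    case True
    then have "(i - 1, j - 1) \<in> scanned q i j" using assms by (auto simp: scanned_def)
    then have "snd s ''w'' [i - Suc 0, j - Suc 0] = cheapest f (i - 1) (j - 1)"
      using assms(3) by (auto simp: tables_def)
    then show ?thesis using True assms that
      by (auto simp: check_column_def frame_def update_cell_def reported_def violation_reported_def
          column_ok_def Let_def numeral_2_eq_2 Suc_diff_le)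
  next
    case False
    then show ?thesis using assms that
      by (auto simp: check_column_def frame_def reported_def column_ok_def)
  qed
qed (use assms(1) in \<open>auto simp: check_column_def frame_def update_cell_def tables_def\<close>)

lemma exec_fill_tables:
  assumes "frame p q f i j s" "tables f (scanned q i j) s" "1 \<le> i" "1 \<le> j" "j \<le> q"
  shows "frame p q f i j (exec fill_tables s)" "snd (exec fill_tables s) ''s'' = snd s ''s''"
    "tables f (insert (i, j) (scanned q i j)) (exec fill_tables s)"
    "reported p q f ok (exec fill_tables s) = reported p q f ok s"
proof -
  obtain k where i: "i = Suc k" using assms(3) by (cases i) auto
  have above: "snd s ''w'' [k, j] = cheapest f k j"
    using assms i by (auto simp: tables_def scanned_def)
  have diag: "snd s ''w'' [k, j - Suc 0] = cheapest f k (j - 1)" "fst s ''t'' [k, j - Suc 0] = last_col f k (j - 1)"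
    if "2 < j" "j \<le> k"
  proof -
    have "(k, j - 1) \<in> scanned q i j" "1 \<le> k" using that assms i by (auto simp: scanned_def)
    then show "snd s ''w'' [k, j - Suc 0] = cheapest f k (j - 1)" "fst s ''t'' [k, j - Suc 0] = last_col f k (j - 1)"
      using assms(2) by (auto simp: tables_def)
  qed
  have new: "snd (exec fill_tables s) ''w'' [i, j] = cheapest f i j" "fst (exec fill_tables s) ''t'' [i, j] = last_col f i j"
    using assms(1) above diag by (auto simp: fill_tables_def frame_def update_cell_def i)
  have old: "snd (exec fill_tables s) ''w'' [a, b] = snd s ''w'' [a, b]" "fst (exec fill_tables s) ''t'' [a, b] = fst s ''t'' [a, b]"
    if "(a, b) \<noteq> (i, j)" for a b
    using assms(1) that by (auto simp: fill_tables_def frame_def update_cell_def)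
  show "tables f (insert (i, j) (scanned q i j)) (exec fill_tables s)"
    using assms(2) new old by (auto simp: tables_def scanned_def)
qed (use assms(1) in \<open>auto simp: fill_tables_def frame_def update_cell_def reported_def violation_reported_def\<close>)

lemma scanned_step:
  "1 \<le> j \<Longrightarrow> j \<le> q \<Longrightarrow> scanned q i (j - 1) = insert (i, j) (scanned q i j)"
  "scanned q (Suc i) q = scanned q i 0"
  by (auto simp: scanned_def)

lemma exec_advance:
  assumes "frame p q f i j s" "snd s ''s'' [] = suffix_sum q f i j" "tables f (scanned q i (j - 1)) s"
    "reported p q f (cells_ok q f (scanned q i j) \<and> nonneg_ok q f i j \<and> column_ok q f i j) s"
    "1 \<le> i" "i \<le> p" "1 \<le> j" "j \<le> q"
  shows "if 1 < j then scan_inv p q f i (j - 1) (exec advance s) else scan_inv p q f (Suc i) q (exec advance s)"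
proof (cases "1 < j")
  case True
  have ok: "cells_ok q f (scanned q i (j - 1))"
    if "cells_ok q f (scanned q i j)" "nonneg_ok q f i j" "column_ok q f i j"
    using that True assms scanned_step(1)[of j q i] by (simp add: cells_ok_def row_ok_def)
  have ex: "exec advance s = (update_cell (fst s) ''l'' [] (j - 1), snd s)"
    using True assms(1) by (simp add: advance_def frame_def)
  have "scan_inv p q f i (j - 1) (exec advance s)"
    using assms ok True unfolding scan_inv_def ex
    by (auto simp: frame_def update_cell_def tables_def reported_def violation_reported_def)
  then show ?thesis using True by simp
next
  case False
  then have j: "j = 1" using assms by simp
  have ok: "cells_ok q f (scanned q (Suc i) q)"
    if "cells_ok q f (scanned q i j)" "nonneg_ok q f i j" "column_ok q f i j" "suffix_sum q f i 1 = 1"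
    using that assms scanned_step(1)[of j q i] by (auto simp: scanned_step j cells_ok_def row_ok_def)
  have tab: "tables f (scanned q (Suc i) q) s" using assms(3) by (simp add: scanned_step j)
  have zero: "suffix_sum q f (Suc i) (Suc q) = 0" by (simp add: suffix_sum_def)
  have "scan_inv p q f (Suc i) q (exec advance s)"
    using assms ok tab zero j unfolding scan_inv_def
    by (auto simp: advance_def check_row_def frame_def update_cell_def tables_def reported_def
        violation_reported_def Let_def)
  then show ?thesis using False by simp
qed

lemma exec_scan_step:
  assumes "scan_inv p q f i j s" "1 \<le> i" "i \<le> p" "1 \<le> j" "j \<le> q"
  shows "if 1 < j then scan_inv p q f i (j - 1) (exec scan_step s) else scan_inv p q f (Suc i) q (exec scan_step s)"
proof -
  let ?s1 = "exec add_cell s"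
  let ?s2 = "exec check_nonneg ?s1"
  let ?s3 = "exec check_column ?s2"
  let ?s4 = "exec fill_tables ?s3"
  have s: "frame p q f i j s" "snd s ''s'' [] = suffix_sum q f i (Suc j)" "tables f (scanned q i j) s"
    "reported p q f (cells_ok q f (scanned q i j)) s"
    using assms(1) by (auto simp: scan_inv_def)
  note 1 = exec_add_cell[OF s(1,2) assms(5)]
  note 2 = exec_check_nonneg[OF 1(1)]
  have s2: "snd ?s2 ''s'' [] = suffix_sum q f i j" "tables f (scanned q i j) ?s2"
    "reported p q f (cells_ok q f (scanned q i j) \<and> nonneg_ok q f i j) ?s2"
    using 1 2 s by auto
  note 3 = exec_check_column[OF 2(1) s2(1,2) assms(2-5)]
  have s3: "snd ?s3 ''s'' [] = suffix_sum q f i j" "tables f (scanned q i j) ?s3"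
    "reported p q f (cells_ok q f (scanned q i j) \<and> nonneg_ok q f i j \<and> column_ok q f i j) ?s3"
    using 3(2,3) 3(4)[OF s2(3)] s2 by (auto simp: conj_assoc)
  note 4 = exec_fill_tables[OF 3(1) s3(2) assms(2,4,5)]
  have s4: "snd ?s4 ''s'' [] = suffix_sum q f i j" "tables f (scanned q i (j - 1)) ?s4"
    "reported p q f (cells_ok q f (scanned q i j) \<and> nonneg_ok q f i j \<and> column_ok q f i j) ?s4"
    using 4 s3 scanned_step(1)[OF assms(4,5)] by auto
  show ?thesis using exec_advance[OF 4(1) s4 assms(2-5)] unfolding scan_step_def exec.simps .
qed

definition scan_state :: "nat \<Rightarrow> nat \<Rightarrow> (pos \<Rightarrow> rat) \<Rightarrow> store \<Rightarrow> bool" where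
  "scan_state p q f s \<longleftrightarrow> (\<exists>i j. scan_inv p q f i j s \<and> 1 \<le> i \<and> 1 \<le> j \<and> j \<le> q \<and> (i \<le> p \<or> i = Suc p \<and> j = q))"

text \<open>The number of cells still to be visited. Subtracting q at the end, rather than using p -
  h, yields 0 instead of q in the final state h = p + 1, l = q, despite truncated
  subtraction.\<close>

definition remaining :: "nat \<Rightarrow> nat \<Rightarrow> store \<Rightarrow> nat" where
  "remaining p q s = (Suc p - fst s ''h'' []) * q + fst s ''l'' [] - q"

lemma scan_state_step:
  assumes "scan_state p q f s" "bval s scan_guard"
  shows "scan_state p q f (exec scan_step s) \<and> remaining p q (exec scan_step s) < remaining p q s"
proof -
  obtain i j where ij: "scan_inv p q f i j s" "1 \<le> i" "1 \<le> j" "j \<le> q" and "i \<le> p \<or> i = Suc p \<and> j = q"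
    using assms(1) by (auto simp: scan_state_def)
  have hl: "fst s ''h'' [] = i" "fst s ''l'' [] = j" "fst s ''p'' [] = p"
    using ij(1) by (auto simp: scan_inv_def frame_def)
  have ip: "i \<le> p" using assms(2) hl by simp
  then obtain d where d: "Suc p - i = Suc d" "p - i = d" by (metis Suc_diff_le)
  note step = exec_scan_step[OF ij(1,2) ip ij(3,4)]
  show ?thesis
  proof (cases "1 < j")
    case True
    then have new: "scan_inv p q f i (j - 1) (exec scan_step s)" using step by simp
    then have "fst (exec scan_step s) ''h'' [] = i" "fst (exec scan_step s) ''l'' [] = j - 1"
      by (auto simp: scan_inv_def frame_def)
    then have "remaining p q (exec scan_step s) < remaining p q s"
      using True hl d by (simp add: remaining_def)
    moreover have "scan_state p q f (exec scan_step s)"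
      unfolding scan_state_def using new True ij ip by (intro exI[of _ i] exI[of _ "j - 1"]) auto
    ultimately show ?thesis by simp
  next
    case False
    then have new: "scan_inv p q f (Suc i) q (exec scan_step s)" using step by simp
    then have "fst (exec scan_step s) ''h'' [] = Suc i" "fst (exec scan_step s) ''l'' [] = q"
      by (auto simp: scan_inv_def frame_def)
    then have "remaining p q (exec scan_step s) < remaining p q s"
      using hl d ij by (simp add: remaining_def)
    moreover have "scan_state p q f (exec scan_step s)"
      unfolding scan_state_def using new ij ip by (intro exI[of _ "Suc i"] exI[of _ q]) auto
    ultimately show ?thesis by simp
  qed
qed

lemma scan_state_init:
  assumes "1 \<le> q"
  shows "scan_state p q (Poly_Mapping.lookup x) (exec scan_init (input_store p q x))"
    "remaining p q (exec scan_init (input_store p q x)) = p * q"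
proof -
  have "cells_ok q (Poly_Mapping.lookup x) (scanned q 1 q)" by (auto simp: cells_ok_def scanned_def)
  then have "scan_inv p q (Poly_Mapping.lookup x) 1 q (exec scan_init (input_store p q x))"
    by (auto simp: scan_inv_def scan_init_def input_store_def frame_def update_cell_def tables_def scanned_def
        suffix_sum_def reported_def)
  then show "scan_state p q (Poly_Mapping.lookup x) (exec scan_init (input_store p q x))"
    unfolding scan_state_def using assms by (intro exI[of _ 1] exI[of _ q]) auto
  show "remaining p q (exec scan_init (input_store p q x)) = p * q"
    by (simp add: remaining_def scan_init_def input_store_def update_cell_def)
qed

lemma scan_state_final:
  assumes "scan_state p q f s" "\<not> bval s scan_guard"
  shows "tables f ({..p} \<times> {1..q}) s" "reported p q f (cells_ok q f ({..p} \<times> {1..q})) s"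
proof -
  obtain i j where ij: "scan_inv p q f i j s" and "i \<le> p \<or> i = Suc p \<and> j = q"
    using assms(1) by (auto simp: scan_state_def)
  moreover have "fst s ''h'' [] = i" "fst s ''p'' [] = p" using ij by (auto simp: scan_inv_def frame_def)
  ultimately have "i = Suc p" "j = q" using assms(2) by auto
  moreover have "scanned q (Suc p) q = {..p} \<times> {1..q}" by (auto simp: scanned_def)
  ultimately show "tables f ({..p} \<times> {1..q}) s" "reported p q f (cells_ok q f ({..p} \<times> {1..q})) s"
    using ij by (auto simp: scan_inv_def)
qed

section \<open>Recovering a violated shifted column\<close>

text \<open>The k entries still to be written form the minimizer determined by v, and this agrees
  with the beginning of the complete one; the entries after k are already stored.\<close>

definition trace_inv :: "nat \<Rightarrow> nat \<Rightarrow> (pos \<Rightarrow> rat) \<Rightarrow> nat \<Rightarrow> nat \<Rightarrow> store \<Rightarrow> bool" where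
  "trace_inv p q f \<eta> j s \<longleftrightarrow>
    (let k = fst s ''k'' []; v = fst s ''v'' [] in
     tables f ({..p} \<times> {1..q}) s \<and> fst s ''answer'' [] = 3 \<and> fst s ''eta'' [] = \<eta> \<and> fst s ''j'' [] = j \<and>
     2 \<le> v \<and> v \<le> q \<and> v + k - 1 \<le> p \<and> k \<le> \<eta> \<and>
     (\<forall>l\<in>{1..k}. backtrack f k v l = backtrack f \<eta> (j - 1) l) \<and>
     (\<forall>l\<in>{k<..\<eta>}. fst s ''c'' [l] = backtrack f \<eta> (j - 1) l))"

lemma trace_inv_step:
  assumes "trace_inv p q f \<eta> j s" "bval s trace_guard"
  shows "trace_inv p q f \<eta> j (exec trace_step s) \<and> fst (exec trace_step s) ''k'' [] < fst s ''k'' []"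
proof -
  define v where "v = fst s ''v'' []"
  obtain k where k: "fst s ''k'' [] = Suc k" using assms(2) by (cases "fst s ''k'' []") auto
  have inv: "tables f ({..p} \<times> {1..q}) s" "2 \<le> v" "v \<le> q" "v + k \<le> p" "Suc k \<le> \<eta>"
    "\<And>l. l \<in> {1..Suc k} \<Longrightarrow> backtrack f (Suc k) v l = backtrack f \<eta> (j - 1) l"
    "\<And>l. l \<in> {Suc k<..\<eta>} \<Longrightarrow> fst s ''c'' [l] = backtrack f \<eta> (j - 1) l"
    "fst s ''answer'' [] = 3" "fst s ''eta'' [] = \<eta>" "fst s ''j'' [] = j"
    using assms(1) unfolding trace_inv_def Let_def k v_def[symmetric] by auto
  define u where "u = last_col f (v + k) v"
  have u: "2 \<le> u" "u \<le> v" using last_col_props[OF inv(2), of f k] by (auto simp: u_def)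
  have "fst s ''t'' [v + k, v] = u"
    using inv(1-4) by (auto simp: tables_def u_def)
  then have ex: "exec trace_step s = (update_cell (update_cell (update_cell (fst s) ''v'' [] u) ''c'' [Suc k] u) ''k'' [] k, snd s)"
    by (simp add: trace_step_def k v_def[symmetric] update_cell_def)
  have bt: "backtrack f (Suc k) v = (backtrack f k u)(Suc k := u)" by (simp add: u_def)
  have b1: "backtrack f k u l = backtrack f \<eta> (j - 1) l" if "l \<in> {1..k}" for l
    using inv(6)[of l] that unfolding bt by simp
  have b2: "u = backtrack f \<eta> (j - 1) (Suc k)" using inv(6)[of "Suc k"] unfolding bt by simp
  have "tables f ({..p} \<times> {1..q}) (exec trace_step s)"
    using inv(1) by (simp add: ex tables_def update_cell_def)
  moreover have "fst (exec trace_step s) ''c'' [l] = backtrack f \<eta> (j - 1) l" if "l \<in> {k<..\<eta>}" for l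
    using that inv(7)[of l] b2 by (cases "l = Suc k") (auto simp: ex update_cell_def)
  moreover have "fst (exec trace_step s) ''v'' [] = u" "fst (exec trace_step s) ''k'' [] = k"
    "fst (exec trace_step s) ''answer'' [] = 3" "fst (exec trace_step s) ''eta'' [] = \<eta>" "fst (exec trace_step s) ''j'' [] = j"
    using inv by (simp_all add: ex update_cell_def)
  ultimately show ?thesis using u inv b1 k unfolding trace_inv_def Let_def by auto
qed

lemma suffix_sum_bar:
  assumes "x \<in> coord_space p q"
  shows "suffix_sum q (Poly_Mapping.lookup x) i j = coord_sum x (bar q (i, j))"
  unfolding suffix_sum_def coord_sum_bar
  using lookup_outside[OF assms] by (intro sum.mono_neutral_right) (auto simp: index_set_def)

lemma separates_None:
  assumes x: "x \<in> coord_space p q" and ok: "cells_ok q (Poly_Mapping.lookup x) ({..p} \<times> {1..q})"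
    and con: "con \<in> orbitope_system p q" and q: "1 \<le> q"
  shows "satisfies x con"
proof -
  have cell: "nonneg_ok q (Poly_Mapping.lookup x) i j \<and> column_ok q (Poly_Mapping.lookup x) i j \<and> row_ok q (Poly_Mapping.lookup x) i j"
    if "i \<in> {1..p}" "j \<in> {1..q}" for i j
    using ok that by (auto simp: cells_ok_def)
  have tri: "lower_triangular (Poly_Mapping.lookup x)"
    using lookup_outside[OF x] by (auto simp: lower_triangular_def index_set_def)
  from con show ?thesis
  proof (cases rule: orbitope_system_cases)
    case (row i)
    then show ?thesis using cell[of i 1] q suffix_sum_bar[OF x, of i 1]
      by (simp add: row_ok_def coord_sum_row coord_sum_bar)
  next
    case (nonneg k)
    then show ?thesis using cell by (cases k) (auto simp: nonneg_ok_def index_set_def)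
  next
    case (col \<eta> j c)
    have "coord_sum x (bar q (i, j)) \<le> cheapest (Poly_Mapping.lookup x) (i - 1) (j - 1)"
      if "3 \<le> j \<and> j \<le> q \<and> j \<le> i \<and> i \<le> p" for i j
      using cell[of i j] that suffix_sum_bar[OF x, of i j] by (simp add: column_ok_def)
    then show ?thesis using shifted_column_constraints_iff[OF tri, of p q] col by blast
  qed
qed

lemma column_violation:
  assumes x: "x \<in> coord_space p q" and \<eta>: "1 \<le> \<eta>" and j: "3 \<le> j" "j \<le> q" "j + \<eta> - 1 \<le> p"
    and viol: "cheapest (Poly_Mapping.lookup x) (j + \<eta> - 2) (j - 1) < suffix_sum q (Poly_Mapping.lookup x) (j + \<eta> - 1) j"
    and c: "\<And>k. k \<in> {1..\<eta>} \<Longrightarrow> c k = backtrack (Poly_Mapping.lookup x) \<eta> (j - 1) k"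
  shows "Diff_Nonpos (bar q (diag_coord \<eta> j)) (shifted_column \<eta> c) \<in> orbitope_system p q"
    "\<not> satisfies x (Diff_Nonpos (bar q (diag_coord \<eta> j)) (shifted_column \<eta> c))"
proof -
  let ?c = "backtrack (Poly_Mapping.lookup x) \<eta> (j - 1)"
  have tri: "lower_triangular (Poly_Mapping.lookup x)"
    using lookup_outside[OF x] by (auto simp: lower_triangular_def index_set_def)
  note B = backtrack_admissible[OF tri \<eta> j(1)]
  have sc: "shifted_column \<eta> c = shifted_column \<eta> ?c" using c unfolding shifted_column_def by force
  have "diag_coord \<eta> j \<in> index_set p q" using diag_coord_mem_iff[OF \<eta>] j by auto
  then show "Diff_Nonpos (bar q (diag_coord \<eta> j)) (shifted_column \<eta> c) \<in> orbitope_system p q"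
    unfolding sc orbitope_system_def using B(1) \<eta> j
    by (intro UnI2 CollectI exI[of _ \<eta>] exI[of _ j] exI[of _ ?c]) auto
  have "admissible_path \<eta> ?c" using B(1) admissible_columns_iff[OF \<eta>, of j] j by auto
  then show "\<not> satisfies x (Diff_Nonpos (bar q (diag_coord \<eta> j)) (shifted_column \<eta> c))"
    using viol B(2) unfolding sc by (simp add: coord_sum_shifted_column diag_coord_def suffix_sum_bar[OF x])
qed

lemma separation_program_correct:
  assumes q: "2 \<le> q" "q \<le> p" and x: "x \<in> coord_space p q"
  obtains t s where "runs separation_program (input_store p q x) t s"
    "separates (orbitope_system p q) x (output_constraint q s)"
    "t \<le> cost_bound scan_init + (p * q + 1) * (1 + bcost scan_guard + cost_bound scan_step)
      + (1 + bcost answer_guard + (cost_bound trace_init + (p + 1) * (1 + bcost trace_guard + cost_bound trace_step) + 1))"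
proof -
  let ?f = "Poly_Mapping.lookup x"
  let ?s0 = "input_store p q x"
  let ?s1 = "exec scan_init ?s0"
  have q1: "1 \<le> q" using q by simp
  obtain t1 where t1: "t1 \<le> cost_bound scan_init" "runs scan_init ?s0 t1 ?s1"
    using runs_exec[OF loop_free_steps(3)] by blast
  obtain t2 s2 where t2: "runs (While scan_guard scan_step) ?s1 t2 s2"
    "t2 \<le> (p * q + 1) * (1 + bcost scan_guard + cost_bound scan_step)"
    "scan_state p q ?f s2" "\<not> bval s2 scan_guard"
    using runs_while[where I = "scan_state p q ?f" and m = "remaining p q", OF loop_free_steps(1) scan_state_init(1)[OF q1]
        scan_state_step] scan_state_init(2)[OF q1, of p x] by metis
  note final = scan_state_final[OF t2(3,4)]
  let ?tail = "Cond answer_guard (Seq trace_init (While trace_guard trace_step)) Skip"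
  let ?T = "1 + bcost answer_guard + (cost_bound trace_init + (p + 1) * (1 + bcost trace_guard + cost_bound trace_step) + 1)"
  have "\<exists>t3 s3. runs ?tail s2 t3 s3 \<and> t3 \<le> ?T \<and> separates (orbitope_system p q) x (output_constraint q s3)"
  proof (cases "fst s2 ''answer'' [] = 3")
    case False
    have "separates (orbitope_system p q) x (output_constraint q s2)"
    proof (cases "fst s2 ''answer'' [] = 0")
      case True
      then have "cells_ok q ?f ({..p} \<times> {1..q})"
        using final(2) by (auto simp: reported_def violation_reported_def Let_def)
      then show ?thesis
        using separates_None[OF x _ _ q1] True by (simp add: separates_def output_constraint_def)
    next
      case nz: False
      then consider (row) "fst s2 ''answer'' [] = 1" "fst s2 ''i'' [] \<in> {1..p}" "suffix_sum q ?f (fst s2 ''i'' []) 1 \<noteq> 1"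
        | (nonneg) "fst s2 ''answer'' [] = 2" "\<not> nonneg_ok q ?f (fst s2 ''i'' []) (fst s2 ''j'' [])"
        using final(2) False by (auto simp: reported_def violation_reported_def Let_def)
      then show ?thesis
      proof cases
        case row
        then show ?thesis using suffix_sum_bar[OF x, of "fst s2 ''i'' []" 1]
          by (auto simp: separates_def output_constraint_def orbitope_system_def coord_sum_row coord_sum_bar)
      next
        case nonneg
        \<comment> \<open>Outside the index set x is 0, so a negative entry is a genuine
          coordinate.\<close>
        then have "(fst s2 ''i'' [], fst s2 ''j'' []) \<in> index_set p q"
          using lookup_outside[OF x, of "fst s2 ''i'' []" "fst s2 ''j'' []"] by (auto simp: nonneg_ok_def)
        then show ?thesis using nonneg
          by (auto simp: separates_def output_constraint_def orbitope_system_def nonneg_ok_def)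
      qed
    qed
    moreover have "runs ?tail s2 (1 + bcost answer_guard + 1) s2"
      using False by (intro runs.IfFalse runs.Skip) simp
    ultimately show ?thesis by (intro exI[of _ "1 + bcost answer_guard + 1"] exI[of _ s2]) simp
  next
    case True
    define \<eta> where "\<eta> = fst s2 ''eta'' []"
    define j where "j = fst s2 ''j'' []"
    have viol: "1 \<le> \<eta>" "3 \<le> j" "j \<le> q" "j + \<eta> - 1 \<le> p"
      "cheapest ?f (j + \<eta> - 2) (j - 1) < suffix_sum q ?f (j + \<eta> - 1) j"
      using final(2) True by (auto simp: reported_def violation_reported_def Let_def \<eta>_def j_def)
    let ?s = "exec trace_init s2"
    have ex: "?s = (update_cell (update_cell (fst s2) ''k'' [] \<eta>) ''v'' [] (j - 1), snd s2)"
      by (simp add: trace_init_def \<eta>_def j_def update_cell_def)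
    have "tables ?f ({..p} \<times> {1..q}) ?s"
      using final(1) by (simp add: ex tables_def update_cell_def)
    then have inv: "trace_inv p q ?f \<eta> j ?s" "fst ?s ''k'' [] = \<eta>"
      using viol True unfolding trace_inv_def Let_def
      by (auto simp: ex update_cell_def \<eta>_def[symmetric] j_def[symmetric])
    obtain t4 where t4: "t4 \<le> cost_bound trace_init" "runs trace_init s2 t4 ?s"
      using runs_exec[OF loop_free_steps(4)] by blast
    obtain t5 s3 where t5: "runs (While trace_guard trace_step) ?s t5 s3"
      "t5 \<le> (\<eta> + 1) * (1 + bcost trace_guard + cost_bound trace_step)"
      "trace_inv p q ?f \<eta> j s3" "\<not> bval s3 trace_guard"
      using runs_while[where I = "trace_inv p q ?f \<eta> j" and m = "\<lambda>s. fst s ''k'' []", OF loop_free_steps(2) inv(1)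
          trace_inv_step] inv(2) by metis
    have s3: "fst s3 ''answer'' [] = 3" "fst s3 ''eta'' [] = \<eta>" "fst s3 ''j'' [] = j"
      "\<And>l. l \<in> {1..\<eta>} \<Longrightarrow> fst s3 ''c'' [l] = backtrack ?f \<eta> (j - 1) l"
      using t5(3,4) by (auto simp: trace_inv_def Let_def)
    have "separates (orbitope_system p q) x (output_constraint q s3)"
      using column_violation[OF x viol, of "\<lambda>k. fst s3 ''c'' [k]"] s3
      by (simp add: separates_def output_constraint_def)
    moreover have "runs ?tail s2 (1 + bcost answer_guard + (t4 + t5)) s3"
      using True by (intro runs.IfTrue runs.Seq[OF t4(2) t5(1)]) simp
    moreover have "t5 \<le> (p + 1) * (1 + bcost trace_guard + cost_bound trace_step)"
      by (rule le_trans[OF t5(2)], rule mult_le_mono1) (use viol in simp)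
    then have "1 + bcost answer_guard + (t4 + t5) \<le> ?T" using t4(1) by linarith
    ultimately show ?thesis by blast
  qed
  then obtain t3 s3 where t3: "runs ?tail s2 t3 s3" "t3 \<le> ?T" "separates (orbitope_system p q) x (output_constraint q s3)"
    by blast
  show thesis
  proof (rule that)
    show "runs separation_program ?s0 (t1 + (t2 + t3)) s3"
      unfolding separation_program_def by (intro runs.Seq[OF t1(2)] runs.Seq[OF t2(1)] t3(1))
    show "t1 + (t2 + t3) \<le> cost_bound scan_init + (p * q + 1) * (1 + bcost scan_guard + cost_bound scan_step) + ?T"
      using t1(1) t2(2) t3(2) by linarith
  qed (rule t3(3))
qed

text \<open>All costs besides p and q depend on the program text only; the additive terms are
  absorbed using pq + 1 \<le> 2pq and p + 1 \<le> 2pq.\<close>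

lemma separation_in_linear_time:
  "\<exists>prog C. \<forall>p q. 2 \<le> q \<and> q \<le> p \<longrightarrow>
    (\<forall>x\<in>coord_space p q. solves_separation_within prog p q x (C * (p * q)))"
proof -
  define A where "A = cost_bound scan_init"
  define B where "B = 1 + bcost scan_guard + cost_bound scan_step"
  define D where "D = 1 + bcost answer_guard + cost_bound trace_init + 1"
  define E where "E = 1 + bcost trace_guard + cost_bound trace_step"
  have "solves_separation_within separation_program p q x ((A + 2 * B + D + 2 * E) * (p * q))"
    if pq: "2 \<le> q" "q \<le> p" and x: "x \<in> coord_space p q" for p q x
  proof -
    obtain t s where ts: "runs separation_program (input_store p q x) t s"
      "separates (orbitope_system p q) x (output_constraint q s)"
      "t \<le> A + (p * q + 1) * B + (1 + bcost answer_guard + (cost_bound trace_init + (p + 1) * E + 1))"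
      using separation_program_correct[OF pq x] unfolding A_def B_def E_def by blast
    have "t \<le> A + (p * q + 1) * B + (D + (p + 1) * E)" using ts(3) unfolding D_def by linarith
    define N where "N = p * q"
    have N: "1 \<le> N" "p + 1 \<le> 2 * N"
    proof -
      show N1: "1 \<le> N" using pq by (simp add: N_def)
      have "p \<le> N" using pq by (simp add: N_def)
      then show "p + 1 \<le> 2 * N" using N1 by linarith
    qed
    have "A \<le> A * N" "D \<le> D * N" "(N + 1) * B \<le> 2 * N * B" "(p + 1) * E \<le> 2 * N * E"
      using mult_le_mono2[OF N(1), of A] mult_le_mono2[OF N(1), of D]
        mult_le_mono1[of "N + 1" "2 * N" B] mult_le_mono1[OF N(2), of E] N(1)
      by (simp_all only: mult_1_right)
    moreover have "(A + 2 * B + D + 2 * E) * N = A * N + 2 * N * B + D * N + 2 * N * E"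
      by (simp add: algebra_simps)
    ultimately have le: "A + (p * q + 1) * B + (D + (p + 1) * E) \<le> (A + 2 * B + D + 2 * E) * (p * q)"
      unfolding N_def[symmetric] by linarith
    show ?thesis unfolding solves_separation_within_def
      using ts(1,2) le_trans[OF \<open>t \<le> A + (p * q + 1) * B + (D + (p + 1) * E)\<close> le] by blast
  qed
  then show ?thesis by blast
qed

theorem theorem16:
  shows "(\<forall>p q. 2 \<le> q \<and> q \<le> p \<longrightarrow>
            partitioning_orbitope p q = solution_set p q (orbitope_system p q) \<and>
            nonredundant p q (orbitope_system p q)) \<and>
         (\<exists>prog C. \<forall>p q. 2 \<le> q \<and> q \<le> p \<longrightarrow>
            (\<forall>x\<in>coord_space p q. solves_separation_within prog p q x (C * (p * q))))"
  using partitioning_orbitope_eq_solution_set orbitope_system_nonredundant separation_in_linear_time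
  by blast

end
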